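(* Let $R_0$ be a given positive number, and let $y(c,\sigma,x)$ be the meromorphic solution of the fifth Painlevé equation described in the context. (1) Suppose that $\theta_x(\theta_0\pm\theta_x-\theta_\infty)\neq0$. Then there exists a small positive number $\varepsilon_0=\varepsilon_0(R_0)=\varepsilon_0(R_0,\theta_0,\theta_x,\theta_\infty)$ such that, for every $(c,\sigma)\in\mathbb C^2$ satisfying $0<|c|<R_0$, $\sigma\neq\pm2\theta_0+\theta_\infty,\ \pm2\theta_x-\theta_\infty$, $|\sigma+2\theta_x+\theta_\infty|<R_0|c|$ (respectively, $|\sigma+2\theta_0-\theta_\infty|<R_0|c|$) and $|4c/(\sigma+2\theta_0-\theta_\infty)|<\varepsilon_0$ (respectively, $|4c/(\sigma+2\theta_x+\theta_\infty)|<\varepsilon_0$), the solution $y(c,\sigma,x)$ has a sequence of zeros $\{x^{(0)}_m\}$, $m\ge m_0$, such that $$x_m^{(0)}=2m\pi i-(\sigma+1)\log(2m\pi i)-\log(\rho_0(\sigma)c)+O(m^{-1}\log m),$$ where $m_0$ is some large positive integer and $\rho_0(\sigma)=-4/(\sigma+2\theta_0-\theta_\infty)$ (respectively, $-4/(\sigma+2\theta_x+\theta_\infty)$). (2) Suppose that $\theta_0(\pm\theta_0-\theta_x+\theta_\infty)\neq0$. Then there exists a small positive number $\varepsilon'_0=\varepsilon'_0(R_0)=\varepsilon_0'(R_0,\theta_0,\theta_x,\theta_\infty)$ such that, for every $(c,\sigma)\in\mathbb C^2$ satisfying $|c|>1/R_0$, $\sigma\neq\pm2\theta_0+\theta_\infty,\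 \pm2\theta_x-\theta_\infty$, $|c(\sigma-2\theta_0-\theta_\infty)|<R_0$ (respectively, $|c(\sigma-2\theta_x+\theta_\infty)|<R_0$) and $|4c^{-1}/(\sigma-2\theta_x+\theta_\infty)|<\varepsilon_0'$ (respectively, $|4c^{-1}/(\sigma-2\theta_0-\theta_\infty)|<\varepsilon'_0$), the solution $y(c,\sigma,x)$ has a sequence of poles $\{x_m^{(\infty)}\}$, $m\ge m_0$, such that $$x_m^{(\infty)}=2m\pi i-(\sigma-1)\log(2m\pi i)-\log(\rho_\infty(\sigma)c)+O(m^{-1}\log m),$$ where $m_0$ is some large positive integer and $\rho_\infty(\sigma)=-(\sigma-2\theta_x+\theta_\infty)/4$ (respectively, $-(\sigma-2\theta_0-\theta_\infty)/4$).
   Context: $\theta_0,\theta_x,\theta_\infty\in\mathbb C$ are fixed and $0<\delta<\pi/2$ is given. "$\pm$" in a condition means the condition holds for both signs. The fifth Painlevé equation is $$\frac{d^2y}{dx^2}=\Big(\frac1{2y}+\frac1{y-1}\Big)\Big(\frac{dy}{dx}\Big)^2-\frac1x\frac{dy}{dx}+\frac{(y-1)^2}{8x^2}\Big((\theta_0-\theta_x+\theta_\infty)^2y-\frac{(\theta_0-\theta_x-\theta_\infty)^2}y\Big)+(1-\theta_0-\theta_x)\frac yx-\frac{y(y+1)}{2(y-1)}.$$ **The solution $y(c,\sigma,x)$.** With $J=\mathrm{diag}[1,-1]$, $\Delta_+=\begin{pmatrix}0&1\\0&0\end{pmatrix}$, $\Delta_-=\begin{pmatrix}0&0\\1&0\end{pmatrix}$,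 the system $x\,dA_0/dx=[A_x,A_0]$, $x\,dA_x/dx=[A_0,A_x]+\frac x2[J,A_x]$ has, for $(c_0,c_x,\sigma)$ in any given bounded parameter domain $B_0\times B_x\times B_*$ (closures of $B_0,B_x$ in $\mathbb C\setminus\{0\}$) and for some small $\varepsilon>0$, large $x_\infty>\varepsilon^{-1}$ depending on that domain and $\delta$, solutions $A_0=f_0J+f_+\Delta_++f_-\Delta_-$, $A_x=g_0J+g_+\Delta_++g_-\Delta_-$, with $A_0$, $A_x$ having eigenvalues $\pm\theta_0/2$, $\pm\theta_x/2$ and $(A_0+A_x)_{11}=-(A_0+A_x)_{22}\equiv-\theta_\infty/2$, holomorphic in $(c_0,c_x,\sigma,x)$ for $x$ in the domain $\Sigma(\sigma,\varepsilon,x_\infty,\delta)$ (in the universal covering of $\mathbb C\setminus\{0\}$): $|\arg x-\pi/2|<\pi/2-\delta$, $|e^xx^{\sigma-1}|<\varepsilon$, $|e^{-x}x^{-\sigma-1}|<\varepsilon$, $|x|>x_\infty$, and given there by the convergent series $$\begin{aligned} f_0={}&\tfrac{\sigma-\theta_\infty}4-\tfrac12\big((\sigma+\theta_\infty)\gamma^0_+\gamma^0_-+(\sigma-\theta_\infty)\gamma^x_+\gamma^x_-\big)x^{-2}+[x^{-3}]\\ &+\gamma^0_-\gamma^x_+(1+[x^{-1}])e^xx^{\sigma-1}+\sum_{n\ge2}(\gamma^0_-\gamma^x_+)^n[x^{-n+1}](e^xx^{\sigma-1})^n\\ &+\gamma^0_+\gamma^x_-(1+[x^{-1}])e^{-x}x^{-\sigma-1}+\sum_{n\ge2}(\gamma^0_+\gamma^x_-)^n[x^{-n+1}](e^{-x}x^{-\sigma-1})^n,\qquad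 g_0=-\theta_\infty/2-f_0,\\ x^{(\sigma+\theta_\infty)/2}f_+={}&\gamma^0_+(1+[x^{-1}])-\gamma^x_+\big(\tfrac{\sigma-\theta_\infty}2+[x^{-1}]\big)e^xx^{\sigma-1}-\gamma^0_-(\gamma^x_+)^2(1+[x^{-1}])(e^xx^{\sigma-1})^2\\ &+\sum_{n\ge3}\gamma^x_+(\gamma^0_-\gamma^x_+)^{n-1}[x^{-n+2}](e^xx^{\sigma-1})^n+2(\gamma^0_+)^2\gamma^x_-(1+[x^{-1}])e^{-x}x^{-\sigma-2}\\ &+\sum_{n\ge2}\gamma^0_+(\gamma^0_+\gamma^x_-)^n[x^{-n}](e^{-x}x^{-\sigma-1})^n,\\ e^{-x}x^{-(\sigma-\theta_\infty)/2}g_+={}&\gamma^x_+(1+[x^{-1}])+2\gamma^0_-(\gamma^x_+)^2(1+[x^{-1}])e^xx^{\sigma-2}+\sum_{n\ge2}\gamma^x_+(\gamma^0_-\gamma^x_+)^n[x^{-n}](e^xx^{\sigma-1})^n\\ &-\gamma^0_+\big(\tfrac{\sigma+\theta_\infty}2+[x^{-1}]\big)e^{-x}x^{-\sigma-1}-(\gamma^0_+)^2\gamma^x_-(1+[x^{-1}])(e^{-x}x^{-\sigma-1})^2\\ &+\sum_{n\ge3}\gamma^0_+(\gamma^0_+\gamma^x_-)^{n-1}[x^{-n+2}](e^{-x}x^{-\sigma-1})^n,\\ x^{-(\sigma+\theta_\infty)/2}f_-={}&\gamma^0_-(1+[x^{-1}])+2(\gamma^0_-)^2\gamma^x_+(1+[x^{-1}])e^xx^{\sigma-2}+\sum_{n\ge2}\gamma^0_-(\gamma^0_-\gamma^x_+)^n[x^{-n}](e^xx^{\sigma-1})^n\\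 &-\gamma^x_-\big(\tfrac{\sigma-\theta_\infty}2+[x^{-1}]\big)e^{-x}x^{-\sigma-1}-\gamma^0_+(\gamma^x_-)^2(1+[x^{-1}])(e^{-x}x^{-\sigma-1})^2\\ &+\sum_{n\ge3}\gamma^x_-(\gamma^0_+\gamma^x_-)^{n-1}[x^{-n+2}](e^{-x}x^{-\sigma-1})^n,\\ e^xx^{(\sigma-\theta_\infty)/2}g_-={}&\gamma^x_-(1+[x^{-1}])-\gamma^0_-\big(\tfrac{\sigma+\theta_\infty}2+[x^{-1}]\big)e^xx^{\sigma-1}-(\gamma^0_-)^2\gamma^x_+(1+[x^{-1}])(e^xx^{\sigma-1})^2\\ &+\sum_{n\ge3}\gamma^0_-(\gamma^0_-\gamma^x_+)^{n-1}[x^{-n+2}](e^xx^{\sigma-1})^n+2\gamma^0_+(\gamma^x_-)^2(1+[x^{-1}])e^{-x}x^{-\sigma-2}\\ &+\sum_{n\ge2}\gamma^x_-(\gamma^0_+\gamma^x_-)^n[x^{-n}](e^{-x}x^{-\sigma-1})^n, \end{aligned}$$ where $\gamma^0_+=\frac{c_0}4(\sigma+2\theta_0-\theta_\infty)$, $\gamma^0_-=\frac{c_0^{-1}}4(-\sigma+2\theta_0+\theta_\infty)$, $\gamma^x_+=\frac{c_x}4(-\sigma+2\theta_x-\theta_\infty)$, $\gamma^x_-=\frac{c_x^{-1}}4(\sigma+2\theta_x+\theta_\infty)$, and $[x^{-k}]$ denotes a holomorphic function (possibly different at each occurrence) with an asymptotic representation $x^{-k}\sum_{j\ge0}f_jx^{-j}$,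 $f_j\in\mathbb Q[\theta_0,\theta_x,\theta_\infty,c_0,c_0^{-1},c_x,c_x^{-1},\sigma]$, uniformly in the parameters as $x\to\infty$ through $|\arg x-\pi/2|<\pi/2-\delta$, $|x|>x_\infty$. More precisely, $\varepsilon$ may be any positive number such that, throughout the parameter domain, $$\big(|\gamma^0_-\gamma^x_+|+|\gamma^0_+\gamma^x_-|+|\gamma^0_+|+|\gamma^0_-|+|\gamma^x_+|+|\gamma^x_-|+1\big)\big(|\gamma^0_+|+|\gamma^0_-|+|\gamma^x_+|+|\gamma^x_-|+1\big)\varepsilon\le r_0(\delta),$$ $r_0(\delta)<1$ being a sufficiently small positive number depending on $\delta$. Then $$y=\frac{g_+\,(f_0+\theta_0/2)}{f_+\,(g_0+\theta_x/2)}$$ is a meromorphic solution of the fifth Painlevé equation on $\Sigma(\sigma,\varepsilon,x_\infty,\delta)$; it depends on $(c_0,c_x)$ only through $c=c_x/c_0$, and it is denoted $y(c,\sigma,x)$ (for given $(c,\sigma)$ one may use any $(c_0,c_x)$ with $c_x/c_0=c$, e.g. $(1,c)$ or $(1/c,1)$, on the corresponding domain). *)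

theory Defs
  imports "HOL-Complex_Analysis.Complex_Analysis" "HOL-Library.Landau_Symbols"
begin

text \<open>A parameter is a triple \<open>(c0, cx, \<sigma>)\<close>.\<close>

type_synonym param = "complex \<times> complex \<times> complex"

definition holomorphic_in_all :: "(param \<Rightarrow> complex \<Rightarrow> complex) \<Rightarrow> (param \<times> complex) set \<Rightarrow> bool" where
  "holomorphic_in_all f S \<longleftrightarrow> (\<forall>q\<in>S. \<exists>d0 dx ds d.
     ((\<lambda>(p, x). f p x) has_derivative
        (\<lambda>((h0, hx, hs), h). d0 * h0 + dx * hx + ds * hs + d * h)) (at q))"

text \<open>
  All arguments \<open>arg x\<close> that occur lie in \<open>(\<delta>, \<pi> - \<delta>)\<close>, so the sheet of the universal covering of
  \<open>\<complex> - {0}\<close> in question is the upper half plane with the principal branches of \<open>Arg\<close>, \<open>Ln\<close>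
  and \<open>powr\<close>.
\<close>

definition sector :: "real \<Rightarrow> real \<Rightarrow> complex set" where
  "sector \<delta> X = {x. x \<noteq> 0 \<and> \<bar>Arg x - pi / 2\<bar> < pi / 2 - \<delta> \<and> cmod x > X}"

definition xi :: "complex \<Rightarrow> complex \<Rightarrow> complex" where
  "xi \<sigma> x = exp x * x powr (\<sigma> - 1)"

definition eta :: "complex \<Rightarrow> complex \<Rightarrow> complex" where
  "eta \<sigma> x = exp (- x) * x powr (- \<sigma> - 1)"

definition Sigma_dom :: "complex \<Rightarrow> real \<Rightarrow> real \<Rightarrow> real \<Rightarrow> complex set" where
  "Sigma_dom \<sigma> \<epsilon> X \<delta> = {x \<in> sector \<delta> X. cmod (xi \<sigma> x) < \<epsilon> \<and> cmod (eta \<sigma> x) < \<epsilon>}"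

definition absolutely_uniformly_summable_from ::
    "nat \<Rightarrow> 'a set \<Rightarrow> (nat \<Rightarrow> 'a \<Rightarrow> complex) \<Rightarrow> bool" where
  "absolutely_uniformly_summable_from n0 D t \<longleftrightarrow>
     uniformly_convergent_on D (\<lambda>N q. \<Sum>n=n0..<n0 + N. norm (t n q))"

text \<open>\<open>traceless a b c\<close> is \<open>a J + b \<Delta>\<^sub>+ + c \<Delta>\<^sub>-\<close>.\<close>

definition traceless :: "complex \<Rightarrow> complex \<Rightarrow> complex \<Rightarrow> complex^2^2" where
  "traceless a b c = vector [vector [a, b], vector [c, - a]]"

definition J_mat :: "complex^2^2" where
  "J_mat = traceless 1 0 0"

definition commutator :: "complex^2^2 \<Rightarrow> complex^2^2 \<Rightarrow> complex^2^2" where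
  "commutator A B = A ** B - B ** A"

text \<open>The eigenvalues, counted with multiplicity, via the characteristic polynomial.\<close>

definition has_eigenvalues :: "complex^2^2 \<Rightarrow> complex \<Rightarrow> complex \<Rightarrow> bool" where
  "has_eigenvalues A u v \<longleftrightarrow> (\<forall>z. det (mat z - A) = (z - u) * (z - v))"

context
  fixes \<theta>0 \<theta>x \<theta>inf :: complex
begin

definition painleve5_at :: "(complex \<Rightarrow> complex) \<Rightarrow> complex \<Rightarrow> bool" where
  "painleve5_at y x \<longleftrightarrow>
     deriv (deriv y) x =
       (1 / (2 * y x) + 1 / (y x - 1)) * (deriv y x)\<^sup>2 - deriv y x / x
       + (y x - 1)\<^sup>2 / (8 * x\<^sup>2)
           * ((\<theta>0 - \<theta>x + \<theta>inf)\<^sup>2 * y x - (\<theta>0 - \<theta>x - \<theta>inf)\<^sup>2 / y x)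
       + (1 - \<theta>0 - \<theta>x) * y x / x - y x * (y x + 1) / (2 * (y x - 1))"

text \<open>
  The value that a function assigns to one of its poles or removable singularities is irrelevant,
  and the right-hand side of the equation only makes sense where \<open>y\<close> differs from \<open>0\<close> and \<open>1\<close>.
\<close>

definition meromorphic_painleve5_solution_on :: "(complex \<Rightarrow> complex) \<Rightarrow> complex set \<Rightarrow> bool" where
  "meromorphic_painleve5_solution_on y S \<longleftrightarrow> y meromorphic_on S \<and>
     (\<forall>x\<in>S. y analytic_on {x} \<and> y x \<noteq> 0 \<and> y x \<noteq> 1 \<longrightarrow> painleve5_at y x)"

definition gamma0p :: "param \<Rightarrow> complex" where
  "gamma0p = (\<lambda>(c0, cx, \<sigma>). c0 / 4 * (\<sigma> + 2 * \<theta>0 - \<theta>inf))"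

definition gamma0m :: "param \<Rightarrow> complex" where
  "gamma0m = (\<lambda>(c0, cx, \<sigma>). inverse c0 / 4 * (- \<sigma> + 2 * \<theta>0 + \<theta>inf))"

definition gammaxp :: "param \<Rightarrow> complex" where
  "gammaxp = (\<lambda>(c0, cx, \<sigma>). cx / 4 * (- \<sigma> + 2 * \<theta>x - \<theta>inf))"

definition gammaxm :: "param \<Rightarrow> complex" where
  "gammaxm = (\<lambda>(c0, cx, \<sigma>). inverse cx / 4 * (\<sigma> + 2 * \<theta>x + \<theta>inf))"

definition Gamma_xi :: "param \<Rightarrow> complex" where
  "Gamma_xi p = gamma0m p * gammaxp p"

definition Gamma_eta :: "param \<Rightarrow> complex" where
  "Gamma_eta p = gamma0p p * gammaxm p"

definition param_domain :: "complex set \<Rightarrow> complex set \<Rightarrow> complex set \<Rightarrow> bool" where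
  "param_domain B0 Bx Bs \<longleftrightarrow>
     (\<forall>B\<in>{B0, Bx, Bs}. open B \<and> connected B \<and> B \<noteq> {} \<and> bounded B) \<and>
     0 \<notin> closure B0 \<and> 0 \<notin> closure Bx"

definition admissible_eps :: "real \<Rightarrow> param set \<Rightarrow> real \<Rightarrow> bool" where
  "admissible_eps r0 P \<epsilon> \<longleftrightarrow> \<epsilon> > 0 \<and> (\<forall>p\<in>P.
     (cmod (Gamma_xi p) + cmod (Gamma_eta p)
       + cmod (gamma0p p) + cmod (gamma0m p) + cmod (gammaxp p) + cmod (gammaxm p) + 1)
     * (cmod (gamma0p p) + cmod (gamma0m p) + cmod (gammaxp p) + cmod (gammaxm p) + 1) * \<epsilon> \<le> r0)"

text \<open>
  The functions of the parameter given by the elements of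
  \<open>\<rat>[\<theta>0, \<theta>x, \<theta>inf, c0, 1/c0, cx, 1/cx, \<sigma>]\<close>.
\<close>

inductive_set coeff_ring :: "(param \<Rightarrow> complex) set" where
  "r \<in> \<rat> \<Longrightarrow> (\<lambda>_. r) \<in> coeff_ring"
| "t \<in> {\<theta>0, \<theta>x, \<theta>inf} \<Longrightarrow> (\<lambda>_. t) \<in> coeff_ring"
| "(\<lambda>(c0, cx, \<sigma>). c0) \<in> coeff_ring"
| "(\<lambda>(c0, cx, \<sigma>). inverse c0) \<in> coeff_ring"
| "(\<lambda>(c0, cx, \<sigma>). cx) \<in> coeff_ring"
| "(\<lambda>(c0, cx, \<sigma>). inverse cx) \<in> coeff_ring"
| "(\<lambda>(c0, cx, \<sigma>). \<sigma>) \<in> coeff_ring"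
| "f \<in> coeff_ring \<Longrightarrow> g \<in> coeff_ring \<Longrightarrow> (\<lambda>p. f p + g p) \<in> coeff_ring"
| "f \<in> coeff_ring \<Longrightarrow> g \<in> coeff_ring \<Longrightarrow> (\<lambda>p. f p * g p) \<in> coeff_ring"

context
  fixes \<delta> :: real and P :: "param set" and \<epsilon> X :: real
begin

definition full_dom :: "(param \<times> complex) set" where
  "full_dom = {((c0, cx, \<sigma>), x) | c0 cx \<sigma> x. (c0, cx, \<sigma>) \<in> P \<and> x \<in> Sigma_dom \<sigma> \<epsilon> X \<delta>}"

text \<open>The class written \<open>[x\<^sup>-\<^sup>k]\<close>.\<close>

definition bracket :: "nat \<Rightarrow> (param \<Rightarrow> complex \<Rightarrow> complex) set" where
  "bracket k = {a. holomorphic_in_all a (P \<times> sector \<delta> X) \<and>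
     (\<exists>f. (\<forall>j. f j \<in> coeff_ring) \<and>
        (\<forall>N::nat. \<exists>C R. \<forall>p\<in>P. \<forall>x\<in>sector \<delta> X. cmod x > R \<longrightarrow>
            cmod (x ^ k * a p x - (\<Sum>j<N. f j p / x ^ j)) \<le> C / cmod x ^ N))}"

text \<open>
  \<open>tail n0 g k w\<close> consists of the sums \<open>\<Sum>n\<ge>n0. g n [x\<^sup>-\<^sup>k\<^sup>(\<^sup>n\<^sup>)] w\<^sup>n\<close>. The convergence is absolute and
  uniform on the whole domain: as the asymptotic representations of the individual
  coefficients need not be uniform in \<open>n\<close>, a merely pointwise convergent series would carry no
  information about the behaviour of its sum as \<open>x \<rightarrow> \<infinity>\<close>.
\<close>

definition tail ::
    "nat \<Rightarrow> (nat \<Rightarrow> param \<Rightarrow> complex) \<Rightarrow> (nat \<Rightarrow> nat) \<Rightarrow> (complex \<Rightarrow> complex \<Rightarrow> complex)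
     \<Rightarrow> (param \<Rightarrow> complex \<Rightarrow> complex) set" where
  "tail n0 g k w = {h. \<exists>b. (\<forall>n\<ge>n0. b n \<in> bracket (k n)) \<and>
     (let t = (\<lambda>n ((c0, cx, \<sigma>), x). g n (c0, cx, \<sigma>) * b n (c0, cx, \<sigma>) x * w \<sigma> x ^ n) in
        absolutely_uniformly_summable_from n0 full_dom t \<and>
        (\<forall>(p, x)\<in>full_dom. h p x = (\<Sum>n. t (n + n0) (p, x))))}"

definition f0_series :: "(param \<Rightarrow> complex \<Rightarrow> complex) \<Rightarrow> bool" where
  "f0_series f0 \<longleftrightarrow>
     (\<exists>a\<in>bracket 3. \<exists>a1\<in>bracket 1. \<exists>b1\<in>bracket 1.
      \<exists>A\<in>tail 2 (\<lambda>n p. Gamma_xi p ^ n) (\<lambda>n. n - 1) xi.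
      \<exists>B\<in>tail 2 (\<lambda>n p. Gamma_eta p ^ n) (\<lambda>n. n - 1) eta.
      \<forall>(p, x)\<in>full_dom. let \<sigma> = snd (snd p) in
        f0 p x = (\<sigma> - \<theta>inf) / 4
          - 1/2 * ((\<sigma> + \<theta>inf) * gamma0p p * gamma0m p + (\<sigma> - \<theta>inf) * gammaxp p * gammaxm p) / x\<^sup>2
          + a p x
          + Gamma_xi p * (1 + a1 p x) * xi \<sigma> x + A p x
          + Gamma_eta p * (1 + b1 p x) * eta \<sigma> x + B p x)"

definition fp_series :: "(param \<Rightarrow> complex \<Rightarrow> complex) \<Rightarrow> bool" where
  "fp_series fp \<longleftrightarrow>
     (\<exists>a\<in>bracket 1. \<exists>a1\<in>bracket 1. \<exists>a2\<in>bracket 1. \<exists>b1\<in>bracket 1.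
      \<exists>A\<in>tail 3 (\<lambda>n p. gammaxp p * Gamma_xi p ^ (n - 1)) (\<lambda>n. n - 2) xi.
      \<exists>B\<in>tail 2 (\<lambda>n p. gamma0p p * Gamma_eta p ^ n) (\<lambda>n. n) eta.
      \<forall>(p, x)\<in>full_dom. let \<sigma> = snd (snd p) in
        x powr ((\<sigma> + \<theta>inf) / 2) * fp p x =
          gamma0p p * (1 + a p x)
          - gammaxp p * ((\<sigma> - \<theta>inf) / 2 + a1 p x) * xi \<sigma> x
          - gamma0m p * (gammaxp p)\<^sup>2 * (1 + a2 p x) * (xi \<sigma> x)\<^sup>2
          + A p x
          + 2 * (gamma0p p)\<^sup>2 * gammaxm p * (1 + b1 p x) * (exp (- x) * x powr (- \<sigma> - 2))
          + B p x)"

definition gp_series :: "(param \<Rightarrow> complex \<Rightarrow> complex) \<Rightarrow> bool" where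
  "gp_series gp \<longleftrightarrow>
     (\<exists>a\<in>bracket 1. \<exists>a1\<in>bracket 1. \<exists>b1\<in>bracket 1. \<exists>b2\<in>bracket 1.
      \<exists>A\<in>tail 2 (\<lambda>n p. gammaxp p * Gamma_xi p ^ n) (\<lambda>n. n) xi.
      \<exists>B\<in>tail 3 (\<lambda>n p. gamma0p p * Gamma_eta p ^ (n - 1)) (\<lambda>n. n - 2) eta.
      \<forall>(p, x)\<in>full_dom. let \<sigma> = snd (snd p) in
        exp (- x) * x powr (- (\<sigma> - \<theta>inf) / 2) * gp p x =
          gammaxp p * (1 + a p x)
          + 2 * gamma0m p * (gammaxp p)\<^sup>2 * (1 + a1 p x) * (exp x * x powr (\<sigma> - 2))
          + A p x
          - gamma0p p * ((\<sigma> + \<theta>inf) / 2 + b1 p x) * eta \<sigma> x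
          - (gamma0p p)\<^sup>2 * gammaxm p * (1 + b2 p x) * (eta \<sigma> x)\<^sup>2
          + B p x)"

definition fm_series :: "(param \<Rightarrow> complex \<Rightarrow> complex) \<Rightarrow> bool" where
  "fm_series fm \<longleftrightarrow>
     (\<exists>a\<in>bracket 1. \<exists>a1\<in>bracket 1. \<exists>b1\<in>bracket 1. \<exists>b2\<in>bracket 1.
      \<exists>A\<in>tail 2 (\<lambda>n p. gamma0m p * Gamma_xi p ^ n) (\<lambda>n. n) xi.
      \<exists>B\<in>tail 3 (\<lambda>n p. gammaxm p * Gamma_eta p ^ (n - 1)) (\<lambda>n. n - 2) eta.
      \<forall>(p, x)\<in>full_dom. let \<sigma> = snd (snd p) in
        x powr (- (\<sigma> + \<theta>inf) / 2) * fm p x =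
          gamma0m p * (1 + a p x)
          + 2 * (gamma0m p)\<^sup>2 * gammaxp p * (1 + a1 p x) * (exp x * x powr (\<sigma> - 2))
          + A p x
          - gammaxm p * ((\<sigma> - \<theta>inf) / 2 + b1 p x) * eta \<sigma> x
          - gamma0p p * (gammaxm p)\<^sup>2 * (1 + b2 p x) * (eta \<sigma> x)\<^sup>2
          + B p x)"

definition gm_series :: "(param \<Rightarrow> complex \<Rightarrow> complex) \<Rightarrow> bool" where
  "gm_series gm \<longleftrightarrow>
     (\<exists>a\<in>bracket 1. \<exists>a1\<in>bracket 1. \<exists>a2\<in>bracket 1. \<exists>b1\<in>bracket 1.
      \<exists>A\<in>tail 3 (\<lambda>n p. gamma0m p * Gamma_xi p ^ (n - 1)) (\<lambda>n. n - 2) xi.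
      \<exists>B\<in>tail 2 (\<lambda>n p. gammaxm p * Gamma_eta p ^ n) (\<lambda>n. n) eta.
      \<forall>(p, x)\<in>full_dom. let \<sigma> = snd (snd p) in
        exp x * x powr ((\<sigma> - \<theta>inf) / 2) * gm p x =
          gammaxm p * (1 + a p x)
          - gamma0m p * ((\<sigma> + \<theta>inf) / 2 + a1 p x) * xi \<sigma> x
          - (gamma0m p)\<^sup>2 * gammaxp p * (1 + a2 p x) * (xi \<sigma> x)\<^sup>2
          + A p x
          + 2 * gamma0p p * (gammaxm p)\<^sup>2 * (1 + b1 p x) * (exp (- x) * x powr (- \<sigma> - 2))
          + B p x)"

text \<open>
  \<open>x dA0/dx = [Ax, A0]\<close> and \<open>x dAx/dx = [A0, Ax] + x/2 [J, Ax]\<close>, entry by entry, with the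
  normalisation of the eigenvalues and of the diagonal of \<open>A0 + Ax\<close>.
\<close>

definition system_solution ::
    "(param \<Rightarrow> complex \<Rightarrow> complex^2^2) \<Rightarrow> (param \<Rightarrow> complex \<Rightarrow> complex^2^2) \<Rightarrow> bool" where
  "system_solution A0 Ax \<longleftrightarrow> (\<forall>(p, x)\<in>full_dom.
     (\<forall>i j.
        ((\<lambda>x. A0 p x $ i $ j) has_field_derivative
            commutator (Ax p x) (A0 p x) $ i $ j / x) (at x) \<and>
        ((\<lambda>x. Ax p x $ i $ j) has_field_derivative
            (commutator (A0 p x) (Ax p x) $ i $ j + x / 2 * commutator J_mat (Ax p x) $ i $ j) / x)
          (at x)) \<and>
     has_eigenvalues (A0 p x) (\<theta>0 / 2) (- \<theta>0 / 2) \<and>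
     has_eigenvalues (Ax p x) (\<theta>x / 2) (- \<theta>x / 2) \<and>
     (A0 p x + Ax p x) $ 1 $ 1 = - \<theta>inf / 2 \<and> (A0 p x + Ax p x) $ 2 $ 2 = \<theta>inf / 2)"

definition series_solution ::
    "(param \<Rightarrow> complex \<Rightarrow> complex) \<Rightarrow> (param \<Rightarrow> complex \<Rightarrow> complex) \<Rightarrow> (param \<Rightarrow> complex \<Rightarrow> complex) \<Rightarrow>
     (param \<Rightarrow> complex \<Rightarrow> complex) \<Rightarrow> (param \<Rightarrow> complex \<Rightarrow> complex) \<Rightarrow> (param \<Rightarrow> complex \<Rightarrow> complex) \<Rightarrow> bool"
  where
  "series_solution f0 fp fm g0 gp gm \<longleftrightarrow>
     system_solution (\<lambda>p x. traceless (f0 p x) (fp p x) (fm p x))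
                     (\<lambda>p x. traceless (g0 p x) (gp p x) (gm p x)) \<and>
     (\<forall>h\<in>{f0, fp, fm, g0, gp, gm}. holomorphic_in_all h full_dom) \<and>
     f0_series f0 \<and> (\<forall>(p, x)\<in>full_dom. g0 p x = - \<theta>inf / 2 - f0 p x) \<and>
     fp_series fp \<and> gp_series gp \<and> fm_series fm \<and> gm_series gm"

text \<open>
  On this parameter domain and for these \<open>\<epsilon>\<close>, \<open>X\<close>, the function \<open>y c \<sigma> x\<close> is the Painleve function
  obtained from a series solution. Where the denominator of the quotient vanishes, \<open>y c \<sigma>\<close> is only
  determined as a meromorphic function.
\<close>

definition represents :: "(complex \<Rightarrow> complex \<Rightarrow> complex \<Rightarrow> complex) \<Rightarrow> bool" where
  "represents y \<longleftrightarrow> (\<exists>f0 fp fm g0 gp gm. series_solution f0 fp fm g0 gp gm \<and>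
     (\<forall>(c0, cx, \<sigma>)\<in>P.
        meromorphic_painleve5_solution_on (y (cx / c0) \<sigma>) (Sigma_dom \<sigma> \<epsilon> X \<delta>) \<and>
        (\<forall>x\<in>Sigma_dom \<sigma> \<epsilon> X \<delta>. let p = (c0, cx, \<sigma>) in
           fp p x * (g0 p x + \<theta>x / 2) \<noteq> 0 \<longrightarrow>
           y (cx / c0) \<sigma> x =
             (gp p x * (f0 p x + \<theta>0 / 2)) / (fp p x * (g0 p x + \<theta>x / 2)))))"

end

text \<open>
  \<open>y\<close> is the family \<open>y(c, \<sigma>, x)\<close>, where \<open>r0\<close> is the constant \<open>r\<^sub>0(\<delta>)\<close> that limits \<open>\<epsilon>\<close>. It is essential
  that every admissible \<open>\<epsilon>\<close> is allowed, uniformly in the parameter domain, and that \<open>y\<close> does not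
  depend on the parameter domain, on \<open>\<epsilon>\<close>, or on \<open>(c0, cx)\<close> other than through \<open>cx / c0\<close>.
\<close>

definition painleve5_family ::
    "real \<Rightarrow> real \<Rightarrow> (complex \<Rightarrow> complex \<Rightarrow> complex \<Rightarrow> complex) \<Rightarrow> bool" where
  "painleve5_family \<delta> r0 y \<longleftrightarrow>
     (\<forall>B0 Bx Bs \<epsilon>. param_domain B0 Bx Bs \<and> admissible_eps r0 (B0 \<times> Bx \<times> Bs) \<epsilon> \<longrightarrow>
        (\<exists>X > 1 / \<epsilon>. represents \<delta> (B0 \<times> Bx \<times> Bs) \<epsilon> X y))"

text \<open>
  The set on which \<open>y c \<sigma>\<close> is thereby defined: the union of all \<open>\<Sigma>(\<sigma>, \<epsilon>, X, \<delta>)\<close> that belong to a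
  parameter domain containing a \<open>(c0, cx, \<sigma>)\<close> with \<open>cx / c0 = c\<close>.
\<close>

definition y_domain ::
    "real \<Rightarrow> real \<Rightarrow> (complex \<Rightarrow> complex \<Rightarrow> complex \<Rightarrow> complex) \<Rightarrow> complex \<Rightarrow> complex \<Rightarrow> complex set"
  where
  "y_domain \<delta> r0 y c \<sigma> = {x. \<exists>B0 Bx Bs \<epsilon> X c0 cx.
     param_domain B0 Bx Bs \<and> admissible_eps r0 (B0 \<times> Bx \<times> Bs) \<epsilon> \<and> X > 1 / \<epsilon> \<and>
     represents \<delta> (B0 \<times> Bx \<times> Bs) \<epsilon> X y \<and>
     (c0, cx, \<sigma>) \<in> B0 \<times> Bx \<times> Bs \<and> cx / c0 = c \<and> x \<in> Sigma_dom \<sigma> \<epsilon> X \<delta>}"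

end

text \<open>
  \<open>x\<^sub>m = 2 m \<pi> i - a log (2 m \<pi> i) - log \<kappa> + O(log m / m)\<close>. Choosing another branch of \<open>log \<kappa>\<close> only
  shifts the index \<open>m\<close>, at the cost of \<open>O(1/m)\<close>.
\<close>

definition log_asymptotics :: "(nat \<Rightarrow> complex) \<Rightarrow> complex \<Rightarrow> complex \<Rightarrow> bool" where
  "log_asymptotics xs a \<kappa> \<longleftrightarrow>
     (\<lambda>m. xs m - (2 * of_nat m * of_real pi * \<i> - a * Ln (2 * of_nat m * of_real pi * \<i>) - Ln \<kappa>))
       \<in> O(\<lambda>m. of_real (ln (real m) / real m))"

text \<open>Both notions are insensitive to the values of \<open>u\<close> at isolated points.\<close>

definition has_zero_sequence ::
    "(complex \<Rightarrow> complex) \<Rightarrow> complex set \<Rightarrow> complex \<Rightarrow> complex \<Rightarrow> bool" where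
  "has_zero_sequence u S a \<kappa> \<longleftrightarrow> (\<exists>m0>0. \<exists>xs.
     (\<forall>m\<ge>m0. xs m \<in> S \<and> isolated_zero u (xs m)) \<and> log_asymptotics xs a \<kappa>)"

definition has_pole_sequence ::
    "(complex \<Rightarrow> complex) \<Rightarrow> complex set \<Rightarrow> complex \<Rightarrow> complex \<Rightarrow> bool" where
  "has_pole_sequence u S a \<kappa> \<longleftrightarrow> (\<exists>m0>0. \<exists>xs.
     (\<forall>m\<ge>m0. xs m \<in> S \<and> is_pole u (xs m)) \<and> log_asymptotics xs a \<kappa>)"

end

theory Submission
  imports Defs "HOL-Real_Asymp.Real_Asymp"
begin

text \<open>
  Write \<open>u = f\<^sub>+ g\<^sub>-\<close> and \<open>v = g\<^sub>+ f\<^sub>-\<close>. Since \<open>f\<^sub>+ f\<^sub>- = \<theta>\<^sub>0\<^sup>2/4 - f\<^sub>0\<^sup>2\<close>,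
  \<open>g\<^sub>+ g\<^sub>- = \<theta>\<^sub>x\<^sup>2/4 - g\<^sub>0\<^sup>2\<close> and \<open>g\<^sub>0 = -\<theta>\<^sub>\<infinity>/2 - f\<^sub>0\<close>,
  \<open>y = (f\<^sub>0 + \<theta>\<^sub>0/2) (f\<^sub>0 + (\<theta>\<^sub>\<infinity> + \<theta>\<^sub>x)/2) / u = v / ((\<theta>\<^sub>0/2 - f\<^sub>0) ((\<theta>\<^sub>x - \<theta>\<^sub>\<infinity>)/2 - f\<^sub>0))\<close>,
  so zeros and poles of \<open>y\<close> are points where \<open>f\<^sub>0\<close> takes a prescribed value. Where
  \<open>w = e\<^sup>-\<^sup>x x\<^sup>-\<^sup>\<sigma>\<^sup>-\<^sup>1\<close> (zeros) or \<open>w = e\<^sup>x x\<^sup>\<sigma>\<^sup>-\<^sup>1\<close> (poles) stays bounded and bounded away from zero,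
  the series give \<open>f\<^sub>0 = (\<sigma> - \<theta>\<^sub>\<infinity>)/4 + \<Gamma> w + o(1)\<close>, but no rate, because the asymptotic representations of
  their coefficients are not uniform in \<open>n\<close>. The rate \<open>O(1/x)\<close> comes from the differential system for
  \<open>f\<^sub>0, u, v\<close>: it has two approximate first integrals with derivative \<open>O(1/x\<^sup>2)\<close>, whose values at infinity
  are known from the series. The prescribed value is then attained next to each solution of \<open>w = const\<close>,
  by the minimum modulus principle.
\<close>

section \<open>Logarithmic strips\<close>

text \<open>\<open>Gamma_eta\<close> equals \<open>(\<sigma> + 2 * \<theta>0 - \<theta>inf) *
  (\<sigma> + 2 * \<theta>x + \<theta>inf) / (16 * c)\<close>. Solving
  \<open>(\<sigma> - \<theta>inf) / 4 + Gamma_eta * \<kappa> = \<phi>\<close> for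
  \<open>\<phi> = - (\<theta>inf + \<theta>x) / 2\<close> or \<open>- \<theta>0 / 2\<close>
  therefore cancels one linear factor and gives \<open>\<kappa> = - 4 * c / (other factor)\<close>;
  this is where \<rho>_0 comes from. For poles the wave value is \<open>inverse \<kappa>\<close>.
  The smallness hypothesis then says exactly that this wave value is below \<epsilon>, so that the
  points lie in \<Sigma>. The system becomes tractable because the two waves have product 1/x^2:
  where one has constant size, the other dies out, one of u, v grows like x, and the bounded product
  u v forces the other to be O(1/x). What remains is f' = s H, H' = s H up to O(1/x), with s = 1 or
  s = -1. The rate is indispensable: an error o(1) in f0 would locate the zeros only up to o(1). The
  final log m / m is larger than this rate; it stems from replacing log x by log(2 m pi i). A single
  \<epsilon> for all (c, \<sigma>) is possible because the condition with R0 tames the only \<gamma>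
  that contains an unbounded power of c.\<close>

text \<open>
  \<open>strip_point b l \<tau> t\<close> solves \<open>x + b log x = i \<tau> - l + t\<close> up to \<open>o(1)\<close>; the filter \<open>strip b l \<rho>\<close> is
  \<open>\<tau> \<rightarrow> \<infinity>\<close>, uniformly in \<open>|t| \<le> \<rho>\<close>.
\<close>

definition strip_point :: "complex \<Rightarrow> complex \<Rightarrow> real \<Rightarrow> complex \<Rightarrow> complex" where
  "strip_point b l \<tau> t = \<i> * of_real \<tau> - b * Ln (\<i> * of_real \<tau>) - l + t"

definition strip :: "complex \<Rightarrow> complex \<Rightarrow> real \<Rightarrow> complex filter" where
  "strip b l \<rho> = filtermap (case_prod (strip_point b l)) (at_top \<times>\<^sub>F principal (cball 0 \<rho>))"

lemma eventually_strip:
  "eventually P (strip b l \<rho>) \<longleftrightarrow>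
     (\<exists>T. \<forall>\<tau>\<ge>T. \<forall>t\<in>cball 0 \<rho>. P (strip_point b l \<tau> t))"
proof -
  have "eventually P (strip b l \<rho>) \<longleftrightarrow>
      (\<forall>\<^sub>F \<tau> in at_top. \<forall>t\<in>cball 0 \<rho>. P (strip_point b l \<tau> t))"
  proof
    assume "eventually P (strip b l \<rho>)"
    then obtain Pf Pg where "eventually Pf at_top" and g: "eventually Pg (principal (cball 0 \<rho>))"
      and "\<And>\<tau> t. Pf \<tau> \<Longrightarrow> Pg t \<Longrightarrow> P (strip_point b l \<tau> t)"
      unfolding strip_def eventually_filtermap eventually_prod_filter by auto
    with g show "\<forall>\<^sub>F \<tau> in at_top. \<forall>t\<in>cball 0 \<rho>. P (strip_point b l \<tau> t)"
      unfolding eventually_principal by (auto elim!: eventually_mono)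
  next
    assume "\<forall>\<^sub>F \<tau> in at_top. \<forall>t\<in>cball 0 \<rho>. P (strip_point b l \<tau> t)"
    then show "eventually P (strip b l \<rho>)"
      unfolding strip_def eventually_filtermap eventually_prod_filter
      by (intro exI[of _ "\<lambda>\<tau>. \<forall>t\<in>cball 0 \<rho>. P (strip_point b l \<tau> t)"]
          exI[of _ "\<lambda>t. t \<in> cball 0 \<rho>"]) (auto simp: eventually_principal)
  qed
  then show ?thesis
    by (simp add: eventually_at_top_linorder)
qed

lemma Ln_i_times_of_real: "\<tau> > 0 \<Longrightarrow> Ln (\<i> * of_real \<tau>) = of_real (ln \<tau>) + \<i> * of_real pi / 2"
  using Ln_times_of_real[of \<tau> \<i>] by (simp add: mult.commute Ln_of_real)

text \<open>Only the logarithm is unbounded. Since 3 > e, \<open>ln \<tau> \<ge> 1\<close>, and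
  pi/2, |l| and \<rho> can be absorbed into multiples of \<open>ln \<tau>\<close>.\<close>

lemma strip_point_deviation:
  assumes "\<tau> \<ge> 3" "cmod t \<le> \<rho>"
  shows "cmod (strip_point b l \<tau> t - \<i> * of_real \<tau>) \<le> (3 * cmod b + cmod l + \<rho>) * ln \<tau>"
proof -
  have "exp 1 \<le> \<tau>" using e_less_272 assms(1) by linarith
  then have 1: "1 \<le> ln \<tau>" using assms(1) by (simp add: ln_ge_iff)
  have "cmod (Ln (\<i> * of_real \<tau>)) \<le> cmod (of_real (ln \<tau>)) + cmod (\<i> * of_real pi / 2)"
    using assms(1) by (simp only: Ln_i_times_of_real norm_triangle_ineq)
  also have "\<dots> \<le> ln \<tau> + 2"
    using 1 pi_less_4 by (simp add: norm_mult norm_divide)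
  finally have "cmod (Ln (\<i> * of_real \<tau>)) \<le> 3 * ln \<tau>" using 1 by simp
  then have 2: "cmod (b * Ln (\<i> * of_real \<tau>)) \<le> 3 * cmod b * ln \<tau>"
    using mult_left_mono[OF _ norm_ge_zero[of b]] by (fastforce simp: norm_mult)
  have "cmod (strip_point b l \<tau> t - \<i> * of_real \<tau>) = cmod (t - b * Ln (\<i> * of_real \<tau>) - l)"
    by (simp add: strip_point_def algebra_simps)
  also have "\<dots> \<le> cmod t + cmod (b * Ln (\<i> * of_real \<tau>)) + cmod l"
    by (smt (verit) norm_triangle_ineq4)
  also have "\<dots> \<le> \<rho> * ln \<tau> + 3 * cmod b * ln \<tau> + cmod l * ln \<tau>"
  proof -
    have "0 \<le> \<rho>" using assms(2) norm_ge_zero order_trans by blast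
    then have "\<rho> * 1 \<le> \<rho> * ln \<tau>" "cmod l * 1 \<le> cmod l * ln \<tau>"
      using 1 by (intro mult_left_mono; simp)+
    then show ?thesis using 2 assms(2) by linarith
  qed
  finally show ?thesis by (simp add: algebra_simps)
qed

text \<open>On the positive imaginary axis the argument is pi/2, far from the cut, so
  \<open>Ln x - Ln z\<close> is the principal \<open>Ln (1 + q)\<close> for the relative error q,
  and this is at most 2 |q|.\<close>

lemma Ln_perturb:
  assumes "z = \<i> * of_real \<tau>" "\<tau> > 0" "cmod (x - z) \<le> e * \<tau>" "e < 1 / 2"
  shows "cmod (Ln x - Ln z) \<le> 2 * e"
proof -
  define q where "q = (x - z) / z"
  have z: "z \<noteq> 0" "cmod z = \<tau>" using assms by (auto simp: norm_mult)
  have q: "cmod q \<le> e" using assms z by (simp add: q_def norm_divide divide_le_eq)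
  have x: "x = z * (1 + q)" using z by (simp add: q_def field_simps)
  have q1: "1 + q \<noteq> 0"
  proof
    assume "1 + q = 0"
    then have "q = - 1" by (simp add: add_eq_0_iff)
    then show False using q assms(4) by simp
  qed
  have n: "cmod (Ln (1 + q)) \<le> 2 * e"
    using norm_Ln_le[of q] q assms(4) by linarith
  have im: "\<bar>Im (Ln (1 + q))\<bar> < 1"
    using abs_Im_le_cmod[of "Ln (1 + q)"] n assms(4) by linarith
  have "Ln x = Ln z + Ln (1 + q)"
    unfolding x
  proof (rule Ln_times_simple[OF z(1) q1])
    have "Im (Ln z) = pi / 2" using assms by (simp add: Ln_i_times_of_real)
    then show "- pi < Im (Ln z) + Im (Ln (1 + q))" "Im (Ln z) + Im (Ln (1 + q)) \<le> pi"
      using im pi_gt3 by linarith+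
  qed
  then show "cmod (Ln x - Ln z) \<le> 2 * e" using n by simp
qed

text \<open>\<open>M\<close> is fixed before \<open>e\<close>: the same quantity
  \<open>M * (ln \<tau> / \<tau>)\<close> serves as a rate and as a bound below any threshold. That
  |x| is comparable to \<tau> turns bounds in x into bounds in \<tau> and back.\<close>

lemma strip_estimates:
  assumes "0 \<le> \<rho>"
  obtains M where "M > 0" "\<And>e. e > 0 \<Longrightarrow> \<exists>T\<ge>3. \<forall>\<tau>\<ge>T. \<forall>t\<in>cball 0 \<rho>.
    M * (ln \<tau> / \<tau>) < e \<and> \<tau> / 2 \<le> cmod (strip_point b l \<tau> t) \<and> cmod (strip_point b l \<tau> t) \<le> 2 * \<tau> \<and>
    cmod (Ln (strip_point b l \<tau> t) - Ln (\<i> * of_real \<tau>)) \<le> M * (ln \<tau> / \<tau>)"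
proof -
  define K where "K = 3 * cmod b + cmod l + \<rho> + 1"
  have K: "K > 0" using assms by (simp add: K_def add_nonneg_pos)
  show thesis
  proof (rule that[of "2 * K"])
    fix e :: real assume e: "e > 0"
    have "((\<lambda>\<tau>. 2 * K * (ln \<tau> / \<tau>)) \<longlongrightarrow> 0) at_top" by real_asymp
    then have "\<forall>\<^sub>F \<tau> in at_top. 2 * K * (ln \<tau> / \<tau>) < min e (1 / 2)"
      using e by (intro order_tendstoD) auto
    then obtain T0 where T0: "\<And>\<tau>. \<tau> \<ge> T0 \<Longrightarrow> 2 * K * (ln \<tau> / \<tau>) < min e (1 / 2)"
      by (auto simp: eventually_at_top_linorder)
    have "\<forall>\<tau>\<ge>max 3 T0. \<forall>t\<in>cball 0 \<rho>.
      2 * K * (ln \<tau> / \<tau>) < e \<and> \<tau> / 2 \<le> cmod (strip_point b l \<tau> t) \<and>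
      cmod (strip_point b l \<tau> t) \<le> 2 * \<tau> \<and>
      cmod (Ln (strip_point b l \<tau> t) - Ln (\<i> * of_real \<tau>)) \<le> 2 * K * (ln \<tau> / \<tau>)"
    proof (intro conjI allI impI ballI)
      fix \<tau> t assume \<tau>: "max 3 T0 \<le> \<tau>" and t: "t \<in> cball (0::complex) \<rho>"
      have s: "2 * K * (ln \<tau> / \<tau>) < e" "2 * K * (ln \<tau> / \<tau>) < 1 / 2" using T0[of \<tau>] \<tau> by auto
      then show "2 * K * (ln \<tau> / \<tau>) < e" by simp
      have "cmod (strip_point b l \<tau> t - \<i> * of_real \<tau>) \<le> (3 * cmod b + cmod l + \<rho>) * ln \<tau>"
        using \<tau> t by (intro strip_point_deviation) auto
      also have "\<dots> \<le> K * ln \<tau>"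
        using \<tau> by (intro mult_right_mono) (auto simp: K_def)
      finally have d: "cmod (strip_point b l \<tau> t - \<i> * of_real \<tau>) \<le> (K * (ln \<tau> / \<tau>)) * \<tau>"
        using \<tau> by (simp add: field_simps)
      show "cmod (Ln (strip_point b l \<tau> t) - Ln (\<i> * of_real \<tau>)) \<le> 2 * K * (ln \<tau> / \<tau>)"
        using Ln_perturb[OF refl _ d] s \<tau> by (simp add: mult.assoc)
      have "(K * (ln \<tau> / \<tau>)) * \<tau> \<le> (1 / 2) * \<tau>"
        using s \<tau> by (intro mult_right_mono) auto
      then have "cmod (strip_point b l \<tau> t - \<i> * of_real \<tau>) \<le> \<tau> / 2" using d by simp
      moreover have "cmod (\<i> * of_real \<tau>) = \<tau>" using \<tau> by (simp add: norm_mult)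
      ultimately show "\<tau> / 2 \<le> cmod (strip_point b l \<tau> t)" "cmod (strip_point b l \<tau> t) \<le> 2 * \<tau>"
        using norm_triangle_ineq3[of "strip_point b l \<tau> t" "\<i> * of_real \<tau>"] \<tau> by linarith+
    qed
    then show "\<exists>T\<ge>3. \<forall>\<tau>\<ge>T. \<forall>t\<in>cball 0 \<rho>.
      2 * K * (ln \<tau> / \<tau>) < e \<and> \<tau> / 2 \<le> cmod (strip_point b l \<tau> t) \<and>
      cmod (strip_point b l \<tau> t) \<le> 2 * \<tau> \<and>
      cmod (Ln (strip_point b l \<tau> t) - Ln (\<i> * of_real \<tau>)) \<le> 2 * K * (ln \<tau> / \<tau>)"
      using max.cobounded1 by blast
  qed (use K in auto)
qed

lemma filterlim_strip_at_infinity: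
  assumes "0 \<le> \<rho>" shows "filterlim (\<lambda>x. x) at_infinity (strip b l \<rho>)"
  unfolding filterlim_at_infinity[OF order_refl]
proof (intro allI impI)
  fix r :: real assume "0 < r"
  obtain M where "M > 0" and "\<exists>T\<ge>3. \<forall>\<tau>\<ge>T. \<forall>t\<in>cball 0 \<rho>.
    M * (ln \<tau> / \<tau>) < 1 \<and> \<tau> / 2 \<le> cmod (strip_point b l \<tau> t) \<and> cmod (strip_point b l \<tau> t) \<le> 2 * \<tau> \<and>
    cmod (Ln (strip_point b l \<tau> t) - Ln (\<i> * of_real \<tau>)) \<le> M * (ln \<tau> / \<tau>)"
    using strip_estimates[OF assms, of b l] by (metis zero_less_one)
  then obtain T where "\<And>\<tau> t. \<tau> \<ge> T \<Longrightarrow> t \<in> cball 0 \<rho> \<Longrightarrow> \<tau> / 2 \<le> cmod (strip_point b l \<tau> t)"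
    by blast
  then show "\<forall>\<^sub>F x in strip b l \<rho>. r \<le> cmod x"
    unfolding eventually_strip by (intro exI[of _ "max T (2 * r)"]) force
qed

text \<open>\<open>Arg\<close> is the imaginary part of \<open>Ln\<close>, and on the strip
  \<open>Ln x\<close> approaches \<open>Ln (\<i> * of_real \<tau>)\<close>, whose imaginary part is
  pi/2.\<close>

lemma eventually_strip_Arg:
  assumes "0 \<le> \<rho>" "\<alpha> > 0" shows "\<forall>\<^sub>F x in strip b l \<rho>. x \<noteq> 0 \<and> \<bar>Arg x - pi / 2\<bar> < \<alpha>"
proof -
  obtain M where "M > 0" and "\<exists>T\<ge>3. \<forall>\<tau>\<ge>T. \<forall>t\<in>cball 0 \<rho>.
    M * (ln \<tau> / \<tau>) < \<alpha> \<and> \<tau> / 2 \<le> cmod (strip_point b l \<tau> t) \<and> cmod (strip_point b l \<tau> t) \<le> 2 * \<tau> \<and>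
    cmod (Ln (strip_point b l \<tau> t) - Ln (\<i> * of_real \<tau>)) \<le> M * (ln \<tau> / \<tau>)"
    using strip_estimates[OF assms(1), of b l] assms(2) by metis
  then obtain T where T: "T \<ge> 3" "\<And>\<tau> t. \<tau> \<ge> T \<Longrightarrow> t \<in> cball 0 \<rho> \<Longrightarrow>
      \<tau> / 2 \<le> cmod (strip_point b l \<tau> t) \<and>
      cmod (Ln (strip_point b l \<tau> t) - Ln (\<i> * of_real \<tau>)) < \<alpha>"
    by fastforce
  show ?thesis unfolding eventually_strip
  proof (intro exI[of _ T] allI impI ballI)
    fix \<tau> t assume t: "T \<le> \<tau>" "t \<in> cball (0::complex) \<rho>"
    let ?x = "strip_point b l \<tau> t"
    have x: "?x \<noteq> 0" using T(1) T(2)[OF t] t by auto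
    have "\<bar>Im (Ln ?x - Ln (\<i> * of_real \<tau>))\<bar> < \<alpha>"
      using abs_Im_le_cmod[of "Ln ?x - Ln (\<i> * of_real \<tau>)"] T(2)[OF t] by linarith
    then show "?x \<noteq> 0 \<and> \<bar>Arg ?x - pi / 2\<bar> < \<alpha>"
      using x T(1) t by (simp add: Arg_def Ln_i_times_of_real)
  qed
qed

text \<open>The sign s merges the two waves: \<open>xi\<close> is s = 1 and \<open>eta\<close> is s
  = -1, both with b = \<sigma> - s. Poles and zeros thus share one argument. The exponent
  \<open>x + b * Ln x\<close> is what the strip coordinate t makes nearly linear.\<close>

definition wave :: "complex \<Rightarrow> complex \<Rightarrow> complex \<Rightarrow> complex" where
  "wave s b x = exp (s * (x + b * Ln x))"

lemma xi_eq_wave: "x \<noteq> 0 \<Longrightarrow> xi \<sigma> x = wave 1 (\<sigma> - 1) x"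
  by (simp add: xi_def wave_def powr_def exp_add)

lemma eta_eq_wave: "x \<noteq> 0 \<Longrightarrow> eta \<sigma> x = wave (-1) (\<sigma> + 1) x"
  by (simp add: eta_def wave_def powr_def algebra_simps flip: exp_add)

text \<open>Three factors with separate roles: the first depends on t only, the second is a pure
  oscillation that equals 1 at \<tau> = 2 pi m, and the third tends to 1 because the logarithms
  approach each other.\<close>

lemma wave_strip_point:
  "wave s b (strip_point b l \<tau> t) =
     exp (s * (t - l)) * exp (s * (\<i> * of_real \<tau>)) *
     exp (s * b * (Ln (strip_point b l \<tau> t) - Ln (\<i> * of_real \<tau>)))"
  unfolding wave_def exp_add[symmetric]
  by (rule arg_cong[of _ _ exp]) (simp add: strip_point_def algebra_simps)

lemma eventually_strip_wave:
  assumes "0 \<le> \<rho>" and s: "s = 1 \<or> s = -1" and "\<rho> < \<rho>'"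
  shows "\<forall>\<^sub>F x in strip b l \<rho>. cmod (wave s b x) \<le> cmod (exp (- s * l)) * exp \<rho>'"
    and "\<forall>\<^sub>F x in strip b l \<rho>. cmod (exp (- s * l)) * exp (- \<rho>') \<le> cmod (wave s b x)"
proof -
  obtain M where M: "M > 0" and est: "\<And>e. e > 0 \<Longrightarrow> \<exists>T\<ge>3. \<forall>\<tau>\<ge>T. \<forall>t\<in>cball 0 \<rho>.
    M * (ln \<tau> / \<tau>) < e \<and> \<tau> / 2 \<le> cmod (strip_point b l \<tau> t) \<and> cmod (strip_point b l \<tau> t) \<le> 2 * \<tau> \<and>
    cmod (Ln (strip_point b l \<tau> t) - Ln (\<i> * of_real \<tau>)) \<le> M * (ln \<tau> / \<tau>)"
    using strip_estimates[OF assms(1), of b l] by metis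
  \<comment> \<open>The gap between \<rho> and \<rho>' is the room for the third factor of the wave;
    the 1 in the denominator covers b = 0.\<close>
  define e where "e = (\<rho>' - \<rho>) / (cmod b + 1)"
  have e: "e > 0" using assms by (simp add: e_def add_nonneg_pos)
  obtain T where T: "T \<ge> 3" "\<And>\<tau> t. \<tau> \<ge> T \<Longrightarrow> t \<in> cball 0 \<rho> \<Longrightarrow>
      cmod (Ln (strip_point b l \<tau> t) - Ln (\<i> * of_real \<tau>)) < e"
    using est[OF e] by fastforce
  have *: "cmod (wave s b (strip_point b l \<tau> t)) \<le> cmod (exp (- s * l)) * exp \<rho>' \<and>
      cmod (exp (- s * l)) * exp (- \<rho>') \<le> cmod (wave s b (strip_point b l \<tau> t))"
    if t: "T \<le> \<tau>" "t \<in> cball 0 \<rho>" for \<tau> t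
  proof -
    let ?d = "Ln (strip_point b l \<tau> t) - Ln (\<i> * of_real \<tau>)"
    have "cmod (s * t + s * b * ?d) \<le> cmod t + cmod b * cmod ?d"
      using norm_triangle_ineq[of "s * t" "s * b * ?d"] s by (auto simp: norm_mult)
    also have "\<dots> \<le> \<rho> + cmod b * e"
      using T(2)[OF t] t by (intro add_mono mult_left_mono) auto
    also have "\<dots> \<le> \<rho> + (cmod b + 1) * e"
      using e by (simp add: distrib_right)
    also have "\<dots> = \<rho>'"
    proof -
      have "cmod b + 1 \<noteq> 0" using norm_ge_zero[of b] by linarith
      then show ?thesis by (simp add: e_def)
    qed
    finally have r: "\<bar>Re (s * t + s * b * ?d)\<bar> \<le> \<rho>'"
      using abs_Re_le_cmod order_trans by blast
    have i: "Re (s * (\<i> * of_real \<tau>)) = 0" using s by auto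
    have "cmod (wave s b (strip_point b l \<tau> t)) = cmod (exp (- s * l)) * exp (Re (s * t + s * b * ?d))"
      unfolding wave_strip_point norm_mult norm_exp_eq_Re i
      by (simp add: exp_add[symmetric] algebra_simps)
    then show ?thesis using r by (simp add: abs_le_iff minus_le_iff)
  qed
  show "\<forall>\<^sub>F x in strip b l \<rho>. cmod (wave s b x) \<le> cmod (exp (- s * l)) * exp \<rho>'"
    and "\<forall>\<^sub>F x in strip b l \<rho>. cmod (exp (- s * l)) * exp (- \<rho>') \<le> cmod (wave s b x)"
    unfolding eventually_strip using * by blast+
qed

section \<open>From limits to rates along a strip\<close>

lemma strip_point_has_vector_derivative:
  assumes "\<tau> > 0"
  shows "((\<lambda>\<tau>. strip_point b l \<tau> t) has_vector_derivative (\<i> - b * of_real (1 / \<tau>))) (at \<tau>)"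
proof (rule has_vector_derivative_transform_within_open)
  have id: "((\<lambda>\<tau>. complex_of_real \<tau>) has_vector_derivative of_real 1) (at \<tau>)"
    by (intro has_vector_derivative_of_real DERIV_ident)
  have ln: "((\<lambda>\<tau>. complex_of_real (ln \<tau>)) has_vector_derivative of_real (1 / \<tau>)) (at \<tau>)"
    using assms by (intro has_vector_derivative_of_real DERIV_ln_divide)
  have "((\<lambda>\<tau>. \<i> * of_real \<tau> - b * (of_real (ln \<tau>) + \<i> * of_real pi / 2) - l + t)
      has_vector_derivative (\<i> * of_real 1 - b * (of_real (1 / \<tau>) + 0) - 0 + 0)) (at \<tau>)"
    by (intro has_vector_derivative_add has_vector_derivative_diff has_vector_derivative_const
        has_vector_derivative_mult_right id ln)
  then show "((\<lambda>\<tau>. \<i> * of_real \<tau> - b * (of_real (ln \<tau>) + \<i> * of_real pi / 2) - l + t)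
      has_vector_derivative (\<i> - b * of_real (1 / \<tau>))) (at \<tau>)"
    by simp
  show "\<tau> \<in> {0<..}" "open {0::real<..}" using assms by auto
qed (use assms in \<open>auto simp: strip_point_def Ln_i_times_of_real\<close>)

lemma filterlim_strip_point:
  assumes "cmod t \<le> \<rho>" shows "filterlim (\<lambda>\<tau>. strip_point b l \<tau> t) (strip b l \<rho>) at_top"
  unfolding filterlim_iff eventually_strip using assms
  by (metis (mono_tags, lifting) eventually_at_top_linorder mem_cball_0)

text \<open>Integrating the derivative along \<open>\<tau> \<mapsto> strip_point b l \<tau> t\<close> up to infinity turns \<open>O(1/x\<^sup>2)\<close>
  into \<open>O(1/x)\<close>.\<close>

lemma bigo_strip_integrate:
  assumes "0 \<le> \<rho>"
    and "\<forall>\<^sub>F x in strip b l \<rho>. (E has_field_derivative E' x) (at x)"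
    and "E' \<in> O[strip b l \<rho>](\<lambda>x. 1 / x\<^sup>2)"
    and "(E \<longlongrightarrow> L) (strip b l \<rho>)"
  shows "(\<lambda>x. E x - L) \<in> O[strip b l \<rho>](\<lambda>x. 1 / x)"
proof -
  obtain C where C: "C > 0" and ev: "\<forall>\<^sub>F x in strip b l \<rho>. cmod (E' x) \<le> C * cmod (1 / x\<^sup>2)"
    using landau_o.bigE[OF assms(3)] by blast
  obtain M where "M > 0" and "\<exists>T\<ge>3. \<forall>\<tau>\<ge>T. \<forall>t\<in>cball 0 \<rho>.
    M * (ln \<tau> / \<tau>) < 1 \<and> \<tau> / 2 \<le> cmod (strip_point b l \<tau> t) \<and> cmod (strip_point b l \<tau> t) \<le> 2 * \<tau> \<and>
    cmod (Ln (strip_point b l \<tau> t) - Ln (\<i> * of_real \<tau>)) \<le> M * (ln \<tau> / \<tau>)"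
    using strip_estimates[OF assms(1), of b l] by (metis zero_less_one)
  then obtain T1 where T1: "T1 \<ge> 3" "\<And>\<tau> t. \<tau> \<ge> T1 \<Longrightarrow> t \<in> cball 0 \<rho> \<Longrightarrow>
      \<tau> / 2 \<le> cmod (strip_point b l \<tau> t) \<and> cmod (strip_point b l \<tau> t) \<le> 2 * \<tau>"
    by blast
  from eventually_conj[OF assms(2) ev] obtain T2 where
    T2: "\<And>\<tau> t. \<tau> \<ge> T2 \<Longrightarrow> t \<in> cball 0 \<rho> \<Longrightarrow>
      (E has_field_derivative E' (strip_point b l \<tau> t)) (at (strip_point b l \<tau> t)) \<and>
      cmod (E' (strip_point b l \<tau> t)) \<le> C * cmod (1 / (strip_point b l \<tau> t)\<^sup>2)"
    unfolding eventually_strip by blast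
  define T where "T = max T1 T2"
  \<comment> \<open>The 4 comes from |x| \<ge> \<tau>/2 inside 1/x^2, and 1 + |b| bounds the speed
    \<open>\<i> - b / \<tau>\<close> of the curve.\<close>
  define K where "K = 4 * (1 + cmod b) * C"
  have K: "K > 0" using C by (simp add: K_def add_pos_nonneg)
  have main: "cmod (E (strip_point b l \<tau> t) - L) \<le> K / \<tau>" if \<tau>: "\<tau> \<ge> T" and t: "t \<in> cball 0 \<rho>" for \<tau> t
  proof -
    define \<gamma> where "\<gamma> = (\<lambda>\<tau>. strip_point b l \<tau> t)"
    have pos: "u > 0" if "u \<ge> T" for u using that T1(1) by (simp add: T_def)
    have der: "((E \<circ> \<gamma>) has_vector_derivative (\<i> - b * of_real (1 / u)) * E' (\<gamma> u)) (at u)"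
      if "u \<ge> T" for u
      using strip_point_has_vector_derivative[OF pos[OF that]] T2[of u t] that t
      by (intro field_vector_diff_chain_at) (auto simp: \<gamma>_def T_def)
    have bound: "cmod ((\<i> - b * of_real (1 / u)) * E' (\<gamma> u)) \<le> K / u\<^sup>2" if u: "u \<ge> T" for u
    proof -
      have u3: "u \<ge> 3" using u T1(1) by (simp add: T_def)
      have "cmod (\<i> - b * of_real (1 / u)) \<le> cmod \<i> + cmod (b * of_real (1 / u))"
        by (rule norm_triangle_ineq4)
      also have "\<dots> \<le> 1 + cmod b * 1"
        using u3 by (simp add: norm_mult norm_divide divide_le_eq mult_le_cancel_left1)
      finally have 1: "cmod (\<i> - b * of_real (1 / u)) \<le> 1 + cmod b" by simp
      have "u / 2 \<le> cmod (\<gamma> u)" using T1(2)[of u t] u t by (simp add: \<gamma>_def T_def)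
      then have "(u / 2)\<^sup>2 \<le> (cmod (\<gamma> u))\<^sup>2" using u3 by (intro power_mono) auto
      then have "C * cmod (1 / (\<gamma> u)\<^sup>2) \<le> C * (1 / (u / 2)\<^sup>2)"
        unfolding norm_divide norm_power norm_one using C u3
        by (intro mult_left_mono divide_left_mono) (auto intro!: mult_pos_pos)
      then have 2: "cmod (E' (\<gamma> u)) \<le> C * (4 / u\<^sup>2)"
        using T2[of u t] u t by (simp add: \<gamma>_def T_def power_divide)
      have "cmod (\<i> - b * of_real (1 / u)) * cmod (E' (\<gamma> u)) \<le> (1 + cmod b) * (C * (4 / u\<^sup>2))"
        using 1 2 by (intro mult_mono) auto
      then show ?thesis by (simp add: norm_mult K_def mult_ac)
    qed
    have step: "cmod ((E \<circ> \<gamma>) u - (E \<circ> \<gamma>) \<tau>) \<le> K / \<tau>" if u: "u > \<tau>" for u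
    proof -
      \<comment> \<open>Mean value inequality with the majorant -K/u, whose derivative is the bound
        K/u^2. The increment stays below K/\<tau> for every endpoint u, so u can go to infinity
        afterwards.\<close>
      have "cmod ((E \<circ> \<gamma>) u - (E \<circ> \<gamma>) \<tau>) \<le> (- K / u) - (- K / \<tau>)"
      proof (rule differentiable_bound_general[OF u])
        show "continuous_on {\<tau>..u} (E \<circ> \<gamma>)"
          using \<tau> by (intro continuous_at_imp_continuous_on ballI has_vector_derivative_continuous[OF der])
            auto
        show "continuous_on {\<tau>..u} (\<lambda>x. - K / x)"
          using pos[OF \<tau>] by (intro continuous_intros) auto
        show "((\<lambda>x. - K / x) has_vector_derivative K / v\<^sup>2) (at v)" if "\<tau> < v" for v
          using pos[OF \<tau>] that
          by (auto intro!: derivative_eq_intros simp: power2_eq_square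
              has_real_derivative_iff_has_vector_derivative[symmetric])
        show "((E \<circ> \<gamma>) has_vector_derivative (\<i> - b * of_real (1 / v)) * E' (\<gamma> v)) (at v)"
          and "cmod ((\<i> - b * of_real (1 / v)) * E' (\<gamma> v)) \<le> K / v\<^sup>2" if "\<tau> < v" for v
          using der[of v] bound[of v] that \<tau> by simp_all
      qed
      also have "\<dots> \<le> K / \<tau>" using K pos[OF \<tau>] u by simp
      finally show ?thesis .
    qed
    have "((\<lambda>u. (E \<circ> \<gamma>) u - (E \<circ> \<gamma>) \<tau>) \<longlongrightarrow> L - E (\<gamma> \<tau>)) at_top"
      unfolding o_def \<gamma>_def using t
      by (intro tendsto_diff tendsto_const filterlim_compose[OF assms(4) filterlim_strip_point]) auto
    then have "cmod (L - E (\<gamma> \<tau>)) \<le> K / \<tau>"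
      by (rule Lim_norm_ubound[rotated])
         (use step in \<open>auto intro: eventually_mono[OF eventually_gt_at_top[of \<tau>]]\<close>)
    then show ?thesis by (simp add: \<gamma>_def norm_minus_commute)
  qed
  show ?thesis
  proof (rule landau_o.bigI[of "2 * K"])
    show "\<forall>\<^sub>F x in strip b l \<rho>. cmod (E x - L) \<le> 2 * K * cmod (1 / x)"
      unfolding eventually_strip
    proof (intro exI[of _ T] allI impI ballI)
      fix \<tau> t assume \<tau>: "T \<le> \<tau>" and t: "t \<in> cball (0::complex) \<rho>"
      let ?x = "strip_point b l \<tau> t"
      have x: "0 < \<tau>" "\<tau> / 2 \<le> cmod ?x" "cmod ?x \<le> 2 * \<tau>"
        using T1(1) T1(2)[of \<tau> t] \<tau> t by (auto simp: T_def)
      have "K / \<tau> = 2 * K / (2 * \<tau>)" using x by simp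
      also have "\<dots> \<le> 2 * K / cmod ?x"
        using x K by (intro divide_left_mono mult_pos_pos) auto
      finally show "cmod (E ?x - L) \<le> 2 * K * cmod (1 / ?x)"
        using main[OF \<tau> t] by (simp add: norm_divide)
    qed
  qed (use K in simp)
qed

section \<open>Order calculus for the waves on a strip\<close>

lemma tendsto_imp_bigo_1:
  fixes g :: "'a \<Rightarrow> complex"
  assumes "(g \<longlongrightarrow> c) F" shows "g \<in> O[F](\<lambda>_. 1 :: complex)"
  using assms by (intro bigoI_tendsto[of _ _ c]) auto

lemma bigo_1_mult:
  fixes g :: "'a \<Rightarrow> complex"
  assumes "a \<in> O[F](\<lambda>_. 1 :: complex)" "g \<in> O[F](h)" shows "(\<lambda>x. a x * g x) \<in> O[F](h)"
  using landau_o.big.mult[OF assms] by simp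

lemma wave_bigo_1:
  assumes "0 \<le> \<rho>" "s = 1 \<or> s = -1"
  shows "wave s b \<in> O[strip b l \<rho>](\<lambda>_. 1)"
  using eventually_strip_wave(1)[OF assms less_add_one, of b l]
  by (intro bigoI[where c = "cmod (exp (- s * l)) * exp (\<rho> + 1)"]) auto

lemma inverse_wave_bigo_1:
  assumes "0 \<le> \<rho>" "s = 1 \<or> s = -1"
  shows "(\<lambda>x. 1 / wave s b x) \<in> O[strip b l \<rho>](\<lambda>_. 1)"
proof (rule bigoI)
  let ?c = "cmod (exp (- s * l)) * exp (- (\<rho> + 1))"
  show "\<forall>\<^sub>F x in strip b l \<rho>. norm (1 / wave s b x) \<le> (1 / ?c) * norm (1 :: complex)"
    using eventually_strip_wave(2)[OF assms less_add_one, of l b]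
  proof (rule eventually_mono)
    fix x assume "?c \<le> cmod (wave s b x)"
    moreover have "?c > 0" by simp
    ultimately show "norm (1 / wave s b x) \<le> (1 / ?c) * norm (1 :: complex)"
      unfolding norm_divide by (simp only: norm_one mult_1_right) (intro divide_left_mono mult_pos_pos; simp add: wave_def)
  qed
qed

lemma wave_has_field_derivative:
  assumes "x \<notin> \<real>\<^sub>\<le>\<^sub>0"
  shows "(wave s b has_field_derivative s * (1 + b / x) * wave s b x) (at x)"
proof -
  have "x \<noteq> 0" using assms by auto
  then show ?thesis
    unfolding wave_def[abs_def] using assms
    by (auto intro!: derivative_eq_intros simp: field_simps)
qed

lemma eventually_strip_not_nonpos:
  assumes "0 \<le> \<rho>" shows "\<forall>\<^sub>F x in strip b l \<rho>. x \<notin> \<real>\<^sub>\<le>\<^sub>0"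
  using eventually_strip_Arg[OF assms pi_half_gt_zero, of b l]
proof eventually_elim
  case (elim x)
  show ?case
  proof
    assume "x \<in> \<real>\<^sub>\<le>\<^sub>0"
    then have "Arg x = pi" using elim Arg_eq_pi_iff[of x]
      by (auto simp: complex_nonpos_Reals_iff complex_is_Real_iff complex_eq_iff less_le)
    then show False using elim by simp
  qed
qed

text \<open>Varying t sweeps out a whole disc about \<open>strip_point b l \<tau> 0\<close>, so
  eventual properties hold on closed discs of fixed radius, as the arguments on holomorphic
  functions require.\<close>

lemma eventually_strip_cball:
  assumes "eventually P (strip b l \<rho>)"
  obtains T where "\<And>\<tau> z. \<tau> \<ge> T \<Longrightarrow> z \<in> cball (strip_point b l \<tau> 0) \<rho> \<Longrightarrow> P z"
proof -
  obtain T where T: "\<And>\<tau> t. \<tau> \<ge> T \<Longrightarrow> t \<in> cball 0 \<rho> \<Longrightarrow> P (strip_point b l \<tau> t)"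
    using assms unfolding eventually_strip by blast
  show thesis
  proof (rule that[of T])
    fix \<tau> z assume "\<tau> \<ge> T" "z \<in> cball (strip_point b l \<tau> 0) \<rho>"
    then have "P (strip_point b l \<tau> (z - strip_point b l \<tau> 0))"
      by (intro T) (auto simp: dist_norm norm_minus_commute)
    then show "P z" by (simp add: strip_point_def)
  qed
qed

text \<open>Both \<open>H - f - ((\<theta> - s) f + 2 f\<^sup>2) / x\<close> and \<open>K - 4 w K\<^sup>2 / x\<close> with \<open>K = H / w\<close> have a derivative of
  order \<open>1 / x\<^sup>2\<close>; by integration, qualitative limits improve to a rate.\<close>

lemma bigo_strip_limit_rate:
  fixes f H r1 r2 :: "complex \<Rightarrow> complex" and s \<sigma> \<theta> \<Gamma> l :: complex and \<rho> :: real
  defines "\<Phi> \<equiv> strip (\<sigma> - s) l \<rho>" and "w \<equiv> wave s (\<sigma> - s)"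
  assumes \<rho>: "0 \<le> \<rho>" and s: "s = 1 \<or> s = -1"
    and Df: "\<forall>\<^sub>F x in \<Phi>. (f has_field_derivative s * H x + r1 x) (at x)"
    and DH: "\<forall>\<^sub>F x in \<Phi>. (H has_field_derivative
               s * H x + (s * (\<theta> + 4 * f x) - 1) * H x / x + r2 x) (at x)"
    and r1: "r1 \<in> O[\<Phi>](\<lambda>x. 1 / x\<^sup>2)" and r2: "r2 \<in> O[\<Phi>](\<lambda>x. 1 / x\<^sup>2)"
    and lim_f: "((\<lambda>x. f x - (\<sigma> - \<theta>) / 4 - \<Gamma> * w x) \<longlongrightarrow> 0) \<Phi>"
    and lim_H: "((\<lambda>x. H x / w x) \<longlongrightarrow> \<Gamma>) \<Phi>"
  shows "(\<lambda>x. f x - (\<sigma> - \<theta>) / 4 - \<Gamma> * w x) \<in> O[\<Phi>](\<lambda>x. 1 / x)"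
proof -
  have s2: "s * s = 1" using s by auto
  have w0: "w x \<noteq> 0" for x by (simp add: w_def wave_def)
  have slit: "\<forall>\<^sub>F x in \<Phi>. x \<notin> \<real>\<^sub>\<le>\<^sub>0" unfolding \<Phi>_def by (rule eventually_strip_not_nonpos[OF \<rho>])
  have inf: "filterlim (\<lambda>x. x) at_infinity \<Phi>" unfolding \<Phi>_def by (rule filterlim_strip_at_infinity[OF \<rho>])
  have wO: "w \<in> O[\<Phi>](\<lambda>_. 1)"
    unfolding w_def \<Phi>_def by (rule wave_bigo_1[OF \<rho> s])
  have wO': "(\<lambda>x. 1 / w x) \<in> O[\<Phi>](\<lambda>_. 1)"
    unfolding w_def \<Phi>_def by (rule inverse_wave_bigo_1[OF \<rho> s])
  have invO: "(\<lambda>x. 1 / x) \<in> O[\<Phi>](\<lambda>_. 1)"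
    by (rule tendsto_imp_bigo_1[of _ 0]) (use tendsto_inverse_0 inf in \<open>auto simp: inverse_eq_divide[symmetric] intro: filterlim_compose\<close>)
  have inv0: "((\<lambda>x. 1 / x) \<longlongrightarrow> 0) \<Phi>"
    using filterlim_compose[OF tendsto_inverse_0 inf] by (simp add: inverse_eq_divide)
  have cO: "(\<lambda>_. c) \<in> O[\<Phi>](\<lambda>_. 1)" for c :: complex by simp
  note mO = landau_o.big.mult_in_1 and aO = sum_in_bigo
  define K where "K = (\<lambda>x. H x / w x)"
  have HK: "H x = w x * K x" for x using w0 by (simp add: K_def)
  have KO: "K \<in> O[\<Phi>](\<lambda>_. 1)" unfolding K_def by (rule tendsto_imp_bigo_1[OF lim_H])
  have HO: "H \<in> O[\<Phi>](\<lambda>_. 1)" unfolding HK[abs_def] by (intro mO wO KO)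
  have fO: "f \<in> O[\<Phi>](\<lambda>_. 1)"
  proof -
    have "(\<lambda>x. (f x - (\<sigma> - \<theta>) / 4 - \<Gamma> * w x) + ((\<sigma> - \<theta>) / 4 + \<Gamma> * w x)) \<in> O[\<Phi>](\<lambda>_. 1)"
      by (intro aO mO wO cO tendsto_imp_bigo_1[OF lim_f])
    then show ?thesis by simp
  qed
  have inv2: "(\<lambda>x. 1 / x\<^sup>2) \<in> O[\<Phi>](\<lambda>x. 1 / x\<^sup>2)" by simp
  define q where "q = (\<lambda>x. f x - (\<sigma> - \<theta>) / 4 - H x)"
  have q: "q \<in> O[\<Phi>](\<lambda>x. 1 / x)"
  proof -
    \<comment> \<open>In \<open>H' - f'\<close> the leading terms \<open>s * H\<close> cancel and
      \<open>(s * (\<theta> + 4 * f) - 1) * H / x\<close> remains, which is not integrable as it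
      stands. As f' is \<open>s * H\<close> up to \<open>r1\<close> and s^2 = 1, the numerator is
      nearly the derivative of \<open>(\<theta> - s) * f + 2 * f\<^sup>2\<close>. Subtracting that
      over x is an integration by parts and leaves O(1/x^2).\<close>
    define E where "E = (\<lambda>x. H x - f x - ((\<theta> - s) * f x + 2 * (f x)\<^sup>2) * (1 / x))"
    define E' where "E' = (\<lambda>x. r2 x - r1 x - (\<theta> - s + 4 * f x) * (1 / x) * r1 x
                     + ((\<theta> - s) * f x + 2 * f x * f x) * (1 / x\<^sup>2))"
    have "(\<lambda>x. E x - (- ((\<sigma> - \<theta>) / 4))) \<in> O[\<Phi>](\<lambda>x. 1 / x)"
      unfolding \<Phi>_def
    proof (rule bigo_strip_integrate[OF \<rho>]; fold \<Phi>_def)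
      show "\<forall>\<^sub>F x in \<Phi>. (E has_field_derivative E' x) (at x)"
        using Df DH slit
      proof eventually_elim
        case (elim x)
        have x: "x \<noteq> 0" using elim(3) by auto
        have di: "((\<lambda>x. 1 / x) has_field_derivative - (1 / x\<^sup>2)) (at x)"
          using x by (auto intro!: derivative_eq_intros simp: power2_eq_square)
        have "(E has_field_derivative
          (s * H x + (s * (\<theta> + 4 * f x) - 1) * H x / x + r2 x) - (s * H x + r1 x)
           - (((\<theta> - s) * (s * H x + r1 x) + 4 * f x * (s * H x + r1 x)) * (1 / x)
               - ((\<theta> - s) * f x + 2 * (f x)\<^sup>2) / x\<^sup>2)) (at x)"
          unfolding E_def power2_eq_square[of "f _"]
          by (rule DERIV_cong[OF DERIV_diff[OF DERIV_diff[OF elim(2) elim(1)]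
              DERIV_mult[OF DERIV_add[OF DERIV_cmult[OF elim(1)]
                DERIV_cmult[OF DERIV_mult[OF elim(1) elim(1)]]] di]]])
             (simp add: algebra_simps add_divide_distrib diff_divide_distrib)
        moreover have "(s * H x + (s * (\<theta> + 4 * f x) - 1) * H x / x + r2 x) - (s * H x + r1 x)
           - (((\<theta> - s) * (s * H x + r1 x) + 4 * f x * (s * H x + r1 x)) * (1 / x)
               - ((\<theta> - s) * f x + 2 * (f x)\<^sup>2) / x\<^sup>2) = E' x + (s * s - 1) * H x / x"
          using x by (simp add: E'_def field_simps power2_eq_square)
        ultimately show ?case by (simp add: s2)
      qed
      show "E' \<in> O[\<Phi>](\<lambda>x. 1 / x\<^sup>2)"
        unfolding E'_def
        by (intro aO r1 r2 bigo_1_mult[OF _ r1] bigo_1_mult[OF _ inv2] mO fO cO invO)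
      have "((\<lambda>x. w x * (K x - \<Gamma>)) \<longlongrightarrow> 0) \<Phi>"
      proof -
        have "(\<lambda>x. K x - \<Gamma>) \<in> o[\<Phi>](\<lambda>_. 1)"
          using lim_H by (intro smalloI_tendsto) (auto simp: K_def LIM_zero)
        from landau_o.big_small_mult[OF wO this] show ?thesis
          using smalloD_tendsto by fastforce
      qed
      moreover have "((\<lambda>x. ((\<theta> - s) * f x + 2 * f x * f x) * (1 / x)) \<longlongrightarrow> 0) \<Phi>"
      proof -
        have "(\<lambda>x. 1 / x) \<in> o[\<Phi>](\<lambda>_. 1)" using inv0 by (intro smalloI_tendsto) auto
        moreover have "(\<lambda>x. (\<theta> - s) * f x + 2 * f x * f x) \<in> O[\<Phi>](\<lambda>_. 1)" by (intro aO mO fO cO)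
        ultimately show ?thesis
          using smalloD_tendsto[OF landau_o.big_small_mult] by fastforce
      qed
      \<comment> \<open>\<open>H\<close> and \<open>f\<close> both oscillate with amplitude \<Gamma>
        w, but these parts cancel in the difference, so E has a limit.\<close>
      ultimately have "((\<lambda>x. w x * (K x - \<Gamma>) - (f x - (\<sigma> - \<theta>) / 4 - \<Gamma> * w x) - (\<sigma> - \<theta>) / 4
         - ((\<theta> - s) * f x + 2 * f x * f x) * (1 / x)) \<longlongrightarrow> 0 - 0 - (\<sigma> - \<theta>) / 4 - 0) \<Phi>"
        by (intro tendsto_diff tendsto_const lim_f)
      then show "(E \<longlongrightarrow> - ((\<sigma> - \<theta>) / 4)) \<Phi>"
        by (simp add: E_def HK algebra_simps power2_eq_square)
    qed
    moreover have "(\<lambda>x. ((\<theta> - s) * f x + 2 * f x * f x) * (1 / x)) \<in> O[\<Phi>](\<lambda>x. 1 / x)"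
      by (intro bigo_1_mult aO mO fO cO) auto
    ultimately have "(\<lambda>x. - 1 * (E x - (- ((\<sigma> - \<theta>) / 4))) - ((\<theta> - s) * f x + 2 * f x * f x) * (1 / x))
        \<in> O[\<Phi>](\<lambda>x. 1 / x)"
      by (rule aO(2)[OF bigo_1_mult[OF cO]])
    then show ?thesis
      by (simp add: E_def q_def algebra_simps power2_eq_square diff_divide_distrib)
  qed
  have "(\<lambda>x. K x - \<Gamma>) \<in> O[\<Phi>](\<lambda>x. 1 / x)"
  proof -
    \<comment> \<open>Since w' = s (1 + (\<sigma> - s)/x) w, dividing by w removes the term
      \<open>s * H\<close> and, because s^2 = 1, also the -1. What is left is
      \<open>4 * s * (f - (\<sigma> - \<theta>) / 4) * K / x\<close>, and the bracket is
      \<open>H + q\<close>. This cancellation is what fixes the exponent b = \<sigma> - s.\<close>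
    define K' where "K' = (\<lambda>x. 4 * s * K x * (H x + q x) * (1 / x) + (1 / w x) * r2 x)"
    have K'O: "K' \<in> O[\<Phi>](\<lambda>x. 1 / x)"
    proof -
      have "(\<lambda>x. 1 / x\<^sup>2) \<in> O[\<Phi>](\<lambda>x. 1 / x)"
        using landau_o.big.mult[OF invO landau_o.big_refl[of "\<lambda>x::complex. 1 / x" \<Phi>]]
        by (simp add: power2_eq_square)
      then have "r2 \<in> O[\<Phi>](\<lambda>x. 1 / x)" by (rule landau_o.big_trans[OF r2])
      moreover have "q \<in> O[\<Phi>](\<lambda>_. 1)" by (rule landau_o.big_trans[OF q invO])
      ultimately show ?thesis unfolding K'_def
        by (intro aO bigo_1_mult[of _ _ r2] bigo_1_mult[of _ _ "\<lambda>x. 1 / x"] mO cO HO KO wO') auto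
    qed
    have DK: "\<forall>\<^sub>F x in \<Phi>. (K has_field_derivative K' x) (at x)"
      using DH slit
    proof eventually_elim
      case (elim x)
      have x: "x \<noteq> 0" using elim(2) by auto
      have dw: "(w has_field_derivative s * (1 + (\<sigma> - s) / x) * w x) (at x)"
        unfolding w_def by (rule wave_has_field_derivative[OF elim(2)])
      have "(K has_field_derivative
          ((s * H x + (s * (\<theta> + 4 * f x) - 1) * H x / x + r2 x) * w x
             - H x * (s * (1 + (\<sigma> - s) / x) * w x)) / (w x * w x)) (at x)"
        unfolding K_def by (rule DERIV_divide[OF elim(1) dw w0])
      moreover have "((s * H x + (s * (\<theta> + 4 * f x) - 1) * H x / x + r2 x) * w x
             - H x * (s * (1 + (\<sigma> - s) / x) * w x)) / (w x * w x) = K' x + (s * s - 1) * K x / x"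
        using x w0[of x] by (simp add: K'_def q_def HK field_simps)
      ultimately show ?case by (simp add: s2)
    qed
    \<comment> \<open>K' is only O(1/x), but its main term \<open>4 * s * w * K\<^sup>2 / x\<close>
      oscillates like w. As w' is \<open>s * w\<close> to leading order,
      \<open>4 * w * K\<^sup>2 / x\<close> is its antiderivative up to O(1/x^2).\<close>
    define E where "E = (\<lambda>x. K x - 4 * w x * (K x)\<^sup>2 * (1 / x))"
    define E' where "E' = (\<lambda>x. (4 * s * K x * (1 / x)) * q x + (1 / w x) * r2 x
        - 4 * s * (\<sigma> - s) * w x * K x * K x * (1 / x\<^sup>2) - 8 * w x * K x * (1 / x) * K' x
        + 4 * w x * K x * K x * (1 / x\<^sup>2))"
    have "(\<lambda>x. E x - \<Gamma>) \<in> O[\<Phi>](\<lambda>x. 1 / x)"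
      unfolding \<Phi>_def
    proof (rule bigo_strip_integrate[OF \<rho>]; fold \<Phi>_def)
      show "\<forall>\<^sub>F x in \<Phi>. (E has_field_derivative E' x) (at x)"
        using DK slit
      proof eventually_elim
        case (elim x)
        have x: "x \<noteq> 0" using elim(2) by auto
        have dw: "(w has_field_derivative s * (1 + (\<sigma> - s) / x) * w x) (at x)"
          unfolding w_def by (rule wave_has_field_derivative[OF elim(2)])
        have di: "((\<lambda>x. 1 / x) has_field_derivative - (1 / x\<^sup>2)) (at x)"
          using x by (auto intro!: derivative_eq_intros simp: power2_eq_square)
        have "(E has_field_derivative
          K' x - ((4 * (s * (1 + (\<sigma> - s) / x) * w x) * (K x)\<^sup>2 + 8 * w x * K x * K' x) * (1 / x)
               - 4 * w x * (K x)\<^sup>2 / x\<^sup>2)) (at x)"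
          unfolding E_def power2_eq_square[of "K _"]
          by (rule DERIV_cong[OF DERIV_diff[OF elim(1)
              DERIV_mult[OF DERIV_mult[OF DERIV_cmult[OF dw] DERIV_mult[OF elim(1) elim(1)]] di]]])
             (simp add: algebra_simps add_divide_distrib diff_divide_distrib)
        moreover have "K' x - ((4 * (s * (1 + (\<sigma> - s) / x) * w x) * (K x)\<^sup>2 + 8 * w x * K x * K' x) * (1 / x)
               - 4 * w x * (K x)\<^sup>2 / x\<^sup>2) =
            4 * s * K x * (w x * K x + q x) * (1 / x) + (1 / w x) * r2 x
             - ((4 * (s * (1 + (\<sigma> - s) / x) * w x) * (K x)\<^sup>2 + 8 * w x * K x * K' x) * (1 / x)
               - 4 * w x * (K x)\<^sup>2 / x\<^sup>2)"
          by (simp add: K'_def HK)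
        moreover have "\<dots> = E' x"
          using x by (simp add: E'_def field_simps power2_eq_square)
        ultimately show ?case by simp
      qed
      have 1: "(\<lambda>x. (4 * s * K x * (1 / x)) * q x) \<in> O[\<Phi>](\<lambda>x. 1 / x\<^sup>2)"
      proof -
        have "(\<lambda>x. (4 * s * K x) * (1 / x)) \<in> O[\<Phi>](\<lambda>x. 1 / x)"
          by (intro bigo_1_mult mO cO KO) auto
        from landau_o.big.mult[OF this q] show ?thesis by (simp add: power2_eq_square)
      qed
      have 2: "(\<lambda>x. (8 * w x * K x * (1 / x)) * K' x) \<in> O[\<Phi>](\<lambda>x. 1 / x\<^sup>2)"
      proof -
        have "(\<lambda>x. (8 * w x * K x) * (1 / x)) \<in> O[\<Phi>](\<lambda>x. 1 / x)"
          by (intro bigo_1_mult mO cO KO wO) auto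
        from landau_o.big.mult[OF this K'O] show ?thesis by (simp add: power2_eq_square)
      qed
      show "E' \<in> O[\<Phi>](\<lambda>x. 1 / x\<^sup>2)"
        unfolding E'_def
        by (intro aO 1 2 bigo_1_mult[OF _ r2] bigo_1_mult[OF _ inv2] mO cO KO wO wO')
      have "((\<lambda>x. (4 * w x * K x * K x) * (1 / x)) \<longlongrightarrow> 0) \<Phi>"
      proof -
        have "(\<lambda>x. 1 / x) \<in> o[\<Phi>](\<lambda>_. 1)" using inv0 by (intro smalloI_tendsto) auto
        moreover have "(\<lambda>x. 4 * w x * K x * K x) \<in> O[\<Phi>](\<lambda>_. 1)" by (intro aO mO wO KO cO)
        ultimately show ?thesis
          using smalloD_tendsto[OF landau_o.big_small_mult] by fastforce
      qed
      moreover have "(K \<longlongrightarrow> \<Gamma>) \<Phi>" using lim_H by (simp only: K_def)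
      ultimately show "(E \<longlongrightarrow> \<Gamma>) \<Phi>"
        using tendsto_diff by (fastforce simp: E_def power2_eq_square mult.assoc)
    qed
    moreover have "(\<lambda>x. (4 * w x * K x * K x) * (1 / x)) \<in> O[\<Phi>](\<lambda>x. 1 / x)"
      by (intro bigo_1_mult mO wO KO cO) auto
    ultimately have "(\<lambda>x. (E x - \<Gamma>) + (4 * w x * K x * K x) * (1 / x)) \<in> O[\<Phi>](\<lambda>x. 1 / x)"
      by (rule aO(1))
    then show ?thesis by (simp add: E_def algebra_simps power2_eq_square)
  qed
  \<comment> \<open>With \<open>H = w * K\<close>, the quantity to be estimated is exactly
    \<open>q + w * (K - \<Gamma>)\<close>: the first integral controls one summand, the second
    integral the other.\<close>
  then have "(\<lambda>x. q x + w x * (K x - \<Gamma>)) \<in> O[\<Phi>](\<lambda>x. 1 / x)"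
    by (rule aO(1)[OF q bigo_1_mult[OF wO]])
  then show ?thesis by (simp add: q_def HK algebra_simps diff_divide_distrib)
qed

section \<open>Values attained along a strip\<close>

text \<open>On \<open>\<tau> = 2 \<pi> m\<close> the wave is \<open>exp (s (t - l))\<close> up to \<open>O(log m / m)\<close>, so that \<open>f - \<phi>\<close> has
  a zero near \<open>t = 0\<close> by the minimum modulus principle.\<close>

lemma strip_value_sequence:
  fixes f :: "complex \<Rightarrow> complex" and s b \<kappa> h \<Gamma> :: complex and \<rho> :: real
  assumes \<rho>: "0 < \<rho>" "\<rho> \<le> 1 / 2" and s: "s = 1 \<or> s = -1" and \<Gamma>: "\<Gamma> \<noteq> 0"
    and Df: "\<forall>\<^sub>F x in strip b (Ln \<kappa>) \<rho>. f field_differentiable at x"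
    and rate: "(\<lambda>x. f x - h - \<Gamma> * wave s b x) \<in> O[strip b (Ln \<kappa>) \<rho>](\<lambda>x. 1 / x)"
    and \<phi>: "\<phi> = h + \<Gamma> * exp (- s * Ln \<kappa>)"
  obtains xs where "log_asymptotics xs b \<kappa>"
    and "\<forall>\<^sub>F m in sequentially. f (xs m) = \<phi> \<and> (\<forall>\<^sub>F x in at (xs m). f x \<noteq> \<phi>)"
    and "\<And>Q. eventually Q (strip b (Ln \<kappa>) \<rho>) \<Longrightarrow>
           \<forall>\<^sub>F m in sequentially. \<forall>\<^sub>F x in nhds (xs m). Q x"
proof -
  define l where "l = Ln \<kappa>"
  \<comment> \<open>The value of the wave at t = 0, \<tau> = 2 pi m, up to the factor that tends to
    1.\<close>
  define A where "A = exp (- s * l)"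
  have \<rho>0: "0 \<le> \<rho>" using \<rho> by simp
  have \<phi>A: "\<phi> = h + \<Gamma> * A" by (simp add: \<phi> A_def l_def)
  have A0: "A \<noteq> 0" by (simp add: A_def)
  define c where "c = cmod (\<Gamma> * A) / 2"
  have c: "c > 0" using \<Gamma> A0 by (simp add: c_def)
  define P where "P = (\<lambda>m t. strip_point b l (2 * pi * real m) t)"
  define L where "L = (\<lambda>m. ln (real m) / real m)"
  have L0: "L \<longlonglongrightarrow> 0" unfolding L_def by real_asymp
  have Lpos: "\<forall>\<^sub>F m in sequentially. 0 < L m"
    using eventually_gt_at_top[of 1] by eventually_elim (simp add: L_def)

  have approx: "\<exists>C>0. \<forall>\<^sub>F m in sequentially. \<forall>t\<in>cball 0 \<rho>.
      cmod (f (P m t) - \<phi> - \<Gamma> * A * (exp (s * t) - 1)) \<le> C * L m"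
  proof -
    obtain C1 where C1: "C1 > 0" and
      ev1: "\<forall>\<^sub>F x in strip b l \<rho>. cmod (f x - h - \<Gamma> * wave s b x) \<le> C1 * cmod (1 / x)"
      using landau_o.bigE[OF rate] unfolding l_def by blast
    then obtain T1 where T1: "\<And>\<tau> t. \<tau> \<ge> T1 \<Longrightarrow> t \<in> cball 0 \<rho> \<Longrightarrow>
        cmod (f (strip_point b l \<tau> t) - h - \<Gamma> * wave s b (strip_point b l \<tau> t))
          \<le> C1 * cmod (1 / strip_point b l \<tau> t)"
      unfolding eventually_strip by blast
    obtain M where M: "M > 0" and est: "\<And>e. e > 0 \<Longrightarrow> \<exists>T\<ge>3. \<forall>\<tau>\<ge>T. \<forall>t\<in>cball 0 \<rho>.
      M * (ln \<tau> / \<tau>) < e \<and> \<tau> / 2 \<le> cmod (strip_point b l \<tau> t) \<and> cmod (strip_point b l \<tau> t) \<le> 2 * \<tau> \<and>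
      cmod (Ln (strip_point b l \<tau> t) - Ln (\<i> * of_real \<tau>)) \<le> M * (ln \<tau> / \<tau>)"
      using strip_estimates[OF \<rho>0, of b l] by metis
    \<comment> \<open>This threshold keeps the exponent \<open>s * b * d\<close> within the disc of
      radius 1/2, where |exp z - 1| \<le> 2 |z|.\<close>
    have b1: "0 < 1 / (2 * (cmod b + 1))" by (simp add: add_nonneg_pos)
    obtain T2 where T2: "T2 \<ge> 3" "\<And>\<tau> t. \<tau> \<ge> T2 \<Longrightarrow> t \<in> cball 0 \<rho> \<Longrightarrow>
      M * (ln \<tau> / \<tau>) < 1 / (2 * (cmod b + 1)) \<and> \<tau> / 2 \<le> cmod (strip_point b l \<tau> t) \<and>
      cmod (Ln (strip_point b l \<tau> t) - Ln (\<i> * of_real \<tau>)) \<le> M * (ln \<tau> / \<tau>)"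
      using est[OF b1] by blast
    define C2 where "C2 = cmod \<Gamma> * (cmod A * exp \<rho>) * (2 * cmod b * M)"
    have C2: "C2 \<ge> 0" using M by (simp add: C2_def)
    \<comment> \<open>Two sources of error: the rate of f contributes 1/\<tau>, and the drift of
      \<open>Ln x\<close> away from \<open>Ln (\<i> * of_real \<tau>)\<close> contributes the larger
      ln \<tau> / \<tau>.\<close>
    have tau: "cmod (f (strip_point b l \<tau> t) - \<phi> - \<Gamma> * A * (exp (s * t) - 1))
        \<le> C1 * (2 / \<tau>) + C2 * (ln \<tau> / \<tau>)"
      if \<tau>: "\<tau> \<ge> max T1 T2" and per: "exp (s * (\<i> * of_real \<tau>)) = 1" and t: "t \<in> cball 0 \<rho>" for \<tau> t
    proof -
      let ?x = "strip_point b l \<tau> t"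
      define d where "d = Ln ?x - Ln (\<i> * of_real \<tau>)"
      have w: "wave s b ?x = A * exp (s * t) * exp (s * b * d)"
        unfolding wave_strip_point per d_def A_def by (simp add: exp_add[symmetric] algebra_simps)
      have T: "M * (ln \<tau> / \<tau>) < 1 / (2 * (cmod b + 1))" "\<tau> / 2 \<le> cmod ?x" "cmod d \<le> M * (ln \<tau> / \<tau>)"
        using T2(2)[of \<tau> t] \<tau> t by (auto simp: d_def)
      have n: "cmod (s * b * d) = cmod b * cmod d" using s by (auto simp: norm_mult)
      have "cmod b * cmod d \<le> (cmod b + 1) * (1 / (2 * (cmod b + 1)))"
        using T by (intro mult_mono) auto
      also have "\<dots> = 1 / 2" using b1 by (simp add: field_simps)
      finally have n1: "cmod (s * b * d) \<le> 1 / 2" using n by simp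
      have "cmod (exp (s * b * d) - 1) \<le> 2 * cmod (s * b * d)"
        using norm_exp_bounds(2)[OF n1] norm_ge_zero[of "s * b * d"] by linarith
      also have "\<dots> \<le> 2 * cmod b * M * (ln \<tau> / \<tau>)"
        unfolding n using mult_left_mono[OF T(3) norm_ge_zero[of b]] by simp
      finally have e1: "cmod (exp (s * b * d) - 1) \<le> 2 * cmod b * M * (ln \<tau> / \<tau>)" .
      have "cmod (exp (s * t)) \<le> exp (cmod (s * t))" by (rule norm_exp)
      also have "\<dots> \<le> exp \<rho>" using t s by (auto simp: norm_mult)
      finally have e2: "cmod (exp (s * t)) \<le> exp \<rho>" .
      have "f ?x - \<phi> - \<Gamma> * A * (exp (s * t) - 1)
          = (f ?x - h - \<Gamma> * wave s b ?x) + \<Gamma> * (A * exp (s * t)) * (exp (s * b * d) - 1)"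
        by (simp add: \<phi>A w algebra_simps)
      also have "cmod \<dots> \<le> cmod (f ?x - h - \<Gamma> * wave s b ?x)
          + cmod (\<Gamma> * (A * exp (s * t)) * (exp (s * b * d) - 1))"
        by (rule norm_triangle_ineq)
      also have "\<dots> \<le> C1 * (2 / \<tau>) + C2 * (ln \<tau> / \<tau>)"
      proof (rule add_mono)
        have "1 / cmod ?x \<le> 1 / (\<tau> / 2)"
          using T(2) T2(1) \<tau> by (intro divide_left_mono mult_pos_pos) auto
        then have "C1 * cmod (1 / ?x) \<le> C1 * (2 / \<tau>)"
          using C1 by (intro mult_left_mono) (auto simp: norm_divide)
        then show "cmod (f ?x - h - \<Gamma> * wave s b ?x) \<le> C1 * (2 / \<tau>)"
          using T1[of \<tau> t] \<tau> t by simp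
        have "cmod (\<Gamma> * (A * exp (s * t)) * (exp (s * b * d) - 1))
            \<le> cmod \<Gamma> * (cmod A * exp \<rho>) * (2 * cmod b * M * (ln \<tau> / \<tau>))"
          unfolding norm_mult using e1 e2 by (intro mult_mono mult_nonneg_nonneg) auto
        then show "cmod (\<Gamma> * (A * exp (s * t)) * (exp (s * b * d) - 1)) \<le> C2 * (ln \<tau> / \<tau>)"
          by (simp add: C2_def mult_ac)
      qed
      finally show ?thesis .
    qed
    have per: "exp (s * (\<i> * of_real (2 * pi * real m))) = 1" for m
    proof -
      have "exp (\<i> * of_real (2 * pi * real m)) = 1"
        using exp_integer_2pi[of "real m"] by (simp add: mult_ac)
      then show ?thesis using s by (auto simp: exp_minus)
    qed
    have ln: "(\<lambda>m. C1 * (2 / (2 * pi * real m)) + C2 * (ln (2 * pi * real m) / (2 * pi * real m))) \<in> O(L)"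
      unfolding L_def by real_asymp
    then obtain C where C: "C > 0" and evC: "\<forall>\<^sub>F m in sequentially.
       \<bar>C1 * (2 / (2 * pi * real m)) + C2 * (ln (2 * pi * real m) / (2 * pi * real m))\<bar> \<le> C * \<bar>L m\<bar>"
      using landau_o.bigE[OF ln] unfolding real_norm_def by blast
    have "\<forall>\<^sub>F m in sequentially. max T1 T2 \<le> 2 * pi * real m" by real_asymp
    then have "\<forall>\<^sub>F m in sequentially. \<forall>t\<in>cball 0 \<rho>.
      cmod (f (P m t) - \<phi> - \<Gamma> * A * (exp (s * t) - 1)) \<le> C * L m"
      using evC Lpos
    proof eventually_elim
      case (elim m)
      then show ?case unfolding P_def using tau[of "2 * pi * real m", OF _ per[of m]] by fastforce
    qed
    with C show ?thesis by blast
  qed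
  then obtain C where C: "C > 0" and evC: "\<forall>\<^sub>F m in sequentially. \<forall>t\<in>cball 0 \<rho>.
      cmod (f (P m t) - \<phi> - \<Gamma> * A * (exp (s * t) - 1)) \<le> C * L m" by blast
  \<comment> \<open>The factor 3 makes the minimum modulus argument work. On |t| = r the model term
    has modulus at least |\<Gamma> A| r / 2 = c r = 3 C L; the approximation error C L leaves at
    least 2 C L, while at the centre |f - \<phi>| is at most C L.\<close>
  define r where "r = (\<lambda>m. 3 * C / c * L m)"
  have "r \<longlonglongrightarrow> 3 * C / c * 0" unfolding r_def by (intro tendsto_intros L0)
  then have r\<rho>: "\<forall>\<^sub>F m in sequentially. r m < \<rho>"
    using \<rho> by (intro order_tendstoD) auto
  have PA: "z \<in> cball (P m 0) \<rho> \<Longrightarrow> z = P m (z - P m 0) \<and> z - P m 0 \<in> cball 0 \<rho>" for z m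
    by (auto simp: P_def strip_point_def dist_norm norm_minus_commute)
  have ev_cball: "\<forall>\<^sub>F m in sequentially. \<forall>z\<in>cball (P m 0) \<rho>. Q z" if ev: "eventually Q (strip b l \<rho>)" for Q
  proof -
    obtain T where T: "\<And>\<tau> z. \<tau> \<ge> T \<Longrightarrow> z \<in> cball (strip_point b l \<tau> 0) \<rho> \<Longrightarrow> Q z"
      using eventually_strip_cball[OF ev] by blast
    have "\<forall>\<^sub>F m in sequentially. T \<le> 2 * pi * real m" by real_asymp
    then show ?thesis by eventually_elim (use T in \<open>auto simp: P_def\<close>)
  qed
  have "\<forall>\<^sub>F m in sequentially. \<exists>x. cmod (x - P m 0) < r m \<and> f x = \<phi> \<and> (\<forall>\<^sub>F x in at x. f x \<noteq> \<phi>)"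
    using ev_cball[OF Df[folded l_def]] r\<rho> Lpos evC
  proof eventually_elim
    case (elim m)
    note app = elim(4)[rule_format]
    have rm: "0 < r m" using C c elim(3) by (simp add: r_def)
    have hol: "(\<lambda>x. f x - \<phi>) holomorphic_on cball (P m 0) \<rho>"
      unfolding holomorphic_on_def
      by (intro ballI field_differentiable_diff field_differentiable_const)
         (use elim(1) field_differentiable_at_within in blast)
    have at0: "cmod (f (P m 0) - \<phi>) \<le> C * L m" using app[of 0] \<rho> by simp
    have out: "2 * C * L m \<le> cmod (f z - \<phi>)" if "cmod (P m 0 - z) = r m" for z
    proof -
      define t where "t = z - P m 0"
      have t: "cmod t = r m" using that by (simp add: t_def norm_minus_commute)
      have z: "z = P m t" "t \<in> cball 0 \<rho>" using PA[of z m] that elim(2) by (auto simp: t_def dist_norm)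
      have st: "cmod (s * t) = r m" using s t by (auto simp: norm_mult)
      then have "r m / 2 \<le> cmod (exp (s * t) - 1)"
        using norm_exp_bounds(1)[of "s * t"] elim(2) \<rho> by simp
      then have "cmod (\<Gamma> * A) * (r m / 2) \<le> cmod (\<Gamma> * A * (exp (s * t) - 1))"
        unfolding norm_mult[of "\<Gamma> * A"] by (rule mult_left_mono) simp
      moreover have "cmod (\<Gamma> * A) * (r m / 2) = 3 * C * L m"
        using c by (simp add: r_def c_def)
      moreover have "cmod (f z - \<phi> - \<Gamma> * A * (exp (s * t) - 1)) \<le> C * L m"
        using app[OF z(2)] z(1) by simp
      ultimately show ?thesis
        using norm_triangle_ineq2[of "\<Gamma> * A * (exp (s * t) - 1)" "\<Gamma> * A * (exp (s * t) - 1) - (f z - \<phi>)"]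
        by (simp add: norm_minus_commute)
    qed
    have CL: "C * L m > 0" using C elim(3) by simp
    obtain x where x: "x \<in> ball (P m 0) (r m)" "f x - \<phi> = 0"
    proof (rule holomorphic_contract_to_zero[of "P m 0" "r m" "\<lambda>x. f x - \<phi>"])
      show "continuous_on (cball (P m 0) (r m)) (\<lambda>x. f x - \<phi>)"
        using elim(2) by (intro holomorphic_on_imp_continuous_on holomorphic_on_subset[OF hol]) auto
      show "(\<lambda>x. f x - \<phi>) holomorphic_on ball (P m 0) (r m)"
        using elim(2) by (intro holomorphic_on_subset[OF hol]) auto
      show "cmod (f (P m 0) - \<phi>) < cmod (f z - \<phi>)" if "cmod (P m 0 - z) = r m" for z
        using out[OF that] at0 CL by linarith
    qed (use rm in auto)
    \<comment> \<open>A point of the circle, where f differs from \<phi>: it excludes that f is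
      constantly \<phi> on the disc, so the value found is attained in isolation.\<close>
    define \<beta> where "\<beta> = P m 0 + of_real (r m)"
    have "cmod (P m 0 - \<beta>) = r m" using rm by (simp add: \<beta>_def)
    then have \<beta>: "f \<beta> - \<phi> \<noteq> 0" "\<beta> \<in> ball (P m 0) \<rho>"
      using out[of \<beta>] CL elim(2) by (auto simp: dist_norm)
    obtain e where e: "0 < e" "\<And>z. z \<in> ball x e - {x} \<Longrightarrow> f z - \<phi> \<noteq> 0"
    proof (rule isolated_zeros[of "\<lambda>x. f x - \<phi>" "ball (P m 0) \<rho>" x \<beta>])
      show "(\<lambda>x. f x - \<phi>) holomorphic_on ball (P m 0) \<rho>"
        by (intro holomorphic_on_subset[OF hol]) auto
    qed (use x \<beta> elim(2) in auto)
    have "\<forall>\<^sub>F z in at x. f z \<noteq> \<phi>"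
      unfolding eventually_at using e by (intro exI[of _ e]) (auto simp: dist_commute)
    then show ?case using x by (intro exI[of _ x]) (auto simp: dist_norm norm_minus_commute)
  qed
  then obtain xs where "\<forall>\<^sub>F m in sequentially. cmod (xs m - P m 0) < r m \<and> f (xs m) = \<phi> \<and>
      (\<forall>\<^sub>F x in at (xs m). f x \<noteq> \<phi>)"
  proof -
    assume "\<forall>\<^sub>F m in sequentially. \<exists>x. cmod (x - P m 0) < r m \<and> f x = \<phi> \<and> (\<forall>\<^sub>F x in at x. f x \<noteq> \<phi>)"
    then have "\<forall>\<^sub>F m in sequentially. let x = (SOME x. cmod (x - P m 0) < r m \<and> f x = \<phi> \<and> (\<forall>\<^sub>F x in at x. f x \<noteq> \<phi>)) in
       cmod (x - P m 0) < r m \<and> f x = \<phi> \<and> (\<forall>\<^sub>F x in at x. f x \<noteq> \<phi>)"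
      by (rule eventually_mono) (unfold Let_def, erule someI_ex)
    then show thesis unfolding Let_def by (rule that)
  qed
  then have xs: "\<forall>\<^sub>F m in sequentially. cmod (xs m - P m 0) < r m"
      "\<forall>\<^sub>F m in sequentially. f (xs m) = \<phi> \<and> (\<forall>\<^sub>F x in at (xs m). f x \<noteq> \<phi>)"
    by (auto elim: eventually_mono)
  show thesis
  proof (rule that[OF _ xs(2)])
    show "log_asymptotics xs b \<kappa>"
      unfolding log_asymptotics_def
    proof (rule bigoI[where c = "3 * C / c"])
      show "\<forall>\<^sub>F m in sequentially. cmod (xs m - (2 * of_nat m * of_real pi * \<i>
            - b * Ln (2 * of_nat m * of_real pi * \<i>) - Ln \<kappa>))
          \<le> 3 * C / c * cmod (of_real (ln (real m) / real m))"
        using xs(1) Lpos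
      proof eventually_elim
        case (elim m)
        have "P m 0 = 2 * of_nat m * of_real pi * \<i> - b * Ln (2 * of_nat m * of_real pi * \<i>) - Ln \<kappa>"
          by (simp add: P_def strip_point_def l_def mult_ac)
        moreover have "cmod (of_real (L m)) = L m" using elim(2) by simp
        ultimately show ?case using elim(1) by (simp add: r_def L_def)
      qed
    qed
  next
    fix Q assume "eventually Q (strip b (Ln \<kappa>) \<rho>)"
    from ev_cball[OF this[folded l_def]] xs(1) r\<rho>
    show "\<forall>\<^sub>F m in sequentially. \<forall>\<^sub>F x in nhds (xs m). Q x"
    proof eventually_elim
      case (elim m)
      \<comment> \<open>The point lies within r m < \<rho> of the centre, hence in the open disc, so
        what holds on the disc holds near the point.\<close>
      have "xs m \<in> ball (P m 0) \<rho>" using elim by (simp add: dist_norm norm_minus_commute)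
      then have "\<forall>\<^sub>F x in nhds (xs m). x \<in> ball (P m 0) \<rho>"
        by (intro eventually_nhds_in_open) auto
      then show ?case by eventually_elim (use elim(1) in auto)
    qed
  qed
qed

section \<open>Limits of the series\<close>

text \<open>The asymptotic representation is needed only with no terms at all (N = 0): it says that
  x^k a is bounded for large |x|, and k \<ge> 1 gives decay.\<close>

lemma bracket_tendsto_0:
  assumes "a \<in> bracket \<theta>0 \<theta>x \<theta>inf \<delta> P X k" "k \<ge> 1" "p \<in> P"
    and inf: "filterlim (\<lambda>x. x) at_infinity F" and "\<forall>\<^sub>F x in F. x \<in> sector \<delta> X"
  shows "(a p \<longlongrightarrow> 0) F"
proof -
  obtain f where "\<And>N. \<exists>C R. \<forall>p\<in>P. \<forall>x\<in>sector \<delta> X. cmod x > R \<longrightarrow>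
            cmod (x ^ k * a p x - (\<Sum>j<N. f j p / x ^ j)) \<le> C / cmod x ^ N"
    using assms(1) unfolding bracket_def by blast
  from this[of 0] obtain C R where CR: "\<And>x. x \<in> sector \<delta> X \<Longrightarrow> cmod x > R \<Longrightarrow> cmod (x ^ k * a p x) \<le> C"
    using assms(3) by auto
  have "\<forall>\<^sub>F x in F. cmod x > max R 0"
    using filterlim_at_infinity_imp_norm_at_top[OF inf] unfolding filterlim_at_top_dense by blast
  then have "\<forall>\<^sub>F x in F. cmod (a p x) \<le> C * cmod (inverse x ^ k)"
    using assms(5)
  proof eventually_elim
    case (elim x)
    then have "x \<noteq> 0" by auto
    then have "a p x = (x ^ k * a p x) * inverse x ^ k" by (simp add: field_simps)
    then have "cmod (a p x) = cmod (x ^ k * a p x) * cmod (inverse x ^ k)"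
      by (metis norm_mult)
    also have "\<dots> \<le> C * cmod (inverse x ^ k)"
      using CR[of x] elim by (intro mult_right_mono) auto
    finally show ?case .
  qed
  moreover have "((\<lambda>x. C * cmod (inverse x ^ k)) \<longlongrightarrow> C * cmod (0 ^ k)) F"
    by (intro tendsto_intros filterlim_compose[OF tendsto_inverse_0 inf])
  moreover have "C * cmod (0 ^ k) = 0" using assms(2) by (cases k) auto
  ultimately show ?thesis by (auto intro: Lim_null_comparison)
qed

text \<open>Uniform absolute convergence bounds the remainder by e/2 on the whole domain with one N.
  Each of the finitely many other terms tends to 0, being a decaying coefficient times a power of a
  bounded wave. No uniformity of the coefficients in n is used, and accordingly no rate
  results.\<close>

lemma tail_tendsto_0:
  assumes "h \<in> tail \<theta>0 \<theta>x \<theta>inf \<delta> P \<epsilon> X n0 g k w" and k: "\<And>n. n \<ge> n0 \<Longrightarrow> k n \<ge> 1"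
    and p: "(c0, cx, \<sigma>) \<in> P"
    and inf: "filterlim (\<lambda>x. x) at_infinity F"
    and dom: "\<forall>\<^sub>F x in F. x \<in> Sigma_dom \<sigma> \<epsilon> X \<delta>" and w: "\<forall>\<^sub>F x in F. cmod (w \<sigma> x) \<le> B"
  shows "(h (c0, cx, \<sigma>) \<longlongrightarrow> 0) F"
proof -
  let ?D = "full_dom \<delta> P \<epsilon> X"
  let ?p = "(c0, cx, \<sigma>)"
  obtain b where b: "\<And>n. n \<ge> n0 \<Longrightarrow> b n \<in> bracket \<theta>0 \<theta>x \<theta>inf \<delta> P X (k n)"
    and t: "let t = (\<lambda>n ((c0, cx, \<sigma>), x). g n (c0, cx, \<sigma>) * b n (c0, cx, \<sigma>) x * w \<sigma> x ^ n) in
        absolutely_uniformly_summable_from n0 ?D t \<and>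
        (\<forall>(p, x)\<in>?D. h p x = (\<Sum>n. t (n + n0) (p, x)))"
    using assms(1) unfolding tail_def by blast
  define u where "u = (\<lambda>n x. g (n + n0) ?p * b (n + n0) ?p x * w \<sigma> x ^ (n + n0))"
  have memD: "(?p, x) \<in> ?D" if "x \<in> Sigma_dom \<sigma> \<epsilon> X \<delta>" for x
    using that p by (auto simp: full_dom_def)
  have h: "h ?p x = (\<Sum>n. u n x)" if "x \<in> Sigma_dom \<sigma> \<epsilon> X \<delta>" for x
    using t memD[OF that] by (fastforce simp: u_def Let_def)
  have "uniformly_convergent_on ?D (\<lambda>N q. \<Sum>n=n0..<n0 + N.
      norm ((\<lambda>((c0, cx, \<sigma>), x). g n (c0, cx, \<sigma>) * b n (c0, cx, \<sigma>) x * w \<sigma> x ^ n) q))"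
    using t by (simp add: absolutely_uniformly_summable_from_def Let_def)
  then obtain S where S: "uniform_limit ?D (\<lambda>N q. \<Sum>n=n0..<n0 + N.
      norm ((\<lambda>((c0, cx, \<sigma>), x). g n (c0, cx, \<sigma>) * b n (c0, cx, \<sigma>) x * w \<sigma> x ^ n) q)) S sequentially"
    unfolding uniformly_convergent_on_def by blast
  have part: "(\<Sum>n=n0..<n0 + N. norm ((\<lambda>((c0, cx, \<sigma>), x). g n (c0, cx, \<sigma>) * b n (c0, cx, \<sigma>) x * w \<sigma> x ^ n) (?p, x)))
      = (\<Sum>n<N. norm (u n x))" for N x
    using sum.shift_bounds_nat_ivl[of "\<lambda>n. norm (g n ?p * b n ?p x * w \<sigma> x ^ n)" 0 n0 N]
    by (simp add: u_def add.commute lessThan_atLeast0)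
  show ?thesis
  proof (rule tendstoI)
    fix e :: real assume e: "e > 0"
    obtain N where N: "\<And>q. q \<in> ?D \<Longrightarrow> dist (\<Sum>n=n0..<n0 + N.
      norm ((\<lambda>((c0, cx, \<sigma>), x). g n (c0, cx, \<sigma>) * b n (c0, cx, \<sigma>) x * w \<sigma> x ^ n) q)) (S q) < e / 2"
      using uniform_limitD[OF S, of "e / 2"] e unfolding eventually_sequentially
      by (meson half_gt_zero order_refl)
    \<comment> \<open>The remainder of the series is dominated by the remainder of the series of
      norms, which the uniform limit S controls at x.\<close>
    have rest: "cmod (h ?p x - (\<Sum>n<N. u n x)) < e / 2" if x: "x \<in> Sigma_dom \<sigma> \<epsilon> X \<delta>" for x
    proof -
      have "(\<lambda>N. \<Sum>n<N. norm (u n x)) \<longlonglongrightarrow> S (?p, x)"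
        using tendsto_uniform_limitI[OF S memD[OF x]] unfolding part .
      then have s: "(\<lambda>n. norm (u n x)) sums S (?p, x)" by (simp add: sums_def)
      have sm: "summable (\<lambda>n. norm (u n x))" using s by (simp add: sums_iff)
      have "h ?p x - (\<Sum>n<N. u n x) = (\<Sum>n. u (n + N) x)"
        using suminf_split_initial_segment[OF summable_norm_cancel[OF sm], of N] h[OF x] by simp
      also have "norm \<dots> \<le> (\<Sum>n. norm (u (n + N) x))"
        using sm by (intro summable_norm) (simp add: summable_iff_shift[of "\<lambda>n. norm (u n x)"])
      also have "\<dots> = S (?p, x) - (\<Sum>n<N. norm (u n x))"
        using suminf_split_initial_segment[OF sm, of N] s by (simp add: sums_iff)
      also have "\<dots> < e / 2"
        using N[OF memD[OF x]] unfolding part dist_real_def by linarith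
      finally show ?thesis .
    qed
    have sec: "\<forall>\<^sub>F x in F. x \<in> sector \<delta> X" using dom by (auto elim: eventually_mono simp: Sigma_dom_def)
    have "((\<lambda>x. u n x) \<longlongrightarrow> 0) F" for n
    proof -
      have "((\<lambda>x. b (n + n0) ?p x) \<longlongrightarrow> 0) F"
        using bracket_tendsto_0[OF b k p inf sec, of "n + n0"] by simp
      then have "((\<lambda>x. b (n + n0) ?p x * (g (n + n0) ?p * w \<sigma> x ^ (n + n0))) \<longlongrightarrow> 0) F"
      proof (rule lim_null_mult_right_bounded)
        show "\<forall>\<^sub>F x in F. cmod (g (n + n0) ?p * w \<sigma> x ^ (n + n0)) \<le> cmod (g (n + n0) ?p) * B ^ (n + n0)"
          using w by eventually_elim (auto simp: norm_mult norm_power intro!: mult_left_mono power_mono)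
      qed
      then show ?thesis by (simp add: u_def mult_ac)
    qed
    then have "((\<lambda>x. \<Sum>n<N. u n x) \<longlongrightarrow> (\<Sum>n<N. 0)) F" by (intro tendsto_sum)
    then have "\<forall>\<^sub>F x in F. cmod (\<Sum>n<N. u n x) < e / 2"
      using tendstoD[where e = "e / 2"] e by fastforce
    then show "\<forall>\<^sub>F x in F. dist (h ?p x) 0 < e"
      using dom
    proof eventually_elim
      case (elim x)
      then show ?case
        using rest[of x] norm_triangle_ineq[of "h ?p x - (\<Sum>n<N. u n x)" "\<Sum>n<N. u n x"] by simp
    qed
  qed
qed

lemma exp_powr_eq_xi_over: "x \<noteq> 0 \<Longrightarrow> exp x * x powr (\<sigma> - 2) = xi \<sigma> x * inverse x"
  using powr_diff[of x "\<sigma> - 1" 1] by (simp add: xi_def divide_inverse)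

lemma exp_powr_eq_eta_over: "x \<noteq> 0 \<Longrightarrow> exp (- x) * x powr (- \<sigma> - 2) = eta \<sigma> x * inverse x"
  using powr_diff[of x "- \<sigma> - 1" 1] by (simp add: eta_def divide_inverse diff_diff_eq)

section \<open>Limits of the series at one fixed parameter\<close>

context
  fixes \<theta>0 \<theta>x \<theta>inf \<sigma> c0 cx :: complex and \<delta> \<epsilon> X :: real and P :: "param set"
    and F :: "complex filter"
    and f0 fp fm g0 gp gm :: "param \<Rightarrow> complex \<Rightarrow> complex"
  assumes sol: "series_solution \<theta>0 \<theta>x \<theta>inf \<delta> P \<epsilon> X f0 fp fm g0 gp gm"
    and p: "(c0, cx, \<sigma>) \<in> P"
    and inf: "filterlim (\<lambda>x. x) at_infinity F"
    and dom: "\<forall>\<^sub>F x in F. x \<in> Sigma_dom \<sigma> \<epsilon> X \<delta>"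
begin

private abbreviation (input) "q \<equiv> (c0, cx, \<sigma>)"
private abbreviation (input) "brk \<equiv> bracket \<theta>0 \<theta>x \<theta>inf \<delta> P X"
private abbreviation (input) "tls \<equiv> tail \<theta>0 \<theta>x \<theta>inf \<delta> P \<epsilon> X"
private abbreviation (input) "\<Gamma>x \<equiv> Gamma_xi \<theta>0 \<theta>x \<theta>inf"
private abbreviation (input) "\<Gamma>e \<equiv> Gamma_eta \<theta>0 \<theta>x \<theta>inf"
private abbreviation (input) "\<gamma>\<^sub>0p \<equiv> gamma0p \<theta>0 \<theta>inf"
private abbreviation (input) "\<gamma>\<^sub>0m \<equiv> gamma0m \<theta>0 \<theta>inf"
private abbreviation (input) "\<gamma>\<^sub>xp \<equiv> gammaxp \<theta>x \<theta>inf"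
private abbreviation (input) "\<gamma>\<^sub>xm \<equiv> gammaxm \<theta>x \<theta>inf"

private lemma memD: "\<forall>\<^sub>F x in F. (q, x) \<in> full_dom \<delta> P \<epsilon> X \<and> x \<noteq> 0"
  using dom by eventually_elim (use p in \<open>auto simp: full_dom_def Sigma_dom_def sector_def\<close>)

private lemma sec: "\<forall>\<^sub>F x in F. x \<in> sector \<delta> X"
  using dom by eventually_elim (auto simp: Sigma_dom_def)

private lemma inv0: "(inverse \<longlongrightarrow> 0) F"
  by (rule filterlim_compose[OF tendsto_inverse_0 inf])

private lemma xiB: "\<forall>\<^sub>F x in F. cmod (xi \<sigma> x) \<le> \<epsilon>" and etaB: "\<forall>\<^sub>F x in F. cmod (eta \<sigma> x) \<le> \<epsilon>"
  using dom by (eventually_elim, auto simp: Sigma_dom_def)+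

private lemma xi_null: "(b \<longlongrightarrow> 0) F \<Longrightarrow> ((\<lambda>x. b x * xi \<sigma> x) \<longlongrightarrow> 0) F"
  and eta_null: "(b \<longlongrightarrow> 0) F \<Longrightarrow> ((\<lambda>x. b x * eta \<sigma> x) \<longlongrightarrow> 0) F"
  by (rule lim_null_mult_right_bounded, assumption, rule xiB etaB)+

private lemma xi_inverse: "((\<lambda>x. xi \<sigma> x * inverse x) \<longlongrightarrow> 0) F"
  and eta_inverse: "((\<lambda>x. eta \<sigma> x * inverse x) \<longlongrightarrow> 0) F"
  using xi_null[OF inv0] eta_null[OF inv0] by (simp_all add: mult.commute)

private lemmas br = bracket_tendsto_0[OF _ order_refl p inf sec]
private lemmas br3 = bracket_tendsto_0[OF _ _ p inf sec, where k = 3, simplified]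
private lemmas tl_xi = tail_tendsto_0[where w = xi, OF _ _ p inf dom xiB]
private lemmas tl_eta = tail_tendsto_0[where w = eta, OF _ _ p inf dom etaB]

text \<open>\<open>eta\<close> is merely bounded, yet its powers with n \<ge> 2 disappear because
  their coefficients are in [x^(-n+1)]. Only the linear term has a coefficient that does not decay,
  and its correction b1 does.\<close>

lemma f0_limit_eta:
  assumes null: "(xi \<sigma> \<longlongrightarrow> 0) F"
  shows "((\<lambda>x. f0 q x - (\<sigma> - \<theta>inf) / 4 - \<Gamma>e q * eta \<sigma> x) \<longlongrightarrow> 0) F"
proof -
  obtain a a1 b1 A B where
      mem: "a \<in> brk 3" "a1 \<in> brk 1" "b1 \<in> brk 1"
      "A \<in> tls 2 (\<lambda>n p. \<Gamma>x p ^ n) (\<lambda>n. n - 1) xi"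
      "B \<in> tls 2 (\<lambda>n p. \<Gamma>e p ^ n) (\<lambda>n. n - 1) eta"
    and eq: "\<forall>(p, x)\<in>full_dom \<delta> P \<epsilon> X. let \<sigma> = snd (snd p) in
        f0 p x = (\<sigma> - \<theta>inf) / 4
          - 1/2 * ((\<sigma> + \<theta>inf) * \<gamma>\<^sub>0p p * \<gamma>\<^sub>0m p
              + (\<sigma> - \<theta>inf) * \<gamma>\<^sub>xp p * \<gamma>\<^sub>xm p) / x\<^sup>2
          + a p x
          + \<Gamma>x p * (1 + a1 p x) * xi \<sigma> x + A p x
          + \<Gamma>e p * (1 + b1 p x) * eta \<sigma> x + B p x"
    using sol unfolding series_solution_def f0_series_def by blast
  define c where "c = 1/2 * ((\<sigma> + \<theta>inf) * \<gamma>\<^sub>0p q * \<gamma>\<^sub>0m q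
              + (\<sigma> - \<theta>inf) * \<gamma>\<^sub>xp q * \<gamma>\<^sub>xm q)"
  have "(A q \<longlongrightarrow> 0) F" "(B q \<longlongrightarrow> 0) F"
    by (rule tl_xi[OF mem(4)] tl_eta[OF mem(5)]; simp)+
  note lims = this br3[OF mem(1)] br[OF mem(2)] br[OF mem(3)] eta_null[OF br[OF mem(3)]]
  have "((\<lambda>x. - c * (inverse x)\<^sup>2 + a q x + \<Gamma>x q * (1 + a1 q x) * xi \<sigma> x
       + \<Gamma>e q * (b1 q x * eta \<sigma> x) + A q x + B q x)
     \<longlongrightarrow> - c * 0\<^sup>2 + 0 + \<Gamma>x q * (1 + 0) * 0 + \<Gamma>e q * 0 + 0 + 0) F"
    by (rule lims null inv0 | rule tendsto_add tendsto_mult tendsto_power tendsto_const)+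
  then have "((\<lambda>x. - c * (inverse x)\<^sup>2 + a q x + \<Gamma>x q * (1 + a1 q x) * xi \<sigma> x
       + \<Gamma>e q * (b1 q x * eta \<sigma> x) + A q x + B q x) \<longlongrightarrow> 0) F" by simp
  then show ?thesis
  proof (rule Lim_transform_eventually)
    show "\<forall>\<^sub>F x in F. - c * (inverse x)\<^sup>2 + a q x + \<Gamma>x q * (1 + a1 q x) * xi \<sigma> x
       + \<Gamma>e q * (b1 q x * eta \<sigma> x) + A q x + B q x
       = f0 q x - (\<sigma> - \<theta>inf) / 4 - \<Gamma>e q * eta \<sigma> x"
      using memD
    proof eventually_elim
      case (elim x)
      have "f0 q x = (\<sigma> - \<theta>inf) / 4 - c / x\<^sup>2 + a q x
          + \<Gamma>x q * (1 + a1 q x) * xi \<sigma> x + A q x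
          + \<Gamma>e q * (1 + b1 q x) * eta \<sigma> x + B q x"
        using bspec[OF eq conjunct1[OF elim]] unfolding c_def Let_def case_prod_conv snd_conv .
      moreover have "c / x\<^sup>2 = c * (inverse x)\<^sup>2" by (simp add: power_inverse divide_inverse)
      ultimately show ?case by (simp only: distrib_left distrib_right mult.assoc mult_1_left) simp
    qed
  qed
qed

lemma f0_limit_xi:
  assumes null: "(eta \<sigma> \<longlongrightarrow> 0) F"
  shows "((\<lambda>x. f0 q x - (\<sigma> - \<theta>inf) / 4 - \<Gamma>x q * xi \<sigma> x) \<longlongrightarrow> 0) F"
proof -
  obtain a a1 b1 A B where
      mem: "a \<in> brk 3" "a1 \<in> brk 1" "b1 \<in> brk 1"
      "A \<in> tls 2 (\<lambda>n p. \<Gamma>x p ^ n) (\<lambda>n. n - 1) xi"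
      "B \<in> tls 2 (\<lambda>n p. \<Gamma>e p ^ n) (\<lambda>n. n - 1) eta"
    and eq: "\<forall>(p, x)\<in>full_dom \<delta> P \<epsilon> X. let \<sigma> = snd (snd p) in
        f0 p x = (\<sigma> - \<theta>inf) / 4
          - 1/2 * ((\<sigma> + \<theta>inf) * \<gamma>\<^sub>0p p * \<gamma>\<^sub>0m p
              + (\<sigma> - \<theta>inf) * \<gamma>\<^sub>xp p * \<gamma>\<^sub>xm p) / x\<^sup>2
          + a p x
          + \<Gamma>x p * (1 + a1 p x) * xi \<sigma> x + A p x
          + \<Gamma>e p * (1 + b1 p x) * eta \<sigma> x + B p x"
    using sol unfolding series_solution_def f0_series_def by blast
  define c where "c = 1/2 * ((\<sigma> + \<theta>inf) * \<gamma>\<^sub>0p q * \<gamma>\<^sub>0m q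
              + (\<sigma> - \<theta>inf) * \<gamma>\<^sub>xp q * \<gamma>\<^sub>xm q)"
  have "(A q \<longlongrightarrow> 0) F" "(B q \<longlongrightarrow> 0) F"
    by (rule tl_xi[OF mem(4)] tl_eta[OF mem(5)]; simp)+
  note lims = this br3[OF mem(1)] br[OF mem(2)] br[OF mem(3)] xi_null[OF br[OF mem(2)]]
  have "((\<lambda>x. - c * (inverse x)\<^sup>2 + a q x + \<Gamma>e q * (1 + b1 q x) * eta \<sigma> x
       + \<Gamma>x q * (a1 q x * xi \<sigma> x) + A q x + B q x)
     \<longlongrightarrow> - c * 0\<^sup>2 + 0 + \<Gamma>e q * (1 + 0) * 0 + \<Gamma>x q * 0 + 0 + 0) F"
    by (rule lims null inv0 | rule tendsto_add tendsto_mult tendsto_power tendsto_const)+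
  then have "((\<lambda>x. - c * (inverse x)\<^sup>2 + a q x + \<Gamma>e q * (1 + b1 q x) * eta \<sigma> x
       + \<Gamma>x q * (a1 q x * xi \<sigma> x) + A q x + B q x) \<longlongrightarrow> 0) F" by simp
  then show ?thesis
  proof (rule Lim_transform_eventually)
    show "\<forall>\<^sub>F x in F. - c * (inverse x)\<^sup>2 + a q x + \<Gamma>e q * (1 + b1 q x) * eta \<sigma> x
       + \<Gamma>x q * (a1 q x * xi \<sigma> x) + A q x + B q x
       = f0 q x - (\<sigma> - \<theta>inf) / 4 - \<Gamma>x q * xi \<sigma> x"
      using memD
    proof eventually_elim
      case (elim x)
      have "f0 q x = (\<sigma> - \<theta>inf) / 4 - c / x\<^sup>2 + a q x
          + \<Gamma>x q * (1 + a1 q x) * xi \<sigma> x + A q x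
          + \<Gamma>e q * (1 + b1 q x) * eta \<sigma> x + B q x"
        using bspec[OF eq conjunct1[OF elim]] unfolding c_def Let_def case_prod_conv snd_conv .
      moreover have "c / x\<^sup>2 = c * (inverse x)\<^sup>2" by (simp add: power_inverse divide_inverse)
      ultimately show ?case by (simp only: distrib_left distrib_right mult.assoc mult_1_left) simp
    qed
  qed
qed

text \<open>The terms in \<open>eta\<close> carry an additional 1/x or a coefficient in [x^(-n)], so
  boundedness of \<open>eta\<close> suffices, whereas the terms linear and quadratic in
  \<open>xi\<close> vanish only with \<open>xi\<close>. The same pattern holds for g_-, and the
  product of the two limits is \<open>Gamma_eta\<close>.\<close>

lemma fp_limit:
  assumes null: "(xi \<sigma> \<longlongrightarrow> 0) F"
  shows "((\<lambda>x. x powr ((\<sigma> + \<theta>inf) / 2) * fp q x) \<longlongrightarrow> \<gamma>\<^sub>0p q) F"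
proof -
  obtain a a1 a2 b1 A B where
      mem: "a \<in> brk 1" "a1 \<in> brk 1" "a2 \<in> brk 1" "b1 \<in> brk 1"
      "A \<in> tls 3 (\<lambda>n p. \<gamma>\<^sub>xp p * \<Gamma>x p ^ (n - 1)) (\<lambda>n. n - 2) xi"
      "B \<in> tls 2 (\<lambda>n p. \<gamma>\<^sub>0p p * \<Gamma>e p ^ n) (\<lambda>n. n) eta"
    and eq: "\<forall>(p, x)\<in>full_dom \<delta> P \<epsilon> X. let \<sigma> = snd (snd p) in
        x powr ((\<sigma> + \<theta>inf) / 2) * fp p x =
          \<gamma>\<^sub>0p p * (1 + a p x)
          - \<gamma>\<^sub>xp p * ((\<sigma> - \<theta>inf) / 2 + a1 p x) * xi \<sigma> x
          - \<gamma>\<^sub>0m p * (\<gamma>\<^sub>xp p)\<^sup>2 * (1 + a2 p x) * (xi \<sigma> x)\<^sup>2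
          + A p x
          + 2 * (\<gamma>\<^sub>0p p)\<^sup>2 * \<gamma>\<^sub>xm p * (1 + b1 p x) * (exp (- x) * x powr (- \<sigma> - 2))
          + B p x"
    using sol unfolding series_solution_def fp_series_def by blast
  have tails: "(A q \<longlongrightarrow> 0) F" "(B q \<longlongrightarrow> 0) F"
    by (rule tl_xi[OF mem(5)] tl_eta[OF mem(6)]; simp)+
  have "((\<lambda>x. \<gamma>\<^sub>0p q * (1 + a q x)
          - \<gamma>\<^sub>xp q * ((\<sigma> - \<theta>inf) / 2 + a1 q x) * xi \<sigma> x
          - \<gamma>\<^sub>0m q * (\<gamma>\<^sub>xp q)\<^sup>2 * (1 + a2 q x) * (xi \<sigma> x)\<^sup>2
          + A q x
          + 2 * (\<gamma>\<^sub>0p q)\<^sup>2 * \<gamma>\<^sub>xm q * (1 + b1 q x) * (eta \<sigma> x * inverse x)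
          + B q x)
     \<longlongrightarrow> \<gamma>\<^sub>0p q * (1 + 0) - \<gamma>\<^sub>xp q * ((\<sigma> - \<theta>inf) / 2 + 0) * 0 - \<gamma>\<^sub>0m q * (\<gamma>\<^sub>xp q)\<^sup>2 * (1 + 0) * 0\<^sup>2 + 0 + 2 * (\<gamma>\<^sub>0p q)\<^sup>2 * \<gamma>\<^sub>xm q * (1 + 0) * 0 + 0) F"
    by (rule tails null eta_inverse br[OF mem(1)] br[OF mem(2)] br[OF mem(3)] br[OF mem(4)]
        | rule tendsto_add tendsto_diff tendsto_minus tendsto_mult tendsto_power tendsto_const)+
  then have "((\<lambda>x. \<gamma>\<^sub>0p q * (1 + a q x)
          - \<gamma>\<^sub>xp q * ((\<sigma> - \<theta>inf) / 2 + a1 q x) * xi \<sigma> x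
          - \<gamma>\<^sub>0m q * (\<gamma>\<^sub>xp q)\<^sup>2 * (1 + a2 q x) * (xi \<sigma> x)\<^sup>2
          + A q x
          + 2 * (\<gamma>\<^sub>0p q)\<^sup>2 * \<gamma>\<^sub>xm q * (1 + b1 q x) * (eta \<sigma> x * inverse x)
          + B q x)
     \<longlongrightarrow> \<gamma>\<^sub>0p q) F" by simp
  then show ?thesis
  proof (rule Lim_transform_eventually)
    show "\<forall>\<^sub>F x in F. \<gamma>\<^sub>0p q * (1 + a q x)
          - \<gamma>\<^sub>xp q * ((\<sigma> - \<theta>inf) / 2 + a1 q x) * xi \<sigma> x
          - \<gamma>\<^sub>0m q * (\<gamma>\<^sub>xp q)\<^sup>2 * (1 + a2 q x) * (xi \<sigma> x)\<^sup>2
          + A q x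
          + 2 * (\<gamma>\<^sub>0p q)\<^sup>2 * \<gamma>\<^sub>xm q * (1 + b1 q x) * (eta \<sigma> x * inverse x)
          + B q x
        = x powr ((\<sigma> + \<theta>inf) / 2) * fp q x"
      using memD
    proof eventually_elim
      case (elim x)
      show ?case
        using bspec[OF eq conjunct1[OF elim]] unfolding Let_def case_prod_conv snd_conv
        by (simp only: exp_powr_eq_eta_over[OF conjunct2[OF elim]])
    qed
  qed
qed

text \<open>Here the two waves change roles: it is \<open>eta\<close> that must vanish and
  \<open>xi\<close> that may stay bounded. Together with f_-, which has the same pattern, the limits
  multiply to \<open>Gamma_xi\<close>.\<close>

lemma gp_limit:
  assumes null: "(eta \<sigma> \<longlongrightarrow> 0) F"
  shows "((\<lambda>x. exp (- x) * x powr (- (\<sigma> - \<theta>inf) / 2) * gp q x) \<longlongrightarrow> \<gamma>\<^sub>xp q) F"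
proof -
  obtain a a1 b1 b2 A B where
      mem: "a \<in> brk 1" "a1 \<in> brk 1" "b1 \<in> brk 1" "b2 \<in> brk 1"
      "A \<in> tls 2 (\<lambda>n p. \<gamma>\<^sub>xp p * \<Gamma>x p ^ n) (\<lambda>n. n) xi"
      "B \<in> tls 3 (\<lambda>n p. \<gamma>\<^sub>0p p * \<Gamma>e p ^ (n - 1)) (\<lambda>n. n - 2) eta"
    and eq: "\<forall>(p, x)\<in>full_dom \<delta> P \<epsilon> X. let \<sigma> = snd (snd p) in
        exp (- x) * x powr (- (\<sigma> - \<theta>inf) / 2) * gp p x =
          \<gamma>\<^sub>xp p * (1 + a p x)
          + 2 * \<gamma>\<^sub>0m p * (\<gamma>\<^sub>xp p)\<^sup>2 * (1 + a1 p x) * (exp x * x powr (\<sigma> - 2))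
          + A p x
          - \<gamma>\<^sub>0p p * ((\<sigma> + \<theta>inf) / 2 + b1 p x) * eta \<sigma> x
          - (\<gamma>\<^sub>0p p)\<^sup>2 * \<gamma>\<^sub>xm p * (1 + b2 p x) * (eta \<sigma> x)\<^sup>2
          + B p x"
    using sol unfolding series_solution_def gp_series_def by blast
  have tails: "(A q \<longlongrightarrow> 0) F" "(B q \<longlongrightarrow> 0) F"
    by (rule tl_xi[OF mem(5)] tl_eta[OF mem(6)]; simp)+
  have "((\<lambda>x. \<gamma>\<^sub>xp q * (1 + a q x)
          + 2 * \<gamma>\<^sub>0m q * (\<gamma>\<^sub>xp q)\<^sup>2 * (1 + a1 q x) * (xi \<sigma> x * inverse x)
          + A q x
          - \<gamma>\<^sub>0p q * ((\<sigma> + \<theta>inf) / 2 + b1 q x) * eta \<sigma> x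
          - (\<gamma>\<^sub>0p q)\<^sup>2 * \<gamma>\<^sub>xm q * (1 + b2 q x) * (eta \<sigma> x)\<^sup>2
          + B q x)
     \<longlongrightarrow> \<gamma>\<^sub>xp q * (1 + 0) + 2 * \<gamma>\<^sub>0m q * (\<gamma>\<^sub>xp q)\<^sup>2 * (1 + 0) * 0 + 0 - \<gamma>\<^sub>0p q * ((\<sigma> + \<theta>inf) / 2 + 0) * 0 - (\<gamma>\<^sub>0p q)\<^sup>2 * \<gamma>\<^sub>xm q * (1 + 0) * 0\<^sup>2 + 0) F"
    by (rule tails null xi_inverse br[OF mem(1)] br[OF mem(2)] br[OF mem(3)] br[OF mem(4)]
        | rule tendsto_add tendsto_diff tendsto_minus tendsto_mult tendsto_power tendsto_const)+
  then have "((\<lambda>x. \<gamma>\<^sub>xp q * (1 + a q x)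
          + 2 * \<gamma>\<^sub>0m q * (\<gamma>\<^sub>xp q)\<^sup>2 * (1 + a1 q x) * (xi \<sigma> x * inverse x)
          + A q x
          - \<gamma>\<^sub>0p q * ((\<sigma> + \<theta>inf) / 2 + b1 q x) * eta \<sigma> x
          - (\<gamma>\<^sub>0p q)\<^sup>2 * \<gamma>\<^sub>xm q * (1 + b2 q x) * (eta \<sigma> x)\<^sup>2
          + B q x)
     \<longlongrightarrow> \<gamma>\<^sub>xp q) F" by simp
  then show ?thesis
  proof (rule Lim_transform_eventually)
    show "\<forall>\<^sub>F x in F. \<gamma>\<^sub>xp q * (1 + a q x)
          + 2 * \<gamma>\<^sub>0m q * (\<gamma>\<^sub>xp q)\<^sup>2 * (1 + a1 q x) * (xi \<sigma> x * inverse x)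
          + A q x
          - \<gamma>\<^sub>0p q * ((\<sigma> + \<theta>inf) / 2 + b1 q x) * eta \<sigma> x
          - (\<gamma>\<^sub>0p q)\<^sup>2 * \<gamma>\<^sub>xm q * (1 + b2 q x) * (eta \<sigma> x)\<^sup>2
          + B q x
        = exp (- x) * x powr (- (\<sigma> - \<theta>inf) / 2) * gp q x"
      using memD
    proof eventually_elim
      case (elim x)
      show ?case
        using bspec[OF eq conjunct1[OF elim]] unfolding Let_def case_prod_conv snd_conv
        by (simp only: exp_powr_eq_xi_over[OF conjunct2[OF elim]])
    qed
  qed
qed

lemma fm_limit:
  assumes null: "(eta \<sigma> \<longlongrightarrow> 0) F"
  shows "((\<lambda>x. x powr (- (\<sigma> + \<theta>inf) / 2) * fm q x) \<longlongrightarrow> \<gamma>\<^sub>0m q) F"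
proof -
  obtain a a1 b1 b2 A B where
      mem: "a \<in> brk 1" "a1 \<in> brk 1" "b1 \<in> brk 1" "b2 \<in> brk 1"
      "A \<in> tls 2 (\<lambda>n p. \<gamma>\<^sub>0m p * \<Gamma>x p ^ n) (\<lambda>n. n) xi"
      "B \<in> tls 3 (\<lambda>n p. \<gamma>\<^sub>xm p * \<Gamma>e p ^ (n - 1)) (\<lambda>n. n - 2) eta"
    and eq: "\<forall>(p, x)\<in>full_dom \<delta> P \<epsilon> X. let \<sigma> = snd (snd p) in
        x powr (- (\<sigma> + \<theta>inf) / 2) * fm p x =
          \<gamma>\<^sub>0m p * (1 + a p x)
          + 2 * (\<gamma>\<^sub>0m p)\<^sup>2 * \<gamma>\<^sub>xp p * (1 + a1 p x) * (exp x * x powr (\<sigma> - 2))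
          + A p x
          - \<gamma>\<^sub>xm p * ((\<sigma> - \<theta>inf) / 2 + b1 p x) * eta \<sigma> x
          - \<gamma>\<^sub>0p p * (\<gamma>\<^sub>xm p)\<^sup>2 * (1 + b2 p x) * (eta \<sigma> x)\<^sup>2
          + B p x"
    using sol unfolding series_solution_def fm_series_def by blast
  have tails: "(A q \<longlongrightarrow> 0) F" "(B q \<longlongrightarrow> 0) F"
    by (rule tl_xi[OF mem(5)] tl_eta[OF mem(6)]; simp)+
  have "((\<lambda>x. \<gamma>\<^sub>0m q * (1 + a q x)
          + 2 * (\<gamma>\<^sub>0m q)\<^sup>2 * \<gamma>\<^sub>xp q * (1 + a1 q x) * (xi \<sigma> x * inverse x)
          + A q x
          - \<gamma>\<^sub>xm q * ((\<sigma> - \<theta>inf) / 2 + b1 q x) * eta \<sigma> x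
          - \<gamma>\<^sub>0p q * (\<gamma>\<^sub>xm q)\<^sup>2 * (1 + b2 q x) * (eta \<sigma> x)\<^sup>2
          + B q x)
     \<longlongrightarrow> \<gamma>\<^sub>0m q * (1 + 0) + 2 * (\<gamma>\<^sub>0m q)\<^sup>2 * \<gamma>\<^sub>xp q * (1 + 0) * 0 + 0 - \<gamma>\<^sub>xm q * ((\<sigma> - \<theta>inf) / 2 + 0) * 0 - \<gamma>\<^sub>0p q * (\<gamma>\<^sub>xm q)\<^sup>2 * (1 + 0) * 0\<^sup>2 + 0) F"
    by (rule tails null xi_inverse br[OF mem(1)] br[OF mem(2)] br[OF mem(3)] br[OF mem(4)]
        | rule tendsto_add tendsto_diff tendsto_minus tendsto_mult tendsto_power tendsto_const)+
  then have "((\<lambda>x. \<gamma>\<^sub>0m q * (1 + a q x)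
          + 2 * (\<gamma>\<^sub>0m q)\<^sup>2 * \<gamma>\<^sub>xp q * (1 + a1 q x) * (xi \<sigma> x * inverse x)
          + A q x
          - \<gamma>\<^sub>xm q * ((\<sigma> - \<theta>inf) / 2 + b1 q x) * eta \<sigma> x
          - \<gamma>\<^sub>0p q * (\<gamma>\<^sub>xm q)\<^sup>2 * (1 + b2 q x) * (eta \<sigma> x)\<^sup>2
          + B q x)
     \<longlongrightarrow> \<gamma>\<^sub>0m q) F" by simp
  then show ?thesis
  proof (rule Lim_transform_eventually)
    show "\<forall>\<^sub>F x in F. \<gamma>\<^sub>0m q * (1 + a q x)
          + 2 * (\<gamma>\<^sub>0m q)\<^sup>2 * \<gamma>\<^sub>xp q * (1 + a1 q x) * (xi \<sigma> x * inverse x)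
          + A q x
          - \<gamma>\<^sub>xm q * ((\<sigma> - \<theta>inf) / 2 + b1 q x) * eta \<sigma> x
          - \<gamma>\<^sub>0p q * (\<gamma>\<^sub>xm q)\<^sup>2 * (1 + b2 q x) * (eta \<sigma> x)\<^sup>2
          + B q x
        = x powr (- (\<sigma> + \<theta>inf) / 2) * fm q x"
      using memD
    proof eventually_elim
      case (elim x)
      show ?case
        using bspec[OF eq conjunct1[OF elim]] unfolding Let_def case_prod_conv snd_conv
        by (simp only: exp_powr_eq_xi_over[OF conjunct2[OF elim]])
    qed
  qed
qed

lemma gm_limit:
  assumes null: "(xi \<sigma> \<longlongrightarrow> 0) F"
  shows "((\<lambda>x. exp x * x powr ((\<sigma> - \<theta>inf) / 2) * gm q x) \<longlongrightarrow> \<gamma>\<^sub>xm q) F"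
proof -
  obtain a a1 a2 b1 A B where
      mem: "a \<in> brk 1" "a1 \<in> brk 1" "a2 \<in> brk 1" "b1 \<in> brk 1"
      "A \<in> tls 3 (\<lambda>n p. \<gamma>\<^sub>0m p * \<Gamma>x p ^ (n - 1)) (\<lambda>n. n - 2) xi"
      "B \<in> tls 2 (\<lambda>n p. \<gamma>\<^sub>xm p * \<Gamma>e p ^ n) (\<lambda>n. n) eta"
    and eq: "\<forall>(p, x)\<in>full_dom \<delta> P \<epsilon> X. let \<sigma> = snd (snd p) in
        exp x * x powr ((\<sigma> - \<theta>inf) / 2) * gm p x =
          \<gamma>\<^sub>xm p * (1 + a p x)
          - \<gamma>\<^sub>0m p * ((\<sigma> + \<theta>inf) / 2 + a1 p x) * xi \<sigma> x
          - (\<gamma>\<^sub>0m p)\<^sup>2 * \<gamma>\<^sub>xp p * (1 + a2 p x) * (xi \<sigma> x)\<^sup>2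
          + A p x
          + 2 * \<gamma>\<^sub>0p p * (\<gamma>\<^sub>xm p)\<^sup>2 * (1 + b1 p x) * (exp (- x) * x powr (- \<sigma> - 2))
          + B p x"
    using sol unfolding series_solution_def gm_series_def by blast
  have tails: "(A q \<longlongrightarrow> 0) F" "(B q \<longlongrightarrow> 0) F"
    by (rule tl_xi[OF mem(5)] tl_eta[OF mem(6)]; simp)+
  have "((\<lambda>x. \<gamma>\<^sub>xm q * (1 + a q x)
          - \<gamma>\<^sub>0m q * ((\<sigma> + \<theta>inf) / 2 + a1 q x) * xi \<sigma> x
          - (\<gamma>\<^sub>0m q)\<^sup>2 * \<gamma>\<^sub>xp q * (1 + a2 q x) * (xi \<sigma> x)\<^sup>2
          + A q x
          + 2 * \<gamma>\<^sub>0p q * (\<gamma>\<^sub>xm q)\<^sup>2 * (1 + b1 q x) * (eta \<sigma> x * inverse x)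
          + B q x)
     \<longlongrightarrow> \<gamma>\<^sub>xm q * (1 + 0) - \<gamma>\<^sub>0m q * ((\<sigma> + \<theta>inf) / 2 + 0) * 0 - (\<gamma>\<^sub>0m q)\<^sup>2 * \<gamma>\<^sub>xp q * (1 + 0) * 0\<^sup>2 + 0 + 2 * \<gamma>\<^sub>0p q * (\<gamma>\<^sub>xm q)\<^sup>2 * (1 + 0) * 0 + 0) F"
    by (rule tails null eta_inverse br[OF mem(1)] br[OF mem(2)] br[OF mem(3)] br[OF mem(4)]
        | rule tendsto_add tendsto_diff tendsto_minus tendsto_mult tendsto_power tendsto_const)+
  then have "((\<lambda>x. \<gamma>\<^sub>xm q * (1 + a q x)
          - \<gamma>\<^sub>0m q * ((\<sigma> + \<theta>inf) / 2 + a1 q x) * xi \<sigma> x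
          - (\<gamma>\<^sub>0m q)\<^sup>2 * \<gamma>\<^sub>xp q * (1 + a2 q x) * (xi \<sigma> x)\<^sup>2
          + A q x
          + 2 * \<gamma>\<^sub>0p q * (\<gamma>\<^sub>xm q)\<^sup>2 * (1 + b1 q x) * (eta \<sigma> x * inverse x)
          + B q x)
     \<longlongrightarrow> \<gamma>\<^sub>xm q) F" by simp
  then show ?thesis
  proof (rule Lim_transform_eventually)
    show "\<forall>\<^sub>F x in F. \<gamma>\<^sub>xm q * (1 + a q x)
          - \<gamma>\<^sub>0m q * ((\<sigma> + \<theta>inf) / 2 + a1 q x) * xi \<sigma> x
          - (\<gamma>\<^sub>0m q)\<^sup>2 * \<gamma>\<^sub>xp q * (1 + a2 q x) * (xi \<sigma> x)\<^sup>2
          + A q x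
          + 2 * \<gamma>\<^sub>0p q * (\<gamma>\<^sub>xm q)\<^sup>2 * (1 + b1 q x) * (eta \<sigma> x * inverse x)
          + B q x
        = exp x * x powr ((\<sigma> - \<theta>inf) / 2) * gm q x"
      using memD
    proof eventually_elim
      case (elim x)
      show ?case
        using bspec[OF eq conjunct1[OF elim]] unfolding Let_def case_prod_conv snd_conv
        by (simp only: exp_powr_eq_eta_over[OF conjunct2[OF elim]])
    qed
  qed
qed

end

section \<open>The differential system\<close>

lemma traceless_nth [simp]:
  "traceless a b c $ 1 $ 1 = a" "traceless a b c $ 1 $ 2 = b"
  "traceless a b c $ 2 $ 1 = c" "traceless a b c $ 2 $ 2 = - a"
  by (simp_all add: traceless_def)

lemma commutator_traceless:
  "commutator (traceless a b c) (traceless a' b' c') =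
     traceless (b * c' - b' * c) (2 * (a * b' - b * a')) (2 * (c * a' - a * c'))"
  by (simp add: commutator_def vec_eq_iff forall_2 matrix_matrix_mult_def sum_2 algebra_simps)

text \<open>Trace zero leaves only the determinant as information, which is the characteristic
  polynomial at 0.\<close>

lemma has_eigenvalues_traceless:
  assumes "has_eigenvalues (traceless a b c) u (- u)" shows "b * c = u\<^sup>2 - a\<^sup>2"
proof -
  have "det (mat 0 - traceless a b c) = (0 - u) * (0 - - u)"
    using assms unfolding has_eigenvalues_def by blast
  then show ?thesis
    by (simp add: det_2 mat_def power2_eq_square algebra_simps eq_neg_iff_add_eq_0)
qed

lemma system_solution_scalar:
  assumes "system_solution \<theta>0 \<theta>x \<theta>inf \<delta> P \<epsilon> X (\<lambda>p x. traceless (f0 p x) (fp p x) (fm p x))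
             (\<lambda>p x. traceless (g0 p x) (gp p x) (gm p x))"
    and "(p, x) \<in> full_dom \<delta> P \<epsilon> X"
  shows "(f0 p has_field_derivative (gp p x * fm p x - fp p x * gm p x) / x) (at x)"
    and "(fp p has_field_derivative 2 * (g0 p x * fp p x - gp p x * f0 p x) / x) (at x)"
    and "(fm p has_field_derivative 2 * (gm p x * f0 p x - g0 p x * fm p x) / x) (at x)"
    and "(gp p has_field_derivative (2 * (f0 p x * gp p x - fp p x * g0 p x) + x * gp p x) / x) (at x)"
    and "(gm p has_field_derivative (2 * (fm p x * g0 p x - f0 p x * gm p x) - x * gm p x) / x) (at x)"
    and "fp p x * fm p x = \<theta>0\<^sup>2 / 4 - (f0 p x)\<^sup>2"
    and "gp p x * gm p x = \<theta>x\<^sup>2 / 4 - (g0 p x)\<^sup>2"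
    and "g0 p x = - \<theta>inf / 2 - f0 p x"
proof -
  note * = bspec[OF assms(1)[unfolded system_solution_def] assms(2), unfolded case_prod_conv]
  note d = conjunct1[OF *, rule_format]
  show "(f0 p has_field_derivative (gp p x * fm p x - fp p x * gm p x) / x) (at x)"
    and "(fp p has_field_derivative 2 * (g0 p x * fp p x - gp p x * f0 p x) / x) (at x)"
    and "(fm p has_field_derivative 2 * (gm p x * f0 p x - g0 p x * fm p x) / x) (at x)"
    using d[of 1 1] d[of 1 2] d[of 2 1] by (simp_all add: commutator_traceless)
  show "(gp p has_field_derivative (2 * (f0 p x * gp p x - fp p x * g0 p x) + x * gp p x) / x) (at x)"
    and "(gm p has_field_derivative (2 * (fm p x * g0 p x - f0 p x * gm p x) - x * gm p x) / x) (at x)"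
    using d[of 1 2] d[of 2 1] by (simp_all add: commutator_traceless J_mat_def)
  show "fp p x * fm p x = \<theta>0\<^sup>2 / 4 - (f0 p x)\<^sup>2" "gp p x * gm p x = \<theta>x\<^sup>2 / 4 - (g0 p x)\<^sup>2"
    using * has_eigenvalues_traceless[of _ _ _ "\<theta>0 / 2"] has_eigenvalues_traceless[of _ _ _ "\<theta>x / 2"]
    by (auto simp: power_divide)
  show "g0 p x = - \<theta>inf / 2 - f0 p x"
    using * by (simp add: algebra_simps)
qed

text \<open>The Lax system closes up on \<open>f0\<close> and the two products \<open>f\<^sub>+ g\<^sub>-\<close>, \<open>g\<^sub>+ f\<^sub>-\<close>.\<close>

lemma system_solution_products:
  assumes "system_solution \<theta>0 \<theta>x \<theta>inf \<delta> P \<epsilon> X (\<lambda>p x. traceless (f0 p x) (fp p x) (fm p x))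
             (\<lambda>p x. traceless (g0 p x) (gp p x) (gm p x))"
    and "(p, x) \<in> full_dom \<delta> P \<epsilon> X" and "x \<noteq> 0"
  defines "R \<equiv> - ((\<theta>inf + 2 * f0 p x) * (\<theta>0\<^sup>2 / 4 - (f0 p x)\<^sup>2))
                - 2 * f0 p x * (\<theta>x\<^sup>2 / 4 - (\<theta>inf / 2 + f0 p x)\<^sup>2)"
  shows "((\<lambda>x. fp p x * gm p x) has_field_derivative
            - (x * (fp p x * gm p x) + (\<theta>inf + 4 * f0 p x) * (fp p x * gm p x) - R) / x) (at x)"
    and "((\<lambda>x. gp p x * fm p x) has_field_derivative
            (x * (gp p x * fm p x) + (\<theta>inf + 4 * f0 p x) * (gp p x * fm p x) - R) / x) (at x)"
    and "(fp p x * gm p x) * (gp p x * fm p x) =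
            (\<theta>0\<^sup>2 / 4 - (f0 p x)\<^sup>2) * (\<theta>x\<^sup>2 / 4 - (\<theta>inf / 2 + f0 p x)\<^sup>2)"
proof -
  note S = system_solution_scalar[OF assms(1,2)]
  have g: "(g0 p x)\<^sup>2 = (\<theta>inf / 2 + f0 p x)\<^sup>2" unfolding S(8) by (simp add: power2_eq_square algebra_simps)
  have e1: "fp p x * fm p x = \<theta>0\<^sup>2 / 4 - (f0 p x)\<^sup>2" by (rule S(6))
  have e2: "gp p x * gm p x = \<theta>x\<^sup>2 / 4 - (\<theta>inf / 2 + f0 p x)\<^sup>2" using S(7) g by simp
  \<comment> \<open>This is how R arises: the mixed terms of both product derivatives are, with
    opposite signs, this combination of f_+ f_- and g_+ g_-, which the determinants turn into a
    polynomial in f0.\<close>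
  have R: "R = 2 * g0 p x * (fp p x * fm p x) - 2 * f0 p x * (gp p x * gm p x)"
    unfolding R_def e1 e2 S(8) by (simp add: field_simps)
  show "((\<lambda>x. fp p x * gm p x) has_field_derivative
            - (x * (fp p x * gm p x) + (\<theta>inf + 4 * f0 p x) * (fp p x * gm p x) - R) / x) (at x)"
    by (rule DERIV_cong[OF DERIV_mult[OF S(2,5)]], unfold R S(8), use assms(3) in \<open>simp add: field_simps\<close>)
  show "((\<lambda>x. gp p x * fm p x) has_field_derivative
            (x * (gp p x * fm p x) + (\<theta>inf + 4 * f0 p x) * (gp p x * fm p x) - R) / x) (at x)"
    by (rule DERIV_cong[OF DERIV_mult[OF S(4,3)]], unfold R S(8), use assms(3) in \<open>simp add: field_simps\<close>)
  show "(fp p x * gm p x) * (gp p x * fm p x) =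
            (\<theta>0\<^sup>2 / 4 - (f0 p x)\<^sup>2) * (\<theta>x\<^sup>2 / 4 - (\<theta>inf / 2 + f0 p x)\<^sup>2)"
    unfolding e1[symmetric] e2[symmetric] by simp
qed

text \<open>h is the dominant product of the pair f_+ g_-, g_+ f_- and k the other one; s = -1 and s
  = 1 exchange them. The limit says that h is like \<Gamma> x w, so the bounded product h k makes k
  of order 1/x. With H = h/x the system takes the form f' = s H + O(1/x^2) that the limit-to-rate
  argument needs.\<close>

lemma strip_product_rate:
  fixes f h k :: "complex \<Rightarrow> complex" and s \<sigma> \<theta> \<Gamma> l \<theta>0 \<theta>x :: complex and \<rho> :: real
  defines "\<Phi> \<equiv> strip (\<sigma> - s) l \<rho>" and "w \<equiv> wave s (\<sigma> - s)"
    and "R \<equiv> \<lambda>x. - ((\<theta> + 2 * f x) * (\<theta>0\<^sup>2 / 4 - (f x)\<^sup>2)) - 2 * f x * (\<theta>x\<^sup>2 / 4 - (\<theta> / 2 + f x)\<^sup>2)"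
  assumes \<rho>: "0 \<le> \<rho>" and s: "s = 1 \<or> s = -1" and \<Gamma>: "\<Gamma> \<noteq> 0"
    and Df: "\<forall>\<^sub>F x in \<Phi>. (f has_field_derivative s * (h x - k x) / x) (at x)"
    and Dh: "\<forall>\<^sub>F x in \<Phi>. (h has_field_derivative s * (x * h x + (\<theta> + 4 * f x) * h x - R x) / x) (at x)"
    and hk: "\<forall>\<^sub>F x in \<Phi>. h x * k x = (\<theta>0\<^sup>2 / 4 - (f x)\<^sup>2) * (\<theta>x\<^sup>2 / 4 - (\<theta> / 2 + f x)\<^sup>2)"
    and lim_f: "((\<lambda>x. f x - (\<sigma> - \<theta>) / 4 - \<Gamma> * w x) \<longlongrightarrow> 0) \<Phi>"
    and lim_h: "((\<lambda>x. h x / x / w x) \<longlongrightarrow> \<Gamma>) \<Phi>"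
  shows "(\<lambda>x. f x - (\<sigma> - \<theta>) / 4 - \<Gamma> * w x) \<in> O[\<Phi>](\<lambda>x. 1 / x)"
    and "\<forall>\<^sub>F x in \<Phi>. h x \<noteq> 0"
proof -
  have w0: "w x \<noteq> 0" for x by (simp add: w_def wave_def)
  have slit: "\<forall>\<^sub>F x in \<Phi>. x \<notin> \<real>\<^sub>\<le>\<^sub>0" unfolding \<Phi>_def by (rule eventually_strip_not_nonpos[OF \<rho>])
  have nz: "\<forall>\<^sub>F x in \<Phi>. h x / x / w x \<noteq> 0" by (rule tendsto_imp_eventually_ne[OF lim_h \<Gamma>])
  then show "\<forall>\<^sub>F x in \<Phi>. h x \<noteq> 0" by eventually_elim auto
  have wO: "w \<in> O[\<Phi>](\<lambda>_. 1)"
    unfolding w_def \<Phi>_def by (rule wave_bigo_1[OF \<rho> s])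
  have wO': "(\<lambda>x. 1 / w x) \<in> O[\<Phi>](\<lambda>_. 1)"
    unfolding w_def \<Phi>_def by (rule inverse_wave_bigo_1[OF \<rho> s])
  have cO: "(\<lambda>_. c) \<in> O[\<Phi>](\<lambda>_. 1)" for c :: complex by simp
  note mO = landau_o.big.mult_in_1 and aO = sum_in_bigo
  have fO: "f \<in> O[\<Phi>](\<lambda>_. 1)"
  proof -
    have "(\<lambda>x. (f x - (\<sigma> - \<theta>) / 4 - \<Gamma> * w x) + ((\<sigma> - \<theta>) / 4 + \<Gamma> * w x)) \<in> O[\<Phi>](\<lambda>_. 1)"
      by (intro aO mO wO cO tendsto_imp_bigo_1[OF lim_f])
    then show ?thesis by simp
  qed
  have iO: "(\<lambda>x. inverse (h x / x / w x)) \<in> O[\<Phi>](\<lambda>_. 1)"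
    by (rule tendsto_imp_bigo_1[OF tendsto_inverse[OF lim_h \<Gamma>]])
  have inv2: "(\<lambda>x. 1 / x\<^sup>2) \<in> O[\<Phi>](\<lambda>x. 1 / x\<^sup>2)" by simp
  define Q where "Q = (\<lambda>x. (\<theta>0 * \<theta>0 / 4 - f x * f x) * (\<theta>x * \<theta>x / 4 - (\<theta> / 2 + f x) * (\<theta> / 2 + f x)))"
  define r1 where "r1 = (\<lambda>x. - s * k x / x)"
  define r2 where "r2 = (\<lambda>x. - s * R x * (1 / x\<^sup>2))"
  show "(\<lambda>x. f x - (\<sigma> - \<theta>) / 4 - \<Gamma> * w x) \<in> O[\<Phi>](\<lambda>x. 1 / x)"
    unfolding \<Phi>_def w_def
  proof (rule bigo_strip_limit_rate[OF \<rho> s, where H = "\<lambda>x. h x / x" and ?r1.0 = r1 and ?r2.0 = r2]; fold \<Phi>_def w_def)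
    show "\<forall>\<^sub>F x in \<Phi>. (f has_field_derivative s * (h x / x) + r1 x) (at x)"
      using Df by eventually_elim (simp add: r1_def right_diff_distrib diff_divide_distrib)
    show "\<forall>\<^sub>F x in \<Phi>. ((\<lambda>x. h x / x) has_field_derivative
        s * (h x / x) + (s * (\<theta> + 4 * f x) - 1) * (h x / x) / x + r2 x) (at x)"
      using Dh slit
    proof eventually_elim
      case (elim x)
      have x: "x \<noteq> 0" using elim(2) by auto
      show ?case
        by (rule DERIV_cong[OF DERIV_divide[OF elim(1) DERIV_ident x]])
           (use x in \<open>simp add: r2_def field_simps power2_eq_square\<close>)
    qed
    \<comment> \<open>k is eliminated as Q/h, and 1/h is written through the convergent quotient
      h/x/w, which exhibits one factor 1/x; the definition of r1 supplies the other.\<close>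
    have "r1 \<in> O[\<Phi>](\<lambda>x. 1 / x\<^sup>2) \<longleftrightarrow>
        (\<lambda>x. (- s * Q x * inverse (h x / x / w x) * (1 / w x)) * (1 / x\<^sup>2)) \<in> O[\<Phi>](\<lambda>x. 1 / x\<^sup>2)"
    proof (rule landau_o.big.in_cong)
      show "\<forall>\<^sub>F x in \<Phi>. r1 x = (- s * Q x * inverse (h x / x / w x) * (1 / w x)) * (1 / x\<^sup>2)"
        using hk nz slit
      proof eventually_elim
        case (elim x)
        have x: "x \<noteq> 0" "h x \<noteq> 0" using elim by auto
        have "Q x = h x * k x" unfolding elim(1) Q_def by (simp add: power2_eq_square)
        then show ?case using x w0[of x] by (simp add: r1_def field_simps power2_eq_square)
      qed
    qed
    also have "\<dots>"
      unfolding Q_def by (intro bigo_1_mult[OF _ inv2] mO aO cO fO iO wO')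
    finally show "r1 \<in> O[\<Phi>](\<lambda>x. 1 / x\<^sup>2)" .
    show "r2 \<in> O[\<Phi>](\<lambda>x. 1 / x\<^sup>2)"
      unfolding r2_def R_def power2_eq_square[of "f _"] power2_eq_square[of "_ + f _"]
      by (intro bigo_1_mult[OF _ inv2] mO aO cO fO landau_o.big.uminus_in_iff[THEN iffD2])
  qed (use lim_f lim_h in auto)
qed

section \<open>Zeros and poles\<close>

text \<open>The two waves multiply to x^(-2), in the original notation
  \<open>xi * eta = 1 / x\<^sup>2\<close>. Hence one vanishes wherever the other is bounded away
  from zero.\<close>

lemma wave_other:
  assumes "s = 1 \<or> s = -1" "x \<noteq> 0"
  shows "wave (- s) (\<sigma> + s) x = (inverse x)\<^sup>2 * (1 / wave s (\<sigma> - s) x)"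
proof -
  have s: "s * s = 1" using assms by auto
  have "exp (- (2 * Ln x)) = (inverse x)\<^sup>2"
    using assms(2) by (simp add: exp_minus exp_double power_inverse)
  moreover have "- s * (x + (\<sigma> + s) * Ln x) = - (2 * Ln x) - s * (x + (\<sigma> - s) * Ln x)"
    using s by (simp add: algebra_simps)
  ultimately show ?thesis
    unfolding wave_def by (simp add: exp_diff)
qed

lemma eventually_strip_sector:
  assumes "0 \<le> \<rho>" "\<delta> < pi / 2" shows "\<forall>\<^sub>F x in strip b l \<rho>. x \<in> sector \<delta> X"
proof -
  have norm: "\<forall>\<^sub>F x in strip b l \<rho>. cmod x > X"
    using filterlim_at_infinity_imp_norm_at_top[OF filterlim_strip_at_infinity[OF assms(1)]]
    unfolding filterlim_at_top_dense by blast
  have "0 < pi / 2 - \<delta>" using assms(2) by simp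
  show ?thesis
    using norm eventually_strip_Arg[OF assms(1) \<open>0 < pi / 2 - \<delta>\<close>, of b l]
    by eventually_elim (simp add: sector_def)
qed

lemma wave_other_tendsto_0:
  assumes "0 \<le> \<rho>" and s: "s = 1 \<or> s = -1"
  shows "((\<lambda>x. wave (- s) (\<sigma> + s) x) \<longlongrightarrow> 0) (strip (\<sigma> - s) l \<rho>)"
proof -
  have "((\<lambda>x. (inverse x)\<^sup>2) \<longlongrightarrow> 0\<^sup>2) (strip (\<sigma> - s) l \<rho>)"
    by (intro tendsto_power filterlim_compose[OF tendsto_inverse_0 filterlim_strip_at_infinity[OF assms(1)]])
  then have "(\<lambda>x. (inverse x)\<^sup>2) \<in> o[strip (\<sigma> - s) l \<rho>](\<lambda>_. 1 :: complex)"
    by (intro smalloI_tendsto) auto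
  from landau_o.small_big_mult[OF this inverse_wave_bigo_1[OF assms]]
  have "((\<lambda>x. (inverse x)\<^sup>2 * (1 / wave s (\<sigma> - s) x)) \<longlongrightarrow> 0) (strip (\<sigma> - s) l \<rho>)"
    using smalloD_tendsto by fastforce
  then show ?thesis
  proof (rule Lim_transform_eventually)
    show "\<forall>\<^sub>F x in strip (\<sigma> - s) l \<rho>. (inverse x)\<^sup>2 * (1 / wave s (\<sigma> - s) x) = wave (- s) (\<sigma> + s) x"
      using eventually_strip_not_nonpos[OF assms(1), of "\<sigma> - s" l]
      by eventually_elim (subst wave_other[OF s]; auto)
  qed
qed

text \<open>The sector condition and the bound on the recessive wave hold automatically far out. The
  only genuine restriction is the size of the wave that defines the strip; \<rho>' > \<rho> leaves
  room for its fluctuation.\<close>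

lemma eventually_strip_Sigma_dom:
  assumes "0 \<le> \<rho>" and s: "s = 1 \<or> s = -1" and "\<rho> < \<rho>'" "cmod (exp (- s * l)) * exp \<rho>' < \<epsilon>"
    and "\<delta> < pi / 2"
  shows "\<forall>\<^sub>F x in strip (\<sigma> - s) l \<rho>. x \<in> Sigma_dom \<sigma> \<epsilon> X \<delta>"
proof -
  have "0 \<le> cmod (exp (- s * l)) * exp \<rho>'" by simp
  then have \<epsilon>: "0 < \<epsilon>" using assms(4) by linarith
  have "\<forall>\<^sub>F x in strip (\<sigma> - s) l \<rho>. cmod (wave (- s) (\<sigma> + s) x) < \<epsilon>"
    using tendstoD[OF wave_other_tendsto_0[OF assms(1,2)] \<epsilon>] by simp
  moreover have "\<forall>\<^sub>F x in strip (\<sigma> - s) l \<rho>. cmod (wave s (\<sigma> - s) x) < \<epsilon>"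
    using eventually_strip_wave(1)[OF assms(1-3), of "\<sigma> - s" l]
    by eventually_elim (use assms(4) in linarith)
  ultimately show ?thesis
    using eventually_strip_sector[OF assms(1,5), where b = "\<sigma> - s" and l = l and X = X]
  proof eventually_elim
    case (elim x)
    then have "x \<noteq> 0" by (simp add: sector_def)
    then have "xi \<sigma> x = wave 1 (\<sigma> - 1) x" "eta \<sigma> x = wave (- 1) (\<sigma> + 1) x"
      by (simp_all add: xi_eq_wave eta_eq_wave)
    moreover have "cmod (wave 1 (\<sigma> - 1) x) < \<epsilon> \<and> cmod (wave (- 1) (\<sigma> + 1) x) < \<epsilon>"
      using s
    proof
      assume "s = 1" with elim(1,2) show ?thesis by simp
    next
      assume "s = - 1" with elim(1,2) show ?thesis by simp
    qed
    ultimately show ?case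
      unfolding Sigma_dom_def using elim(3) by simp
  qed
qed

text \<open>A strict inequality between the central wave value a and \<epsilon> leaves a strip of
  positive width on which the wave is still below \<epsilon>. The bound 1/2 is the range of the
  elementary estimates for exp.\<close>

lemma strip_radius:
  assumes "0 < a" "a < (\<epsilon> :: real)"
  obtains \<rho> \<rho>' where "0 < \<rho>" "\<rho> \<le> 1 / 2" "\<rho> < \<rho>'" "a * exp \<rho>' < \<epsilon>"
proof -
  define r where "r = min 1 (ln (\<epsilon> / a) / 2)"
  have l: "0 < ln (\<epsilon> / a)" using assms by simp
  then have r: "0 < r" "r \<le> 1" "r < ln (\<epsilon> / a)" by (auto simp: r_def)
  have "exp r < exp (ln (\<epsilon> / a))" using r(3) by simp
  also have "\<dots> = \<epsilon> / a" using assms by (intro exp_ln divide_pos_pos) auto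
  finally have "exp r < \<epsilon> / a" .
  then have "a * exp r < \<epsilon>" using assms by (simp add: field_simps)
  then show thesis using r by (intro that[of "r / 2" r]) auto
qed

text \<open>The case s = -1 (zeros): \<open>xi\<close> dies out, f_+ g_- is dominant, and its limit
  after division by \<open>x * eta\<close> is the product of the limits of the f_+ and g_-
  series.\<close>

lemma series_solution_rate_eta:
  assumes sol: "series_solution \<theta>0 \<theta>x \<theta>inf \<delta> P \<epsilon> X f0 fp fm g0 gp gm"
    and p: "(c0, cx, \<sigma>) \<in> P" and \<Gamma>: "Gamma_eta \<theta>0 \<theta>x \<theta>inf (c0, cx, \<sigma>) \<noteq> 0"
    and \<rho>: "0 \<le> \<rho>" and dom: "\<forall>\<^sub>F x in strip (\<sigma> + 1) l \<rho>. x \<in> Sigma_dom \<sigma> \<epsilon> X \<delta>"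
  shows "(\<lambda>x. f0 (c0, cx, \<sigma>) x - (\<sigma> - \<theta>inf) / 4 - Gamma_eta \<theta>0 \<theta>x \<theta>inf (c0, cx, \<sigma>) * wave (- 1) (\<sigma> + 1) x)
           \<in> O[strip (\<sigma> + 1) l \<rho>](\<lambda>x. 1 / x)"
    and "\<forall>\<^sub>F x in strip (\<sigma> + 1) l \<rho>. fp (c0, cx, \<sigma>) x * gm (c0, cx, \<sigma>) x \<noteq> 0"
proof -
  let ?q = "(c0, cx, \<sigma>)" and ?\<Phi> = "strip (\<sigma> + 1) l \<rho>"
  have inf: "filterlim (\<lambda>x. x) at_infinity ?\<Phi>" by (rule filterlim_strip_at_infinity[OF \<rho>])
  have nz: "\<forall>\<^sub>F x in ?\<Phi>. x \<noteq> 0" using dom by eventually_elim (simp add: Sigma_dom_def sector_def)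
  have xi0: "(xi \<sigma> \<longlongrightarrow> 0) ?\<Phi>"
  proof (rule Lim_transform_eventually)
    show "((\<lambda>x. wave 1 (\<sigma> - 1) x) \<longlongrightarrow> 0) ?\<Phi>"
      using wave_other_tendsto_0[OF \<rho>, of "-1" \<sigma> l] by simp
    show "\<forall>\<^sub>F x in ?\<Phi>. wave 1 (\<sigma> - 1) x = xi \<sigma> x" using nz by eventually_elim (simp add: xi_eq_wave)
  qed
  have lim_f: "((\<lambda>x. f0 ?q x - (\<sigma> - \<theta>inf) / 4 - Gamma_eta \<theta>0 \<theta>x \<theta>inf ?q * wave (- 1) (\<sigma> + 1) x) \<longlongrightarrow> 0) ?\<Phi>"
  proof (rule Lim_transform_eventually[OF f0_limit_eta[OF sol p inf dom xi0]])
    show "\<forall>\<^sub>F x in ?\<Phi>. f0 ?q x - (\<sigma> - \<theta>inf) / 4 - Gamma_eta \<theta>0 \<theta>x \<theta>inf ?q * eta \<sigma> x =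
        f0 ?q x - (\<sigma> - \<theta>inf) / 4 - Gamma_eta \<theta>0 \<theta>x \<theta>inf ?q * wave (- 1) (\<sigma> + 1) x"
      using nz by eventually_elim (simp add: eta_eq_wave)
  qed
  have lim_h: "((\<lambda>x. fp ?q x * gm ?q x / x / wave (- 1) (\<sigma> + 1) x) \<longlongrightarrow> Gamma_eta \<theta>0 \<theta>x \<theta>inf ?q) ?\<Phi>"
    unfolding Gamma_eta_def
  proof (rule Lim_transform_eventually[OF tendsto_mult[OF fp_limit[OF sol p inf dom xi0] gm_limit[OF sol p inf dom xi0]]])
    show "\<forall>\<^sub>F x in ?\<Phi>. x powr ((\<sigma> + \<theta>inf) / 2) * fp ?q x * (exp x * x powr ((\<sigma> - \<theta>inf) / 2) * gm ?q x) =
        fp ?q x * gm ?q x / x / wave (- 1) (\<sigma> + 1) x"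
      using nz
    proof eventually_elim
      case (elim x)
      \<comment> \<open>The \<theta>inf parts of the two normalising powers cancel, and e^x
        x^\<sigma> is the reciprocal of \<open>x * eta\<close>.\<close>
      have "x powr ((\<sigma> + \<theta>inf) / 2) * x powr ((\<sigma> - \<theta>inf) / 2) = x powr \<sigma>"
        by (simp add: powr_add[symmetric] add_divide_distrib[symmetric])
      moreover have "exp x * x powr \<sigma> * (x * wave (- 1) (\<sigma> + 1) x) = 1"
      proof -
        have "exp x * x powr \<sigma> * (exp (Ln x) * wave (- 1) (\<sigma> + 1) x) = exp (x + \<sigma> * Ln x + (Ln x - (x + (\<sigma> + 1) * Ln x)))"
          using elim unfolding exp_add exp_diff by (simp add: powr_def wave_def exp_minus exp_add exp_diff divide_inverse)
        also have "\<dots> = 1" by (simp add: algebra_simps)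
        finally show ?thesis using elim by simp
      qed
      ultimately show ?case
        using elim by (simp add: wave_def field_simps)
    qed
  qed
  have mem: "\<forall>\<^sub>F x in ?\<Phi>. (?q, x) \<in> full_dom \<delta> P \<epsilon> X \<and> x \<noteq> 0"
    using dom nz by eventually_elim (use p in \<open>auto simp: full_dom_def\<close>)
  have sys: "system_solution \<theta>0 \<theta>x \<theta>inf \<delta> P \<epsilon> X (\<lambda>p x. traceless (f0 p x) (fp p x) (fm p x))
             (\<lambda>p x. traceless (g0 p x) (gp p x) (gm p x))"
    using sol by (simp add: series_solution_def)
  \<comment> \<open>The base is spelled \<open>\<sigma> - - 1\<close> to match the pattern b =
    \<sigma> - s at s = -1.\<close>
  have 1: "\<forall>\<^sub>F x in strip (\<sigma> - - 1) l \<rho>. (f0 ?q has_field_derivative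
      - 1 * (fp ?q x * gm ?q x - gp ?q x * fm ?q x) / x) (at x)"
    using mem[folded diff_minus_eq_add] by eventually_elim (use system_solution_scalar(1)[OF sys] in auto)
  have 2: "\<forall>\<^sub>F x in strip (\<sigma> - - 1) l \<rho>. ((\<lambda>x. fp ?q x * gm ?q x) has_field_derivative
      - 1 * (x * (fp ?q x * gm ?q x) + (\<theta>inf + 4 * f0 ?q x) * (fp ?q x * gm ?q x) -
        (- ((\<theta>inf + 2 * f0 ?q x) * (\<theta>0\<^sup>2 / 4 - (f0 ?q x)\<^sup>2))
                - 2 * f0 ?q x * (\<theta>x\<^sup>2 / 4 - (\<theta>inf / 2 + f0 ?q x)\<^sup>2))) / x) (at x)"
    using mem[folded diff_minus_eq_add]
  proof eventually_elim
    case (elim x)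
    show ?case
      using system_solution_products(1)[OF sys conjunct1[OF elim] conjunct2[OF elim]] by simp
  qed
  have 3: "\<forall>\<^sub>F x in strip (\<sigma> - - 1) l \<rho>. fp ?q x * gm ?q x * (gp ?q x * fm ?q x) =
      (\<theta>0\<^sup>2 / 4 - (f0 ?q x)\<^sup>2) * (\<theta>x\<^sup>2 / 4 - (\<theta>inf / 2 + f0 ?q x)\<^sup>2)"
    using mem[folded diff_minus_eq_add]
    by eventually_elim (use system_solution_products(3)[OF sys] in auto)
  note R = strip_product_rate[OF \<rho> _ \<Gamma> 1 2 3]
  show "(\<lambda>x. f0 ?q x - (\<sigma> - \<theta>inf) / 4 - Gamma_eta \<theta>0 \<theta>x \<theta>inf ?q * wave (- 1) (\<sigma> + 1) x)
           \<in> O[?\<Phi>](\<lambda>x. 1 / x)"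
    using R(1) lim_f lim_h by simp
  show "\<forall>\<^sub>F x in ?\<Phi>. fp ?q x * gm ?q x \<noteq> 0"
    using R(2) lim_f lim_h by simp
qed

text \<open>The case s = 1 (poles): \<open>eta\<close> dies out and g_+ f_- takes over as the
  dominant product.\<close>

lemma series_solution_rate_xi:
  assumes sol: "series_solution \<theta>0 \<theta>x \<theta>inf \<delta> P \<epsilon> X f0 fp fm g0 gp gm"
    and p: "(c0, cx, \<sigma>) \<in> P" and \<Gamma>: "Gamma_xi \<theta>0 \<theta>x \<theta>inf (c0, cx, \<sigma>) \<noteq> 0"
    and \<rho>: "0 \<le> \<rho>" and dom: "\<forall>\<^sub>F x in strip (\<sigma> - 1) l \<rho>. x \<in> Sigma_dom \<sigma> \<epsilon> X \<delta>"
  shows "(\<lambda>x. f0 (c0, cx, \<sigma>) x - (\<sigma> - \<theta>inf) / 4 - Gamma_xi \<theta>0 \<theta>x \<theta>inf (c0, cx, \<sigma>) * wave 1 (\<sigma> - 1) x)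
           \<in> O[strip (\<sigma> - 1) l \<rho>](\<lambda>x. 1 / x)"
    and "\<forall>\<^sub>F x in strip (\<sigma> - 1) l \<rho>. gp (c0, cx, \<sigma>) x * fm (c0, cx, \<sigma>) x \<noteq> 0"
proof -
  let ?q = "(c0, cx, \<sigma>)" and ?\<Phi> = "strip (\<sigma> - 1) l \<rho>"
  have inf: "filterlim (\<lambda>x. x) at_infinity ?\<Phi>" by (rule filterlim_strip_at_infinity[OF \<rho>])
  have nz: "\<forall>\<^sub>F x in ?\<Phi>. x \<noteq> 0" using dom by eventually_elim (simp add: Sigma_dom_def sector_def)
  have eta0: "(eta \<sigma> \<longlongrightarrow> 0) ?\<Phi>"
  proof (rule Lim_transform_eventually)
    show "((\<lambda>x. wave (- 1) (\<sigma> + 1) x) \<longlongrightarrow> 0) ?\<Phi>"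
      using wave_other_tendsto_0[OF \<rho>, of 1 \<sigma> l] by simp
    show "\<forall>\<^sub>F x in ?\<Phi>. wave (- 1) (\<sigma> + 1) x = eta \<sigma> x" using nz by eventually_elim (simp add: eta_eq_wave)
  qed
  have lim_f: "((\<lambda>x. f0 ?q x - (\<sigma> - \<theta>inf) / 4 - Gamma_xi \<theta>0 \<theta>x \<theta>inf ?q * wave 1 (\<sigma> - 1) x) \<longlongrightarrow> 0) ?\<Phi>"
  proof (rule Lim_transform_eventually[OF f0_limit_xi[OF sol p inf dom eta0]])
    show "\<forall>\<^sub>F x in ?\<Phi>. f0 ?q x - (\<sigma> - \<theta>inf) / 4 - Gamma_xi \<theta>0 \<theta>x \<theta>inf ?q * xi \<sigma> x =
        f0 ?q x - (\<sigma> - \<theta>inf) / 4 - Gamma_xi \<theta>0 \<theta>x \<theta>inf ?q * wave 1 (\<sigma> - 1) x"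
      using nz by eventually_elim (simp add: xi_eq_wave)
  qed
  have lim_h: "((\<lambda>x. gp ?q x * fm ?q x / x / wave 1 (\<sigma> - 1) x) \<longlongrightarrow> Gamma_xi \<theta>0 \<theta>x \<theta>inf ?q) ?\<Phi>"
    unfolding Gamma_xi_def
  proof (rule Lim_transform_eventually[OF tendsto_mult[OF fm_limit[OF sol p inf dom eta0] gp_limit[OF sol p inf dom eta0]]])
    show "\<forall>\<^sub>F x in ?\<Phi>. x powr (- (\<sigma> + \<theta>inf) / 2) * fm ?q x * (exp (- x) * x powr (- (\<sigma> - \<theta>inf) / 2) * gp ?q x) =
        gp ?q x * fm ?q x / x / wave 1 (\<sigma> - 1) x"
      using nz
    proof eventually_elim
      case (elim x)
      have "x powr (- (\<sigma> + \<theta>inf) / 2) * x powr (- (\<sigma> - \<theta>inf) / 2) = x powr (- \<sigma>)"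
        by (simp add: powr_add[symmetric] add_divide_distrib[symmetric])
      moreover have "exp (- x) * x powr (- \<sigma>) * (x * wave 1 (\<sigma> - 1) x) = 1"
      proof -
        have "exp (- x) * x powr (- \<sigma>) * (exp (Ln x) * wave 1 (\<sigma> - 1) x) = exp ((- x) + (- \<sigma>) * Ln x + (Ln x + (x + (\<sigma> - 1) * Ln x)))"
          using elim unfolding exp_add by (simp add: powr_def wave_def exp_add)
        also have "\<dots> = 1" by (simp add: algebra_simps)
        finally show ?thesis using elim by simp
      qed
      ultimately show ?case
        using elim by (simp add: wave_def field_simps)
    qed
  qed
  have mem: "\<forall>\<^sub>F x in ?\<Phi>. (?q, x) \<in> full_dom \<delta> P \<epsilon> X \<and> x \<noteq> 0"
    using dom nz by eventually_elim (use p in \<open>auto simp: full_dom_def\<close>)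
  have sys: "system_solution \<theta>0 \<theta>x \<theta>inf \<delta> P \<epsilon> X (\<lambda>p x. traceless (f0 p x) (fp p x) (fm p x))
             (\<lambda>p x. traceless (g0 p x) (gp p x) (gm p x))"
    using sol by (simp add: series_solution_def)
  have 1: "\<forall>\<^sub>F x in ?\<Phi>. (f0 ?q has_field_derivative
      1 * (gp ?q x * fm ?q x - fp ?q x * gm ?q x) / x) (at x)"
    using mem by eventually_elim (use system_solution_scalar(1)[OF sys] in auto)
  have 2: "\<forall>\<^sub>F x in ?\<Phi>. ((\<lambda>x. gp ?q x * fm ?q x) has_field_derivative
      1 * (x * (gp ?q x * fm ?q x) + (\<theta>inf + 4 * f0 ?q x) * (gp ?q x * fm ?q x) -
        (- ((\<theta>inf + 2 * f0 ?q x) * (\<theta>0\<^sup>2 / 4 - (f0 ?q x)\<^sup>2))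
                - 2 * f0 ?q x * (\<theta>x\<^sup>2 / 4 - (\<theta>inf / 2 + f0 ?q x)\<^sup>2))) / x) (at x)"
    using mem
  proof eventually_elim
    case (elim x)
    show ?case
      using system_solution_products(2)[OF sys conjunct1[OF elim] conjunct2[OF elim]] by simp
  qed
  have 3: "\<forall>\<^sub>F x in ?\<Phi>. gp ?q x * fm ?q x * (fp ?q x * gm ?q x) =
      (\<theta>0\<^sup>2 / 4 - (f0 ?q x)\<^sup>2) * (\<theta>x\<^sup>2 / 4 - (\<theta>inf / 2 + f0 ?q x)\<^sup>2)"
    using mem
  proof eventually_elim
    case (elim x)
    show ?case
      using system_solution_products(3)[OF sys conjunct1[OF elim] conjunct2[OF elim]]
      by (simp only: mult.commute[of "gp ?q x * fm ?q x"])
  qed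
  note R = strip_product_rate[OF \<rho> _ \<Gamma> 1 2 3 lim_f lim_h]
  show "(\<lambda>x. f0 ?q x - (\<sigma> - \<theta>inf) / 4 - Gamma_xi \<theta>0 \<theta>x \<theta>inf ?q * wave 1 (\<sigma> - 1) x)
           \<in> O[?\<Phi>](\<lambda>x. 1 / x)"
    using R(1) by simp
  show "\<forall>\<^sub>F x in ?\<Phi>. gp ?q x * fm ?q x \<noteq> 0"
    using R(2) by simp
qed

lemma eventually_sequentially_pos:
  "eventually P sequentially \<Longrightarrow> \<exists>m0>0. \<forall>m\<ge>m0. P (m :: nat)"
  unfolding eventually_sequentially by (metis Suc_le_lessD less_imp_le zero_less_Suc le_SucI Suc_leD)

lemma has_zero_sequence_represents:
  assumes rep: "represents \<theta>0 \<theta>x \<theta>inf \<delta> P \<epsilon> X y" and p: "(c0, cx, \<sigma>) \<in> P" and "\<delta> < pi / 2"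
    and \<Gamma>: "Gamma_eta \<theta>0 \<theta>x \<theta>inf (c0, cx, \<sigma>) \<noteq> 0" and \<kappa>: "\<kappa> \<noteq> 0" "cmod \<kappa> < \<epsilon>"
    and \<phi>: "\<phi> = (\<sigma> - \<theta>inf) / 4 + Gamma_eta \<theta>0 \<theta>x \<theta>inf (c0, cx, \<sigma>) * \<kappa>"
      "\<phi> = - \<theta>0 / 2 \<or> \<phi> = - (\<theta>inf + \<theta>x) / 2" "\<phi> \<noteq> (\<theta>x - \<theta>inf) / 2"
  shows "has_zero_sequence (y (cx / c0) \<sigma>) (Sigma_dom \<sigma> \<epsilon> X \<delta>) (\<sigma> + 1) \<kappa>"
proof -
  let ?q = "(c0, cx, \<sigma>)"
  obtain f0 fp fm g0 gp gm where sol: "series_solution \<theta>0 \<theta>x \<theta>inf \<delta> P \<epsilon> X f0 fp fm g0 gp gm"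
    and y: "\<And>x. x \<in> Sigma_dom \<sigma> \<epsilon> X \<delta> \<Longrightarrow> fp ?q x * (g0 ?q x + \<theta>x / 2) \<noteq> 0 \<Longrightarrow>
        y (cx / c0) \<sigma> x = (gp ?q x * (f0 ?q x + \<theta>0 / 2)) / (fp ?q x * (g0 ?q x + \<theta>x / 2))"
    using rep p unfolding represents_def Let_def by fast
  obtain \<rho> \<rho>' where \<rho>: "0 < \<rho>" "\<rho> \<le> 1 / 2" "\<rho> < \<rho>'" "cmod \<kappa> * exp \<rho>' < \<epsilon>"
    using strip_radius[of "cmod \<kappa>" \<epsilon>] \<kappa> by auto
  have \<rho>0: "0 \<le> \<rho>" using \<rho> by simp
  let ?\<Phi> = "strip (\<sigma> + 1) (Ln \<kappa>) \<rho>"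
  have dom: "\<forall>\<^sub>F x in ?\<Phi>. x \<in> Sigma_dom \<sigma> \<epsilon> X \<delta>"
    using eventually_strip_Sigma_dom[OF \<rho>0, of "-1" \<rho>' "Ln \<kappa>" \<epsilon> \<delta> \<sigma> X] \<rho> \<kappa> assms(3) by simp
  note rate = series_solution_rate_eta[OF sol p \<Gamma> \<rho>0 dom]
  have mem: "(?q, x) \<in> full_dom \<delta> P \<epsilon> X \<and> x \<noteq> 0" if "x \<in> Sigma_dom \<sigma> \<epsilon> X \<delta>" for x
    using that p by (auto simp: full_dom_def Sigma_dom_def sector_def)
  have sys: "system_solution \<theta>0 \<theta>x \<theta>inf \<delta> P \<epsilon> X (\<lambda>p x. traceless (f0 p x) (fp p x) (fm p x))
             (\<lambda>p x. traceless (g0 p x) (gp p x) (gm p x))"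
    using sol by (simp add: series_solution_def)
  note sc = system_solution_scalar[OF sys conjunct1[OF mem]]
  note pr = system_solution_products[OF sys conjunct1[OF mem] conjunct2[OF mem]]
  have Df: "\<forall>\<^sub>F x in ?\<Phi>. f0 ?q field_differentiable at x"
    using dom by eventually_elim (use sc(1) field_differentiable_def in blast)
  obtain xs where xs: "log_asymptotics xs (\<sigma> + 1) \<kappa>"
      "\<forall>\<^sub>F m in sequentially. f0 ?q (xs m) = \<phi> \<and> (\<forall>\<^sub>F x in at (xs m). f0 ?q x \<noteq> \<phi>)"
      "\<And>Q. eventually Q ?\<Phi> \<Longrightarrow> \<forall>\<^sub>F m in sequentially. \<forall>\<^sub>F x in nhds (xs m). Q x"
    by (rule strip_value_sequence[OF \<rho>(1,2) _ \<Gamma> Df rate(1), of \<phi>]) (use \<phi>(1) \<kappa> in auto)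
  have "\<forall>\<^sub>F m in sequentially. xs m \<in> Sigma_dom \<sigma> \<epsilon> X \<delta> \<and> isolated_zero (y (cx / c0) \<sigma>) (xs m)"
    using xs(2) xs(3)[OF dom] xs(3)[OF rate(2)]
  proof eventually_elim
    case (elim m)
    let ?z = "xs m"
    have z: "?z \<in> Sigma_dom \<sigma> \<epsilon> X \<delta>" "fp ?q ?z * gm ?q ?z \<noteq> 0"
      using elim by (auto dest: eventually_nhds_x_imp_x)
    have lim_f: "(f0 ?q \<longlongrightarrow> \<phi>) (at ?z)"
      using DERIV_isCont[OF sc(1)[OF z(1)]] elim(1) by (simp add: isCont_def)
    have lim_u: "((\<lambda>x. fp ?q x * gm ?q x) \<longlongrightarrow> fp ?q ?z * gm ?q ?z) (at ?z)"
      using DERIV_isCont[OF pr(1)[OF z(1) z(1)]] by (simp add: isCont_def)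
    let ?N = "\<lambda>x. (f0 ?q x + \<theta>0 / 2) * (f0 ?q x + (\<theta>inf + \<theta>x) / 2)"
    have at: "\<forall>\<^sub>F x in at ?z. x \<in> Sigma_dom \<sigma> \<epsilon> X \<delta>" "\<forall>\<^sub>F x in at ?z. fp ?q x * gm ?q x \<noteq> 0"
      using elim(2,3) by (auto simp: eventually_at_filter elim: eventually_mono)
    have ne: "\<forall>\<^sub>F x in at ?z. f0 ?q x \<noteq> (\<theta>x - \<theta>inf) / 2"
      using lim_f \<phi>(3) by (rule tendsto_imp_eventually_ne)
    \<comment> \<open>Either a is the limit \<phi>, which is attained in isolation, or a is
      different from the limit.\<close>
    have other: "\<forall>\<^sub>F x in at ?z. f0 ?q x \<noteq> a" for a
      using tendsto_imp_eventually_ne[OF lim_f, of a] elim(1) by (cases "a = \<phi>") auto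
    \<comment> \<open>A punctured neighbourhood suffices for \<open>isolated_zero\<close>; y is
      known only where the original denominator does not vanish.\<close>
    have eq: "\<forall>\<^sub>F x in at ?z. ?N x / (fp ?q x * gm ?q x) = y (cx / c0) \<sigma> x"
      using at ne
    proof eventually_elim
      case (elim x)
      have "gp ?q x * gm ?q x = (\<theta>x / 2 - g0 ?q x) * (g0 ?q x + \<theta>x / 2)"
        unfolding sc(7)[OF elim(1)] by (simp add: power2_eq_square algebra_simps)
      moreover have g: "g0 ?q x + \<theta>x / 2 \<noteq> 0" "\<theta>x / 2 - g0 ?q x = f0 ?q x + (\<theta>inf + \<theta>x) / 2"
        using elim(3) unfolding sc(8)[OF elim(1)] by (auto simp: field_simps)
      ultimately have "gp ?q x = (f0 ?q x + (\<theta>inf + \<theta>x) / 2) * (g0 ?q x + \<theta>x / 2) / gm ?q x"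
        using elim(2) by (simp add: field_simps)
      then show ?case
        using y[OF elim(1)] g(1) elim(2) by (simp add: mult.commute)
    qed
    have "((\<lambda>x. ?N x / (fp ?q x * gm ?q x)) \<longlongrightarrow>
        ((\<phi> + \<theta>0 / 2) * (\<phi> + (\<theta>inf + \<theta>x) / 2)) / (fp ?q ?z * gm ?q ?z)) (at ?z)"
      by (intro tendsto_intros lim_f lim_u z)
    moreover have "(\<phi> + \<theta>0 / 2) * (\<phi> + (\<theta>inf + \<theta>x) / 2) = 0"
      using \<phi>(2) by (auto simp: add_divide_distrib diff_divide_distrib)
    ultimately have "(y (cx / c0) \<sigma> \<longlongrightarrow> 0) (at ?z)"
      using Lim_transform_eventually[OF _ eq] by simp
    moreover have "\<forall>\<^sub>F x in at ?z. y (cx / c0) \<sigma> x \<noteq> 0"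
      using eq other[of "- \<theta>0 / 2"] other[of "- (\<theta>inf + \<theta>x) / 2"] at(2)
    proof eventually_elim
      case (elim x)
      have "f0 ?q x + \<theta>0 / 2 \<noteq> 0" "f0 ?q x + (\<theta>inf + \<theta>x) / 2 \<noteq> 0"
        unfolding add_eq_0_iff2 minus_divide_left by (rule elim)+
      then have "?N x / (fp ?q x * gm ?q x) \<noteq> 0" using elim(4) by simp
      then show ?case using elim(1) by simp
    qed
    ultimately show ?case using z(1) by (simp add: isolated_zero_def)
  qed
  from eventually_sequentially_pos[OF this] xs(1) show ?thesis
    unfolding has_zero_sequence_def by blast
qed

text \<open>With s = 1 the wave takes the value exp(- Ln \<kappa>) = 1/\<kappa> at the centres,
  hence the inverse in the smallness condition. The two values of \<phi> are the roots of the
  denominator of y written with numerator g_+ f_-, which is nonzero at the point.\<close>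

lemma has_pole_sequence_represents:
  assumes rep: "represents \<theta>0 \<theta>x \<theta>inf \<delta> P \<epsilon> X y" and p: "(c0, cx, \<sigma>) \<in> P" and "\<delta> < pi / 2"
    and \<Gamma>: "Gamma_xi \<theta>0 \<theta>x \<theta>inf (c0, cx, \<sigma>) \<noteq> 0" and \<kappa>: "\<kappa> \<noteq> 0" "cmod (inverse \<kappa>) < \<epsilon>"
    and \<phi>: "\<phi> = (\<sigma> - \<theta>inf) / 4 + Gamma_xi \<theta>0 \<theta>x \<theta>inf (c0, cx, \<sigma>) * inverse \<kappa>"
      "\<phi> = \<theta>0 / 2 \<or> \<phi> = (\<theta>x - \<theta>inf) / 2" "\<phi> \<noteq> - \<theta>0 / 2"
  shows "has_pole_sequence (y (cx / c0) \<sigma>) (Sigma_dom \<sigma> \<epsilon> X \<delta>) (\<sigma> - 1) \<kappa>"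
proof -
  let ?q = "(c0, cx, \<sigma>)"
  obtain f0 fp fm g0 gp gm where sol: "series_solution \<theta>0 \<theta>x \<theta>inf \<delta> P \<epsilon> X f0 fp fm g0 gp gm"
    and y: "\<And>x. x \<in> Sigma_dom \<sigma> \<epsilon> X \<delta> \<Longrightarrow> fp ?q x * (g0 ?q x + \<theta>x / 2) \<noteq> 0 \<Longrightarrow>
        y (cx / c0) \<sigma> x = (gp ?q x * (f0 ?q x + \<theta>0 / 2)) / (fp ?q x * (g0 ?q x + \<theta>x / 2))"
    using rep p unfolding represents_def Let_def by fast
  obtain \<rho> \<rho>' where \<rho>: "0 < \<rho>" "\<rho> \<le> 1 / 2" "\<rho> < \<rho>'" "cmod (inverse \<kappa>) * exp \<rho>' < \<epsilon>"
    using strip_radius[of "cmod (inverse \<kappa>)" \<epsilon>] \<kappa> by auto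
  have \<rho>0: "0 \<le> \<rho>" using \<rho> by simp
  let ?\<Phi> = "strip (\<sigma> - 1) (Ln \<kappa>) \<rho>"
  have e: "exp (- Ln \<kappa>) = inverse \<kappa>" using \<kappa> by (simp add: exp_minus)
  have dom: "\<forall>\<^sub>F x in ?\<Phi>. x \<in> Sigma_dom \<sigma> \<epsilon> X \<delta>"
    using eventually_strip_Sigma_dom[OF \<rho>0, of 1 \<rho>' "Ln \<kappa>" \<epsilon> \<delta> \<sigma> X] \<rho> assms(3) e by simp
  note rate = series_solution_rate_xi[OF sol p \<Gamma> \<rho>0 dom]
  have mem: "(?q, x) \<in> full_dom \<delta> P \<epsilon> X \<and> x \<noteq> 0" if "x \<in> Sigma_dom \<sigma> \<epsilon> X \<delta>" for x
    using that p by (auto simp: full_dom_def Sigma_dom_def sector_def)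
  have sys: "system_solution \<theta>0 \<theta>x \<theta>inf \<delta> P \<epsilon> X (\<lambda>p x. traceless (f0 p x) (fp p x) (fm p x))
             (\<lambda>p x. traceless (g0 p x) (gp p x) (gm p x))"
    using sol by (simp add: series_solution_def)
  note sc = system_solution_scalar[OF sys conjunct1[OF mem]]
  note pr = system_solution_products[OF sys conjunct1[OF mem] conjunct2[OF mem]]
  have Df: "\<forall>\<^sub>F x in ?\<Phi>. f0 ?q field_differentiable at x"
    using dom by eventually_elim (use sc(1) field_differentiable_def in blast)
  obtain xs where xs: "log_asymptotics xs (\<sigma> - 1) \<kappa>"
      "\<forall>\<^sub>F m in sequentially. f0 ?q (xs m) = \<phi> \<and> (\<forall>\<^sub>F x in at (xs m). f0 ?q x \<noteq> \<phi>)"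
      "\<And>Q. eventually Q ?\<Phi> \<Longrightarrow> \<forall>\<^sub>F m in sequentially. \<forall>\<^sub>F x in nhds (xs m). Q x"
    by (rule strip_value_sequence[OF \<rho>(1,2) _ \<Gamma> Df rate(1), of \<phi>]) (use \<phi>(1) e in auto)
  have "\<forall>\<^sub>F m in sequentially. xs m \<in> Sigma_dom \<sigma> \<epsilon> X \<delta> \<and> is_pole (y (cx / c0) \<sigma>) (xs m)"
    using xs(2) xs(3)[OF dom] xs(3)[OF rate(2)]
  proof eventually_elim
    case (elim m)
    let ?z = "xs m"
    have z: "?z \<in> Sigma_dom \<sigma> \<epsilon> X \<delta>" "gp ?q ?z * fm ?q ?z \<noteq> 0"
      using elim by (auto dest: eventually_nhds_x_imp_x)
    have lim_f: "(f0 ?q \<longlongrightarrow> \<phi>) (at ?z)"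
      using DERIV_isCont[OF sc(1)[OF z(1)]] elim(1) by (simp add: isCont_def)
    have lim_v: "((\<lambda>x. gp ?q x * fm ?q x) \<longlongrightarrow> gp ?q ?z * fm ?q ?z) (at ?z)"
      using DERIV_isCont[OF pr(2)[OF z(1) z(1)]] by (simp add: isCont_def)
    let ?D = "\<lambda>x. (\<theta>0 / 2 - f0 ?q x) * ((\<theta>x - \<theta>inf) / 2 - f0 ?q x)"
    have at: "\<forall>\<^sub>F x in at ?z. x \<in> Sigma_dom \<sigma> \<epsilon> X \<delta>" "\<forall>\<^sub>F x in at ?z. gp ?q x * fm ?q x \<noteq> 0"
      using elim(2,3) by (auto simp: eventually_at_filter elim: eventually_mono)
    have other: "\<forall>\<^sub>F x in at ?z. f0 ?q x \<noteq> a" for a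
      using tendsto_imp_eventually_ne[OF lim_f, of a] elim(1) by (cases "a = \<phi>") auto
    have eq: "\<forall>\<^sub>F x in at ?z. y (cx / c0) \<sigma> x = gp ?q x * fm ?q x / ?D x"
      using at other[of "\<theta>0 / 2"] other[of "(\<theta>x - \<theta>inf) / 2"] other[of "- \<theta>0 / 2"]
    proof eventually_elim
      case (elim x)
      have ff: "fp ?q x * fm ?q x = (\<theta>0 / 2 - f0 ?q x) * (f0 ?q x + \<theta>0 / 2)"
        unfolding sc(6)[OF elim(1)] by (simp add: power2_eq_square algebra_simps)
      have n: "\<theta>0 / 2 - f0 ?q x \<noteq> 0" "f0 ?q x + \<theta>0 / 2 \<noteq> 0"
        using elim(3,5) unfolding add_eq_0_iff2 minus_divide_left by auto
      then have fp: "fp ?q x \<noteq> 0" using ff by auto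
      have g: "g0 ?q x + \<theta>x / 2 = (\<theta>x - \<theta>inf) / 2 - f0 ?q x"
        unfolding sc(8)[OF elim(1)] by (simp add: field_simps)
      have g0: "(\<theta>x - \<theta>inf) / 2 - f0 ?q x \<noteq> 0" using elim(4) by auto
      \<comment> \<open>Substituting this factor brings f_- into the numerator and cancels f_+
        against the denominator of y.\<close>
      have "f0 ?q x + \<theta>0 / 2 = fp ?q x * fm ?q x / (\<theta>0 / 2 - f0 ?q x)"
        unfolding ff using n by simp
      then show ?case
        using y[OF elim(1)] fp g0 unfolding g by simp
    qed
    have "filterlim (\<lambda>x. gp ?q x * fm ?q x / ?D x) at_infinity (at ?z)"
    proof (rule filterlim_divide_at_infinity[OF lim_v _ z(2)])
      have "(?D \<longlongrightarrow> (\<theta>0 / 2 - \<phi>) * ((\<theta>x - \<theta>inf) / 2 - \<phi>)) (at ?z)"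
        by (intro tendsto_intros lim_f)
      moreover have "(\<theta>0 / 2 - \<phi>) * ((\<theta>x - \<theta>inf) / 2 - \<phi>) = 0" using \<phi>(2) by auto
      moreover have "\<forall>\<^sub>F x in at ?z. ?D x \<noteq> 0"
        using other[of "\<theta>0 / 2"] other[of "(\<theta>x - \<theta>inf) / 2"] by eventually_elim auto
      ultimately show "filterlim ?D (at 0) (at ?z)" by (simp add: filterlim_at)
    qed
    then have "is_pole (y (cx / c0) \<sigma>) ?z"
      unfolding is_pole_def using filterlim_cong[OF refl refl eq] by simp
    then show ?case using z(1) by simp
  qed
  from eventually_sequentially_pos[OF this] xs(1) show ?thesis
    unfolding has_pole_sequence_def by blast
qed

section \<open>An admissible \<epsilon> that is uniform in (c, \<sigma>)\<close>

definition eps_weight :: "complex \<Rightarrow> complex \<Rightarrow> complex \<Rightarrow> param \<Rightarrow> real" where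
  "eps_weight \<theta>0 \<theta>x \<theta>inf p =
     (cmod (Gamma_xi \<theta>0 \<theta>x \<theta>inf p) + cmod (Gamma_eta \<theta>0 \<theta>x \<theta>inf p)
       + cmod (gamma0p \<theta>0 \<theta>inf p) + cmod (gamma0m \<theta>0 \<theta>inf p)
       + cmod (gammaxp \<theta>x \<theta>inf p) + cmod (gammaxm \<theta>x \<theta>inf p) + 1)
     * (cmod (gamma0p \<theta>0 \<theta>inf p) + cmod (gamma0m \<theta>0 \<theta>inf p)
       + cmod (gammaxp \<theta>x \<theta>inf p) + cmod (gammaxm \<theta>x \<theta>inf p) + 1)"

lemma eps_weight_le:
  assumes "cmod (gamma0p \<theta>0 \<theta>inf p) \<le> M" "cmod (gamma0m \<theta>0 \<theta>inf p) \<le> M"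
    "cmod (gammaxp \<theta>x \<theta>inf p) \<le> M" "cmod (gammaxm \<theta>x \<theta>inf p) \<le> M"
  shows "eps_weight \<theta>0 \<theta>x \<theta>inf p \<le> (2 * M\<^sup>2 + 4 * M + 1) * (4 * M + 1)"
proof -
  have M: "0 \<le> M" using assms(1) norm_ge_zero order_trans by blast
  have "cmod (Gamma_xi \<theta>0 \<theta>x \<theta>inf p) \<le> M\<^sup>2" "cmod (Gamma_eta \<theta>0 \<theta>x \<theta>inf p) \<le> M\<^sup>2"
    unfolding Gamma_xi_def Gamma_eta_def norm_mult power2_eq_square
    using assms M by (auto intro!: mult_mono)
  then show ?thesis
    unfolding eps_weight_def using assms M by (intro mult_mono) auto
qed

lemma isCont_eps_weight:
  assumes "c0 \<noteq> 0" "cx \<noteq> 0"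
  shows "isCont (eps_weight \<theta>0 \<theta>x \<theta>inf) (c0, cx, \<sigma>)"
proof -
  have "gamma0p \<theta>0 \<theta>inf = (\<lambda>p. fst p / 4 * (snd (snd p) + 2 * \<theta>0 - \<theta>inf))"
    "gamma0m \<theta>0 \<theta>inf = (\<lambda>p. inverse (fst p) / 4 * (- snd (snd p) + 2 * \<theta>0 + \<theta>inf))"
    "gammaxp \<theta>x \<theta>inf = (\<lambda>p. fst (snd p) / 4 * (- snd (snd p) + 2 * \<theta>x - \<theta>inf))"
    "gammaxm \<theta>x \<theta>inf = (\<lambda>p. inverse (fst (snd p)) / 4 * (snd (snd p) + 2 * \<theta>x + \<theta>inf))"
    by (auto simp: gamma0p_def gamma0m_def gammaxp_def gammaxm_def fun_eq_iff)
  note c = this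
  have d: "isCont (gamma0p \<theta>0 \<theta>inf) (c0, cx, \<sigma>)" "isCont (gamma0m \<theta>0 \<theta>inf) (c0, cx, \<sigma>)"
    "isCont (gammaxp \<theta>x \<theta>inf) (c0, cx, \<sigma>)" "isCont (gammaxm \<theta>x \<theta>inf) (c0, cx, \<sigma>)"
    unfolding c using assms by (intro continuous_intros; simp)+
  show ?thesis
    unfolding eps_weight_def[abs_def] Gamma_xi_def Gamma_eta_def
    by (intro continuous_intros d)
qed

text \<open>The weight is continuous, so a strict bound at one parameter persists on a small box,
  and \<open>r0 / K\<close> is admissible there. The box, and hence X, may depend on the parameter;
  \<epsilon> depends on K only, which is what a common \<epsilon>_0 requires.\<close>

lemma param_domain_exists:
  assumes c: "c0 \<noteq> 0" "cx \<noteq> 0" and K: "eps_weight \<theta>0 \<theta>x \<theta>inf (c0, cx, \<sigma>) < K" and "0 < r0"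
  obtains B0 Bx Bs where "param_domain B0 Bx Bs" "(c0, cx, \<sigma>) \<in> B0 \<times> Bx \<times> Bs"
    "admissible_eps \<theta>0 \<theta>x \<theta>inf r0 (B0 \<times> Bx \<times> Bs) (r0 / K)"
proof -
  have "0 \<le> eps_weight \<theta>0 \<theta>x \<theta>inf (c0, cx, \<sigma>)"
    unfolding eps_weight_def by (intro mult_nonneg_nonneg add_nonneg_nonneg) auto
  then have K0: "K > 0" using K by linarith
  have "(eps_weight \<theta>0 \<theta>x \<theta>inf \<longlongrightarrow> eps_weight \<theta>0 \<theta>x \<theta>inf (c0, cx, \<sigma>)) (nhds (c0, cx, \<sigma>))"
    using isCont_eps_weight[OF c] unfolding isCont_def by (simp only: tendsto_at_iff_tendsto_nhds)
  from order_tendstoD(2)[OF this K]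
  obtain S where S: "open S" "(c0, cx, \<sigma>) \<in> S" "\<And>p. p \<in> S \<Longrightarrow> eps_weight \<theta>0 \<theta>x \<theta>inf p < K"
    unfolding eventually_nhds by blast
  obtain A A' where A: "open A" "open A'" "(c0, cx, \<sigma>) \<in> A \<times> A'" "A \<times> A' \<subseteq> S"
    using open_prod_elim[OF S(1,2)] by blast
  have "(cx, \<sigma>) \<in> A'" using A(3) by auto
  then obtain D E where D: "open D" "open E" "(cx, \<sigma>) \<in> D \<times> E" "D \<times> E \<subseteq> A'"
    using open_prod_elim[OF A(2)] by blast
  obtain e1 where e1: "e1 > 0" "ball c0 e1 \<subseteq> A" using A openE by blast
  obtain e2 where e2: "e2 > 0" "ball cx e2 \<subseteq> D" using D openE by blast
  obtain e3 where e3: "e3 > 0" "ball \<sigma> e3 \<subseteq> E" using D openE by blast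
  \<comment> \<open>Half the modulus keeps even the closed disc away from 0, as a parameter domain
    demands.\<close>
  define d1 where "d1 = min e1 (cmod c0 / 2)"
  define d2 where "d2 = min e2 (cmod cx / 2)"
  have pos: "d1 > 0" "d2 > 0" using e1 e2 c by (auto simp: d1_def d2_def)
  have sub: "ball c0 d1 \<times> ball cx d2 \<times> ball \<sigma> e3 \<subseteq> S"
    using e1(2) e2(2) e3(2) A(4) D(4) unfolding d1_def d2_def by fastforce
  have cl: "0 \<notin> closure (ball c0 d1)" "0 \<notin> closure (ball cx d2)"
    using c pos by (auto simp: d1_def d2_def)
  show thesis
  proof (rule that)
    show "param_domain (ball c0 d1) (ball cx d2) (ball \<sigma> e3)"
      unfolding param_domain_def using cl pos e3(1) by auto
    show "(c0, cx, \<sigma>) \<in> ball c0 d1 \<times> ball cx d2 \<times> ball \<sigma> e3" using pos e3(1) by auto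
    show "admissible_eps \<theta>0 \<theta>x \<theta>inf r0 (ball c0 d1 \<times> ball cx d2 \<times> ball \<sigma> e3) (r0 / K)"
      unfolding admissible_eps_def eps_weight_def[symmetric]
    proof (intro conjI ballI)
      show "0 < r0 / K" using assms(4) K0 by simp
      fix p assume "p \<in> ball c0 d1 \<times> ball cx d2 \<times> ball \<sigma> e3"
      then have "eps_weight \<theta>0 \<theta>x \<theta>inf p \<le> K" using S(3) sub by (meson less_imp_le subsetD)
      then have "eps_weight \<theta>0 \<theta>x \<theta>inf p * (r0 / K) \<le> K * (r0 / K)"
        using assms(4) K0 by (intro mult_right_mono) auto
      then show "eps_weight \<theta>0 \<theta>x \<theta>inf p * (r0 / K) \<le> r0" using K0 by simp
    qed
  qed
qed

lemma painleve5_family_represents: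
  assumes "painleve5_family \<theta>0 \<theta>x \<theta>inf \<delta> r0 y" "0 < r0" "c0 \<noteq> 0" "cx \<noteq> 0"
    and "eps_weight \<theta>0 \<theta>x \<theta>inf (c0, cx, \<sigma>) < K"
  obtains P X where "(c0, cx, \<sigma>) \<in> P" "represents \<theta>0 \<theta>x \<theta>inf \<delta> P (r0 / K) X y"
    "Sigma_dom \<sigma> (r0 / K) X \<delta> \<subseteq> y_domain \<theta>0 \<theta>x \<theta>inf \<delta> r0 y (cx / c0) \<sigma>"
proof -
  obtain B0 Bx Bs where B: "param_domain B0 Bx Bs" "(c0, cx, \<sigma>) \<in> B0 \<times> Bx \<times> Bs"
    "admissible_eps \<theta>0 \<theta>x \<theta>inf r0 (B0 \<times> Bx \<times> Bs) (r0 / K)"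
    by (rule param_domain_exists[OF assms(3-5,2)])
  then obtain X where X: "X > 1 / (r0 / K)" "represents \<theta>0 \<theta>x \<theta>inf \<delta> (B0 \<times> Bx \<times> Bs) (r0 / K) X y"
    using assms(1) unfolding painleve5_family_def by blast
  have "Sigma_dom \<sigma> (r0 / K) X \<delta> \<subseteq> y_domain \<theta>0 \<theta>x \<theta>inf \<delta> r0 y (cx / c0) \<sigma>"
  proof
    fix x assume "x \<in> Sigma_dom \<sigma> (r0 / K) X \<delta>"
    then show "x \<in> y_domain \<theta>0 \<theta>x \<theta>inf \<delta> r0 y (cx / c0) \<sigma>"
      unfolding y_domain_def using B X
      by (intro CollectI exI[of _ B0] exI[of _ Bx] exI[of _ Bs] exI[of _ "r0 / K"] exI[of _ X]
          exI[of _ c0] exI[of _ cx] conjI refl)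
  qed
  then show thesis by (rule that[OF B(2) X(2)])
qed

lemma has_zero_sequence_family:
  assumes "painleve5_family \<theta>0 \<theta>x \<theta>inf \<delta> r0 y" "0 < r0" "\<delta> < pi / 2" "c0 \<noteq> 0" "cx \<noteq> 0"
    and "eps_weight \<theta>0 \<theta>x \<theta>inf (c0, cx, \<sigma>) < K"
    and "Gamma_eta \<theta>0 \<theta>x \<theta>inf (c0, cx, \<sigma>) \<noteq> 0" "\<kappa> \<noteq> 0" "cmod \<kappa> < r0 / K"
    and "\<phi> = (\<sigma> - \<theta>inf) / 4 + Gamma_eta \<theta>0 \<theta>x \<theta>inf (c0, cx, \<sigma>) * \<kappa>"
      "\<phi> = - \<theta>0 / 2 \<or> \<phi> = - (\<theta>inf + \<theta>x) / 2" "\<phi> \<noteq> (\<theta>x - \<theta>inf) / 2"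
  shows "has_zero_sequence (y (cx / c0) \<sigma>) (y_domain \<theta>0 \<theta>x \<theta>inf \<delta> r0 y (cx / c0) \<sigma>) (\<sigma> + 1) \<kappa>"
proof -
  obtain P X where P: "(c0, cx, \<sigma>) \<in> P" "represents \<theta>0 \<theta>x \<theta>inf \<delta> P (r0 / K) X y"
    "Sigma_dom \<sigma> (r0 / K) X \<delta> \<subseteq> y_domain \<theta>0 \<theta>x \<theta>inf \<delta> r0 y (cx / c0) \<sigma>"
    by (rule painleve5_family_represents[OF assms(1,2,4,5,6)])
  show ?thesis
    using has_zero_sequence_represents[OF P(2,1) assms(3,7-12)] P(3)
    unfolding has_zero_sequence_def by blast
qed

lemma has_pole_sequence_family:
  assumes "painleve5_family \<theta>0 \<theta>x \<theta>inf \<delta> r0 y" "0 < r0" "\<delta> < pi / 2" "c0 \<noteq> 0" "cx \<noteq> 0"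
    and "eps_weight \<theta>0 \<theta>x \<theta>inf (c0, cx, \<sigma>) < K"
    and "Gamma_xi \<theta>0 \<theta>x \<theta>inf (c0, cx, \<sigma>) \<noteq> 0" "\<kappa> \<noteq> 0" "cmod (inverse \<kappa>) < r0 / K"
    and "\<phi> = (\<sigma> - \<theta>inf) / 4 + Gamma_xi \<theta>0 \<theta>x \<theta>inf (c0, cx, \<sigma>) * inverse \<kappa>"
      "\<phi> = \<theta>0 / 2 \<or> \<phi> = (\<theta>x - \<theta>inf) / 2" "\<phi> \<noteq> - \<theta>0 / 2"
  shows "has_pole_sequence (y (cx / c0) \<sigma>) (y_domain \<theta>0 \<theta>x \<theta>inf \<delta> r0 y (cx / c0) \<sigma>) (\<sigma> - 1) \<kappa>"
proof -
  obtain P X where P: "(c0, cx, \<sigma>) \<in> P" "represents \<theta>0 \<theta>x \<theta>inf \<delta> P (r0 / K) X y"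
    "Sigma_dom \<sigma> (r0 / K) X \<delta> \<subseteq> y_domain \<theta>0 \<theta>x \<theta>inf \<delta> r0 y (cx / c0) \<sigma>"
    by (rule painleve5_family_represents[OF assms(1,2,4,5,6)])
  show ?thesis
    using has_pole_sequence_represents[OF P(2,1) assms(3,7-12)] P(3)
    unfolding has_pole_sequence_def by blast
qed

lemma norm_linear_form_le:
  fixes a b c :: complex
  assumes "cmod a \<le> A" "cmod b \<le> B" "cmod c \<le> C"
  shows "cmod (a + 2 * b + c) \<le> A + 2 * B + C"
proof -
  have "cmod (a + 2 * b + c) \<le> cmod (a + 2 * b) + cmod c" by (rule norm_triangle_ineq)
  also have "cmod (a + 2 * b) \<le> cmod a + cmod (2 * b)" by (rule norm_triangle_ineq)
  finally show ?thesis using assms by (simp add: norm_mult)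
qed

text \<open>Each \<gamma> is a power of c0 or cx times a linear factor in \<sigma>. Either the power
  is bounded, and the bound on \<sigma> controls the factor, or the product is bounded directly. The
  second alternative serves the one \<gamma> whose power of c is unbounded but whose factor is small
  by hypothesis.\<close>

lemma eps_weight_bound:
  fixes \<theta>0 \<theta>x \<theta>inf \<sigma> c0 cx :: complex and R S :: real
  defines "M \<equiv> (1 + R) * (S + 2 * cmod \<theta>0 + 2 * cmod \<theta>x + cmod \<theta>inf) + R"
  assumes R: "0 \<le> R" and \<sigma>: "cmod \<sigma> \<le> S"
    and "cmod c0 \<le> 1 + R \<or> cmod (c0 * (\<sigma> + 2 * \<theta>0 - \<theta>inf)) \<le> R"
    and "cmod (inverse c0) \<le> 1 + R \<or> cmod (inverse c0 * (- \<sigma> + 2 * \<theta>0 + \<theta>inf)) \<le> R"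
    and "cmod cx \<le> 1 + R \<or> cmod (cx * (- \<sigma> + 2 * \<theta>x - \<theta>inf)) \<le> R"
    and "cmod (inverse cx) \<le> 1 + R \<or> cmod (inverse cx * (\<sigma> + 2 * \<theta>x + \<theta>inf)) \<le> R"
  shows "eps_weight \<theta>0 \<theta>x \<theta>inf (c0, cx, \<sigma>) \<le> (2 * M\<^sup>2 + 4 * M + 1) * (4 * M + 1)"
proof -
  define T where "T = S + 2 * cmod \<theta>0 + 2 * cmod \<theta>x + cmod \<theta>inf"
  have "0 \<le> S" using \<sigma> norm_ge_zero order_trans by blast
  then have T: "0 \<le> T" by (simp add: T_def)
  have *: "cmod (z / 4 * v) \<le> M" if "cmod z \<le> 1 + R \<or> cmod (z * v) \<le> R" "cmod v \<le> T" for z v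
  proof -
    have "cmod (z * v) \<le> M"
      using that(1)
    proof
      assume "cmod z \<le> 1 + R"
      then have "cmod z * cmod v \<le> (1 + R) * T" using that(2) R by (intro mult_mono) auto
      then show ?thesis using R by (simp add: M_def T_def norm_mult)
    next
      assume "cmod (z * v) \<le> R"
      moreover have "0 \<le> (1 + R) * T" using R T by simp
      ultimately show ?thesis by (simp add: M_def T_def)
    qed
    moreover from this have "0 \<le> M" using norm_ge_zero order_trans by blast
    ultimately show ?thesis by (simp add: norm_mult norm_divide)
  qed
  have t: "cmod (\<sigma> + 2 * \<theta>0 - \<theta>inf) \<le> T" "cmod (- \<sigma> + 2 * \<theta>0 + \<theta>inf) \<le> T"
    "cmod (- \<sigma> + 2 * \<theta>x - \<theta>inf) \<le> T" "cmod (\<sigma> + 2 * \<theta>x + \<theta>inf) \<le> T"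
    using norm_linear_form_le[of \<sigma> S \<theta>0 "cmod \<theta>0" "- \<theta>inf" "cmod \<theta>inf"]
      norm_linear_form_le[of "- \<sigma>" S \<theta>0 "cmod \<theta>0" \<theta>inf "cmod \<theta>inf"]
      norm_linear_form_le[of "- \<sigma>" S \<theta>x "cmod \<theta>x" "- \<theta>inf" "cmod \<theta>inf"]
      norm_linear_form_le[of \<sigma> S \<theta>x "cmod \<theta>x" \<theta>inf "cmod \<theta>inf"] \<sigma> norm_ge_zero[of \<theta>0] norm_ge_zero[of \<theta>x]
    unfolding T_def by (simp_all del: norm_ge_zero)
  show ?thesis
    using *[OF assms(4) t(1)] *[OF assms(5) t(2)] *[OF assms(6) t(3)] *[OF assms(7) t(4)]
    by (intro eps_weight_le) (simp_all only: gamma0p_def gamma0m_def gammaxp_def gammaxm_def case_prod_conv)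
qed

section \<open>The two sequences of zeros and the two sequences of poles\<close>

theorem theorem2p26:
  fixes \<theta>0 \<theta>x \<theta>inf :: complex and \<delta> r0 R0 :: real
    and y :: "complex \<Rightarrow> complex \<Rightarrow> complex \<Rightarrow> complex"
  assumes "0 < \<delta>" "\<delta> < pi / 2"
    and "0 < r0" "r0 < 1"
    and "painleve5_family \<theta>0 \<theta>x \<theta>inf \<delta> r0 y"
    and "0 < R0"
  shows
    "(\<theta>x * (\<theta>0 + \<theta>x - \<theta>inf) \<noteq> 0 \<and> \<theta>x * (\<theta>0 - \<theta>x - \<theta>inf) \<noteq> 0 \<longrightarrow>
       (\<exists>\<epsilon>0>0. \<forall>c \<sigma>.
          0 < cmod c \<and> cmod c < R0 \<and>
          \<sigma> \<notin> {2 * \<theta>0 + \<theta>inf, - 2 * \<theta>0 + \<theta>inf, 2 * \<theta>x - \<theta>inf, - 2 * \<theta>x - \<theta>inf} \<longrightarrow>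
          (cmod (\<sigma> + 2 * \<theta>x + \<theta>inf) < R0 * cmod c \<and>
             cmod (4 * c / (\<sigma> + 2 * \<theta>0 - \<theta>inf)) < \<epsilon>0 \<longrightarrow>
           has_zero_sequence (y c \<sigma>) (y_domain \<theta>0 \<theta>x \<theta>inf \<delta> r0 y c \<sigma>)
             (\<sigma> + 1) (- 4 / (\<sigma> + 2 * \<theta>0 - \<theta>inf) * c)) \<and>
          (cmod (\<sigma> + 2 * \<theta>0 - \<theta>inf) < R0 * cmod c \<and>
             cmod (4 * c / (\<sigma> + 2 * \<theta>x + \<theta>inf)) < \<epsilon>0 \<longrightarrow>
           has_zero_sequence (y c \<sigma>) (y_domain \<theta>0 \<theta>x \<theta>inf \<delta> r0 y c \<sigma>)
             (\<sigma> + 1) (- 4 / (\<sigma> + 2 * \<theta>x + \<theta>inf) * c)))) \<and>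
     (\<theta>0 * (\<theta>0 - \<theta>x + \<theta>inf) \<noteq> 0 \<and> \<theta>0 * (- \<theta>0 - \<theta>x + \<theta>inf) \<noteq> 0 \<longrightarrow>
       (\<exists>\<epsilon>0'>0. \<forall>c \<sigma>.
          cmod c > 1 / R0 \<and>
          \<sigma> \<notin> {2 * \<theta>0 + \<theta>inf, - 2 * \<theta>0 + \<theta>inf, 2 * \<theta>x - \<theta>inf, - 2 * \<theta>x - \<theta>inf} \<longrightarrow>
          (cmod (c * (\<sigma> - 2 * \<theta>0 - \<theta>inf)) < R0 \<and>
             cmod (4 * inverse c / (\<sigma> - 2 * \<theta>x + \<theta>inf)) < \<epsilon>0' \<longrightarrow>
           has_pole_sequence (y c \<sigma>) (y_domain \<theta>0 \<theta>x \<theta>inf \<delta> r0 y c \<sigma>)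
             (\<sigma> - 1) (- (\<sigma> - 2 * \<theta>x + \<theta>inf) / 4 * c)) \<and>
          (cmod (c * (\<sigma> - 2 * \<theta>x + \<theta>inf)) < R0 \<and>
             cmod (4 * inverse c / (\<sigma> - 2 * \<theta>0 - \<theta>inf)) < \<epsilon>0' \<longrightarrow>
           has_pole_sequence (y c \<sigma>) (y_domain \<theta>0 \<theta>x \<theta>inf \<delta> r0 y c \<sigma>)
             (\<sigma> - 1) (- (\<sigma> - 2 * \<theta>0 - \<theta>inf) / 4 * c))))"
proof -
  \<comment> \<open>A bound for |\<sigma>|: in each of the four cases one linear factor in \<sigma>
    is at most R0 * R0, by its condition with R0 together with |c| < R0 (zeros) or 1/|c| < R0
    (poles).\<close>
  define S where "S = R0 * R0 + 2 * cmod \<theta>0 + 2 * cmod \<theta>x + cmod \<theta>inf"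
  define M where "M = (1 + R0) * (S + 2 * cmod \<theta>0 + 2 * cmod \<theta>x + cmod \<theta>inf) + R0"
  \<comment> \<open>The bound of \<open>eps_weight_bound\<close> for R = R0, plus 1 to make it
    strict. It involves R0 and the \<theta>s only, so \<open>r0 / K\<close> can serve as
    \<epsilon>_0 in both halves.\<close>
  define K where "K = (2 * M\<^sup>2 + 4 * M + 1) * (4 * M + 1) + 1"
  have "0 \<le> M" using \<open>0 < R0\<close> by (simp add: M_def S_def)
  then have "0 < K" unfolding K_def by (intro add_nonneg_pos mult_nonneg_nonneg) auto
  then have \<epsilon>: "0 < r0 / K" using \<open>0 < r0\<close> by simp
  have R0: "0 \<le> R0" using \<open>0 < R0\<close> by simp
  have weight: "eps_weight \<theta>0 \<theta>x \<theta>inf (c0, cx, \<sigma>) < K"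
    if "cmod \<sigma> \<le> S" "cmod c0 \<le> 1 + R0 \<or> cmod (c0 * (\<sigma> + 2 * \<theta>0 - \<theta>inf)) \<le> R0"
      "cmod (inverse c0) \<le> 1 + R0 \<or> cmod (inverse c0 * (- \<sigma> + 2 * \<theta>0 + \<theta>inf)) \<le> R0"
      "cmod cx \<le> 1 + R0 \<or> cmod (cx * (- \<sigma> + 2 * \<theta>x - \<theta>inf)) \<le> R0"
      "cmod (inverse cx) \<le> 1 + R0 \<or> cmod (inverse cx * (\<sigma> + 2 * \<theta>x + \<theta>inf)) \<le> R0"
    for c0 cx \<sigma>
    using eps_weight_bound[OF R0 that] by (simp add: K_def M_def)
  have bound: "cmod \<sigma> \<le> S" if "cmod X \<le> R0 * R0" "\<sigma> = X + 2 * t + u" "cmod t \<le> cmod \<theta>0 + cmod \<theta>x" "cmod u \<le> cmod \<theta>inf"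
    for \<sigma> X t u
    using norm_linear_form_le[OF that(1,3,4)] that(2) by (simp add: S_def)
  \<comment> \<open>\<Gamma> times the wave value: the factor in the denominator of that value
    cancels and a quarter of the other factor survives. Adding
    \<open>(\<sigma> - \<theta>inf) / 4\<close> then eliminates \<sigma>, leaving one of the
    prescribed values of f0.\<close>
  have alg: "a * b / (16 * c) * (- 4 / a * c) = - b / 4" "b * a / (16 * c) * (- 4 / a * c) = - b / 4"
    "a * b * c / 16 * inverse (- a / 4 * c) = - b / 4" "b * a * c / 16 * inverse (- a / 4 * c) = - b / 4"
    if "a \<noteq> 0" "c \<noteq> 0" for a b c :: complex
    using that by (simp_all add: field_simps)
  have inv: "inverse (- a / 4 * c) = - (4 * inverse c / a)" for a c :: complex
    by (simp add: inverse_eq_divide mult.commute)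
  \<comment> \<open>The conditions on the \<theta>s enter here: d is the doubled difference between
    the attained value of f0 and the value it has to avoid.\<close>
  have half: "u \<noteq> v" if "d \<noteq> 0" "d = 2 * v - 2 * u" for u v d :: complex
    using that by auto
  have zero_x: "has_zero_sequence (y c \<sigma>) (y_domain \<theta>0 \<theta>x \<theta>inf \<delta> r0 y c \<sigma>)
             (\<sigma> + 1) (- 4 / (\<sigma> + 2 * \<theta>0 - \<theta>inf) * c)"
    if nz: "\<theta>x \<noteq> 0" and "0 < cmod c" "cmod c < R0"
      and \<sigma>: "\<sigma> \<notin> {2 * \<theta>0 + \<theta>inf, - 2 * \<theta>0 + \<theta>inf, 2 * \<theta>x - \<theta>inf, - 2 * \<theta>x - \<theta>inf}"
      and small: "cmod (\<sigma> + 2 * \<theta>x + \<theta>inf) < R0 * cmod c"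
      and \<kappa>: "cmod (4 * c / (\<sigma> + 2 * \<theta>0 - \<theta>inf)) < r0 / K" for c \<sigma>
  proof -
    let ?A = "\<sigma> + 2 * \<theta>0 - \<theta>inf" and ?B = "\<sigma> + 2 * \<theta>x + \<theta>inf"
    have c: "c \<noteq> 0" using that by auto
    then have c': "inverse c \<noteq> 0" by simp
    have "?A = \<sigma> - (- 2 * \<theta>0 + \<theta>inf)" "?B = \<sigma> - (- 2 * \<theta>x - \<theta>inf)" by simp_all
    then have AB: "?A \<noteq> 0" "?B \<noteq> 0" using \<sigma> by (metis insertCI right_minus_eq)+
    have "R0 * cmod c \<le> R0 * R0" using that(3) R0 by (intro mult_left_mono) auto
    then have "cmod ?B \<le> R0 * R0" using small by linarith
    then have "cmod \<sigma> \<le> S"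
      by (rule bound[of _ _ "- \<theta>x" "- \<theta>inf"]) auto
    moreover have "cmod (inverse c * ?B) \<le> R0"
    proof -
      have "cmod (inverse c * ?B) = cmod ?B / cmod c"
        by (simp only: norm_mult norm_inverse divide_inverse mult.commute)
      then show ?thesis using small c by (simp add: pos_divide_le_eq)
    qed
    \<comment> \<open>Normalising c0 = 1, cx = c leaves 1/c as the only unbounded power. It occurs
      in \<open>gammaxm\<close> alone, next to the factor ?B that the hypothesis makes smaller than
      R0 |c|.\<close>
    ultimately have w: "eps_weight \<theta>0 \<theta>x \<theta>inf (1, c, \<sigma>) < K"
      using that(3) R0 by (intro weight) auto
    have G: "Gamma_eta \<theta>0 \<theta>x \<theta>inf (1, c, \<sigma>) = ?A * ?B / (16 * c)"
      using c by (simp add: Gamma_eta_def gamma0p_def gammaxm_def divide_simps)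
    have e: "Gamma_eta \<theta>0 \<theta>x \<theta>inf (1, c, \<sigma>) * (- 4 / ?A * c) = - ?B / 4"
      unfolding G by (rule alg(1)[OF AB(1) c])
    have \<phi>: "- (\<theta>inf + \<theta>x) / 2 = (\<sigma> - \<theta>inf) / 4 + Gamma_eta \<theta>0 \<theta>x \<theta>inf (1, c, \<sigma>) * (- 4 / ?A * c)"
      unfolding e by (simp add: field_simps)
    have ne: "- (\<theta>inf + \<theta>x) / 2 \<noteq> (\<theta>x - \<theta>inf) / 2"
      by (rule half[of "2 * \<theta>x"]) (use nz in \<open>simp_all add: field_simps\<close>)
    have "has_zero_sequence (y (c / 1) \<sigma>) (y_domain \<theta>0 \<theta>x \<theta>inf \<delta> r0 y (c / 1) \<sigma>)
             (\<sigma> + 1) (- 4 / ?A * c)"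
    proof (rule has_zero_sequence_family[OF assms(5,3,2) one_neq_zero c w _ _ _ \<phi> _ ne])
      show "Gamma_eta \<theta>0 \<theta>x \<theta>inf (1, c, \<sigma>) \<noteq> 0" unfolding G using c AB by simp
      show "- 4 / ?A * c \<noteq> 0" using c AB by simp
      show "cmod (- 4 / ?A * c) < r0 / K" using \<kappa> by (simp add: norm_mult norm_divide)
    qed simp
    then show ?thesis by (simp add: inverse_eq_divide)
  qed
  have zero_0: "has_zero_sequence (y c \<sigma>) (y_domain \<theta>0 \<theta>x \<theta>inf \<delta> r0 y c \<sigma>)
             (\<sigma> + 1) (- 4 / (\<sigma> + 2 * \<theta>x + \<theta>inf) * c)"
    if nz: "\<theta>0 + \<theta>x - \<theta>inf \<noteq> 0" and "0 < cmod c" "cmod c < R0"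
      and \<sigma>: "\<sigma> \<notin> {2 * \<theta>0 + \<theta>inf, - 2 * \<theta>0 + \<theta>inf, 2 * \<theta>x - \<theta>inf, - 2 * \<theta>x - \<theta>inf}"
      and small: "cmod (\<sigma> + 2 * \<theta>0 - \<theta>inf) < R0 * cmod c"
      and \<kappa>: "cmod (4 * c / (\<sigma> + 2 * \<theta>x + \<theta>inf)) < r0 / K" for c \<sigma>
  proof -
    let ?A = "\<sigma> + 2 * \<theta>0 - \<theta>inf" and ?B = "\<sigma> + 2 * \<theta>x + \<theta>inf"
    have c: "c \<noteq> 0" using that by auto
    then have c': "inverse c \<noteq> 0" by simp
    have "?A = \<sigma> - (- 2 * \<theta>0 + \<theta>inf)" "?B = \<sigma> - (- 2 * \<theta>x - \<theta>inf)" by simp_all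
    then have AB: "?A \<noteq> 0" "?B \<noteq> 0" using \<sigma> by (metis insertCI right_minus_eq)+
    have "R0 * cmod c \<le> R0 * R0" using that(3) R0 by (intro mult_left_mono) auto
    then have "cmod ?A \<le> R0 * R0" using small by linarith
    then have "cmod \<sigma> \<le> S"
      by (rule bound[of _ _ "- \<theta>0" "\<theta>inf"]) auto
    moreover have "cmod (inverse c * ?A) \<le> R0"
    proof -
      have "cmod (inverse c * ?A) = cmod ?A / cmod c"
        by (simp only: norm_mult norm_inverse divide_inverse mult.commute)
      then show ?thesis using small c by (simp add: pos_divide_le_eq)
    qed
    \<comment> \<open>Now ?A is the small factor. It belongs to \<open>gamma0p\<close>, so the
      unbounded power 1/c is moved there by c0 = 1/c, cx = 1.\<close>
    ultimately have w: "eps_weight \<theta>0 \<theta>x \<theta>inf (inverse c, 1, \<sigma>) < K"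
      using that(3) R0 by (intro weight) auto
    have G: "Gamma_eta \<theta>0 \<theta>x \<theta>inf (inverse c, 1, \<sigma>) = ?A * ?B / (16 * c)"
      using c by (simp add: Gamma_eta_def gamma0p_def gammaxm_def divide_simps)
    have e: "Gamma_eta \<theta>0 \<theta>x \<theta>inf (inverse c, 1, \<sigma>) * (- 4 / ?B * c) = - ?A / 4"
      unfolding G by (rule alg(2)[OF AB(2) c])
    have \<phi>: "- \<theta>0 / 2 = (\<sigma> - \<theta>inf) / 4 + Gamma_eta \<theta>0 \<theta>x \<theta>inf (inverse c, 1, \<sigma>) * (- 4 / ?B * c)"
      unfolding e by (simp add: field_simps)
    have ne: "- \<theta>0 / 2 \<noteq> (\<theta>x - \<theta>inf) / 2"
      by (rule half[of "\<theta>0 + \<theta>x - \<theta>inf"]) (use nz in \<open>simp_all add: field_simps\<close>)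
    have "has_zero_sequence (y (1 / inverse c) \<sigma>) (y_domain \<theta>0 \<theta>x \<theta>inf \<delta> r0 y (1 / inverse c) \<sigma>)
             (\<sigma> + 1) (- 4 / ?B * c)"
    proof (rule has_zero_sequence_family[OF assms(5,3,2) c' one_neq_zero w _ _ _ \<phi> _ ne])
      show "Gamma_eta \<theta>0 \<theta>x \<theta>inf (inverse c, 1, \<sigma>) \<noteq> 0" unfolding G using c AB by simp
      show "- 4 / ?B * c \<noteq> 0" using c AB by simp
      show "cmod (- 4 / ?B * c) < r0 / K" using \<kappa> by (simp add: norm_mult norm_divide)
    qed simp
    then show ?thesis by (simp add: inverse_eq_divide)
  qed
  have pole_0: "has_pole_sequence (y c \<sigma>) (y_domain \<theta>0 \<theta>x \<theta>inf \<delta> r0 y c \<sigma>)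
             (\<sigma> - 1) (- (\<sigma> - 2 * \<theta>x + \<theta>inf) / 4 * c)"
    if nz: "\<theta>0 \<noteq> 0" and "1 / R0 < cmod c"
      and \<sigma>: "\<sigma> \<notin> {2 * \<theta>0 + \<theta>inf, - 2 * \<theta>0 + \<theta>inf, 2 * \<theta>x - \<theta>inf, - 2 * \<theta>x - \<theta>inf}"
      and small: "cmod (c * (\<sigma> - 2 * \<theta>0 - \<theta>inf)) < R0"
      and \<kappa>: "cmod (4 * inverse c / (\<sigma> - 2 * \<theta>x + \<theta>inf)) < r0 / K" for c \<sigma>
  proof -
    let ?U = "\<sigma> - 2 * \<theta>x + \<theta>inf" and ?V = "\<sigma> - 2 * \<theta>0 - \<theta>inf"
    have "0 < 1 / R0" using \<open>0 < R0\<close> by simp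
    then have cpos: "0 < cmod c" using that(2) by linarith
    then have c: "c \<noteq> 0" by auto
    then have c': "inverse c \<noteq> 0" by simp
    have ci: "cmod (inverse c) < R0"
      using that(2) \<open>0 < R0\<close> cpos unfolding norm_inverse by (simp add: field_simps)
    have "?U = \<sigma> - (2 * \<theta>x - \<theta>inf)" "?V = \<sigma> - (2 * \<theta>0 + \<theta>inf)" by simp_all
    then have UV: "?U \<noteq> 0" "?V \<noteq> 0" using \<sigma> by (metis insertCI right_minus_eq)+
    have "cmod ?V = cmod (c * ?V) * cmod (inverse c)"
      using c by (simp add: norm_mult norm_inverse)
    also have "\<dots> \<le> R0 * R0" using small ci R0 by (intro mult_mono) auto
    finally have "cmod \<sigma> \<le> S"
      by (rule bound[of _ _ "\<theta>0" "\<theta>inf"]) auto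
    moreover have "cmod (c * (- \<sigma> + 2 * \<theta>0 + \<theta>inf)) \<le> R0"
      using small norm_minus_cancel[of "c * ?V"] by (simp add: algebra_simps)
    \<comment> \<open>For poles c itself is unbounded and 1/c is not. With c0 = 1/c the power c
      appears only in \<open>gamma0m\<close>, whose linear factor is -?V.\<close>
    ultimately have w: "eps_weight \<theta>0 \<theta>x \<theta>inf (inverse c, 1, \<sigma>) < K"
      using ci R0 by (intro weight) auto
    have G: "Gamma_xi \<theta>0 \<theta>x \<theta>inf (inverse c, 1, \<sigma>) = ?U * ?V * c / 16"
      using c by (simp add: Gamma_xi_def gamma0m_def gammaxp_def) (simp add: algebra_simps)
    have e: "Gamma_xi \<theta>0 \<theta>x \<theta>inf (inverse c, 1, \<sigma>) * inverse (- ?U / 4 * c) = - ?V / 4"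
      unfolding G by (rule alg(3)[OF UV(1) c])
    have \<phi>: "\<theta>0 / 2 = (\<sigma> - \<theta>inf) / 4 + Gamma_xi \<theta>0 \<theta>x \<theta>inf (inverse c, 1, \<sigma>) * inverse (- ?U / 4 * c)"
      unfolding e by (simp add: field_simps)
    have ne: "\<theta>0 / 2 \<noteq> - \<theta>0 / 2"
      by (rule half[of "- 2 * \<theta>0"]) (use nz in \<open>simp_all add: field_simps\<close>)
    have "has_pole_sequence (y (1 / inverse c) \<sigma>) (y_domain \<theta>0 \<theta>x \<theta>inf \<delta> r0 y (1 / inverse c) \<sigma>)
             (\<sigma> - 1) (- ?U / 4 * c)"
    proof (rule has_pole_sequence_family[OF assms(5,3,2) c' one_neq_zero w _ _ _ \<phi> _ ne])
      show "Gamma_xi \<theta>0 \<theta>x \<theta>inf (inverse c, 1, \<sigma>) \<noteq> 0" unfolding G using c UV by simp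
      show "- ?U / 4 * c \<noteq> 0"
        using c UV by (metis mult_eq_0_iff divide_eq_0_iff neg_equal_0_iff_equal zero_neq_numeral)
      show "cmod (inverse (- ?U / 4 * c)) < r0 / K"
        unfolding inv norm_minus_cancel by (rule \<kappa>)
    qed simp
    then show ?thesis by (simp add: inverse_eq_divide)
  qed
  have pole_x: "has_pole_sequence (y c \<sigma>) (y_domain \<theta>0 \<theta>x \<theta>inf \<delta> r0 y c \<sigma>)
             (\<sigma> - 1) (- (\<sigma> - 2 * \<theta>0 - \<theta>inf) / 4 * c)"
    if nz: "- \<theta>0 - \<theta>x + \<theta>inf \<noteq> 0" and "1 / R0 < cmod c"
      and \<sigma>: "\<sigma> \<notin> {2 * \<theta>0 + \<theta>inf, - 2 * \<theta>0 + \<theta>inf, 2 * \<theta>x - \<theta>inf, - 2 * \<theta>x - \<theta>inf}"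
      and small: "cmod (c * (\<sigma> - 2 * \<theta>x + \<theta>inf)) < R0"
      and \<kappa>: "cmod (4 * inverse c / (\<sigma> - 2 * \<theta>0 - \<theta>inf)) < r0 / K" for c \<sigma>
  proof -
    let ?U = "\<sigma> - 2 * \<theta>x + \<theta>inf" and ?V = "\<sigma> - 2 * \<theta>0 - \<theta>inf"
    have "0 < 1 / R0" using \<open>0 < R0\<close> by simp
    then have cpos: "0 < cmod c" using that(2) by linarith
    then have c: "c \<noteq> 0" by auto
    then have c': "inverse c \<noteq> 0" by simp
    have ci: "cmod (inverse c) < R0"
      using that(2) \<open>0 < R0\<close> cpos unfolding norm_inverse by (simp add: field_simps)
    have "?U = \<sigma> - (2 * \<theta>x - \<theta>inf)" "?V = \<sigma> - (2 * \<theta>0 + \<theta>inf)" by simp_all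
    then have UV: "?U \<noteq> 0" "?V \<noteq> 0" using \<sigma> by (metis insertCI right_minus_eq)+
    have "cmod ?U = cmod (c * ?U) * cmod (inverse c)"
      using c by (simp add: norm_mult norm_inverse)
    also have "\<dots> \<le> R0 * R0" using small ci R0 by (intro mult_mono) auto
    finally have "cmod \<sigma> \<le> S"
      by (rule bound[of _ _ "\<theta>x" "- \<theta>inf"]) auto
    moreover have "cmod (c * (- \<sigma> + 2 * \<theta>x - \<theta>inf)) \<le> R0"
      using small norm_minus_cancel[of "c * ?U"] by (simp add: algebra_simps)
    \<comment> \<open>The small factor is now ?U, which belongs to \<open>gammaxp\<close>; cx = c
      puts the unbounded power c there.\<close>
    ultimately have w: "eps_weight \<theta>0 \<theta>x \<theta>inf (1, c, \<sigma>) < K"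
      using ci R0 by (intro weight) auto
    have G: "Gamma_xi \<theta>0 \<theta>x \<theta>inf (1, c, \<sigma>) = ?U * ?V * c / 16"
      using c by (simp add: Gamma_xi_def gamma0m_def gammaxp_def) (simp add: algebra_simps)
    have e: "Gamma_xi \<theta>0 \<theta>x \<theta>inf (1, c, \<sigma>) * inverse (- ?V / 4 * c) = - ?U / 4"
      unfolding G by (rule alg(4)[OF UV(2) c])
    have \<phi>: "(\<theta>x - \<theta>inf) / 2 = (\<sigma> - \<theta>inf) / 4 + Gamma_xi \<theta>0 \<theta>x \<theta>inf (1, c, \<sigma>) * inverse (- ?V / 4 * c)"
      unfolding e by (simp add: field_simps)
    have ne: "(\<theta>x - \<theta>inf) / 2 \<noteq> - \<theta>0 / 2"
      by (rule half[of "- \<theta>0 - \<theta>x + \<theta>inf"]) (use nz in \<open>simp_all add: field_simps\<close>)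
    have "has_pole_sequence (y (c / 1) \<sigma>) (y_domain \<theta>0 \<theta>x \<theta>inf \<delta> r0 y (c / 1) \<sigma>)
             (\<sigma> - 1) (- ?V / 4 * c)"
    proof (rule has_pole_sequence_family[OF assms(5,3,2) one_neq_zero c w _ _ _ \<phi> _ ne])
      show "Gamma_xi \<theta>0 \<theta>x \<theta>inf (1, c, \<sigma>) \<noteq> 0" unfolding G using c UV by simp
      show "- ?V / 4 * c \<noteq> 0"
        using c UV by (metis mult_eq_0_iff divide_eq_0_iff neg_equal_0_iff_equal zero_neq_numeral)
      show "cmod (inverse (- ?V / 4 * c)) < r0 / K"
        unfolding inv norm_minus_cancel by (rule \<kappa>)
    qed simp
    then show ?thesis by (simp add: inverse_eq_divide)
  qed
  show ?thesis
  proof (intro conjI impI)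
    assume "\<theta>x * (\<theta>0 + \<theta>x - \<theta>inf) \<noteq> 0 \<and> \<theta>x * (\<theta>0 - \<theta>x - \<theta>inf) \<noteq> 0"
    then have "\<theta>x \<noteq> 0" "\<theta>0 + \<theta>x - \<theta>inf \<noteq> 0" by auto
    note Z = zero_x[OF this(1)] zero_0[OF this(2)]
    show "\<exists>\<epsilon>0>0. \<forall>c \<sigma>.
          0 < cmod c \<and> cmod c < R0 \<and>
          \<sigma> \<notin> {2 * \<theta>0 + \<theta>inf, - 2 * \<theta>0 + \<theta>inf, 2 * \<theta>x - \<theta>inf, - 2 * \<theta>x - \<theta>inf} \<longrightarrow>
          (cmod (\<sigma> + 2 * \<theta>x + \<theta>inf) < R0 * cmod c \<and>
             cmod (4 * c / (\<sigma> + 2 * \<theta>0 - \<theta>inf)) < \<epsilon>0 \<longrightarrow>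
           has_zero_sequence (y c \<sigma>) (y_domain \<theta>0 \<theta>x \<theta>inf \<delta> r0 y c \<sigma>)
             (\<sigma> + 1) (- 4 / (\<sigma> + 2 * \<theta>0 - \<theta>inf) * c)) \<and>
          (cmod (\<sigma> + 2 * \<theta>0 - \<theta>inf) < R0 * cmod c \<and>
             cmod (4 * c / (\<sigma> + 2 * \<theta>x + \<theta>inf)) < \<epsilon>0 \<longrightarrow>
           has_zero_sequence (y c \<sigma>) (y_domain \<theta>0 \<theta>x \<theta>inf \<delta> r0 y c \<sigma>)
             (\<sigma> + 1) (- 4 / (\<sigma> + 2 * \<theta>x + \<theta>inf) * c))"
      by (intro exI[of _ "r0 / K"] conjI allI impI \<epsilon>; elim conjE; rule Z; assumption)
  next
    assume "\<theta>0 * (\<theta>0 - \<theta>x + \<theta>inf) \<noteq> 0 \<and> \<theta>0 * (- \<theta>0 - \<theta>x + \<theta>inf) \<noteq> 0"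
    then have "\<theta>0 \<noteq> 0" "- \<theta>0 - \<theta>x + \<theta>inf \<noteq> 0" by auto
    note Z = pole_0[OF this(1)] pole_x[OF this(2)]
    show "\<exists>\<epsilon>0'>0. \<forall>c \<sigma>.
          cmod c > 1 / R0 \<and>
          \<sigma> \<notin> {2 * \<theta>0 + \<theta>inf, - 2 * \<theta>0 + \<theta>inf, 2 * \<theta>x - \<theta>inf, - 2 * \<theta>x - \<theta>inf} \<longrightarrow>
          (cmod (c * (\<sigma> - 2 * \<theta>0 - \<theta>inf)) < R0 \<and>
             cmod (4 * inverse c / (\<sigma> - 2 * \<theta>x + \<theta>inf)) < \<epsilon>0' \<longrightarrow>
           has_pole_sequence (y c \<sigma>) (y_domain \<theta>0 \<theta>x \<theta>inf \<delta> r0 y c \<sigma>)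
             (\<sigma> - 1) (- (\<sigma> - 2 * \<theta>x + \<theta>inf) / 4 * c)) \<and>
          (cmod (c * (\<sigma> - 2 * \<theta>x + \<theta>inf)) < R0 \<and>
             cmod (4 * inverse c / (\<sigma> - 2 * \<theta>0 - \<theta>inf)) < \<epsilon>0' \<longrightarrow>
           has_pole_sequence (y c \<sigma>) (y_domain \<theta>0 \<theta>x \<theta>inf \<delta> r0 y c \<sigma>)
             (\<sigma> - 1) (- (\<sigma> - 2 * \<theta>0 - \<theta>inf) / 4 * c))"
      by (intro exI[of _ "r0 / K"] conjI allI impI \<epsilon>; elim conjE; rule Z; assumption)
  qed
qed

end
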